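(* Let $X$ be a sequentially complete Hausdorff locally convex space over $\mathbb{C}$, let $\mathcal{P}\in\mathcal{C}_0(X)$ be a principal calibration, and let $T\in (Q_{\mathcal{P}}(X))_{0}$. Then there exists a unique unital continuous algebra morphism $$F_{T}:\mathcal{A}(\sigma_{W}(Q_{\mathcal{P}},T))\rightarrow Q_{\mathcal{P}}(X)$$ which satisfies $F_{T}(\widetilde{id})=T$, where $\widetilde{id}$ is the germ of the identity function on $\mathbb{C}$.
   Context: A calibration on $X$ is a family $\mathcal{P}$ of seminorms generating the topology of $X$; it is principal ($\mathcal{P}\in\mathcal{C}_0(X)$) if it is directed: for all $p_1,p_2\in\mathcal{P}$ there is $p_3\in\mathcal{P}$ with $p_1\le p_3$ and $p_2\le p_3$. $Q_{\mathcal{P}}(X)$ is the algebra of linear operators $T:X\to X$ such that for every $p\in\mathcal{P}$ there is $c_p>0$ with $p(Tx)\le c_p\,p(x)$ for all $x$; it carries the topology of the submultiplicative seminorms $\hat p(T)=\inf\{r>0 : p(Tx)\le r\,p(x)\ \forall x\in X\}$, $p\in\mathcal{P}$. $(Q_{\mathcal{P}}(X))_0$ is the set of bounded elements: those $T\in Q_{\mathcal{P}}(X)$ for which $\{(\alpha T)^n:n\ge1\}$ is bounded in $Q_{\mathcal{P}}(X)$ for some nonzero scalar $\alpha$. The Waelbroeck resolvent set $\rho_W(Q_{\mathcal{P}},T)$ is the set of $\lambda_0\in\mathbb{C}_\infty=\mathbb{C}\cup\{\infty\}$ having a neighborhood $V$ in $\mathbb{C}_\infty$ such that $\lambda I-T$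 is invertible in $Q_{\mathcal{P}}(X)$ for all $\lambda\in V\setminus\{\infty\}$ and $\{(\lambda I-T)^{-1}:\lambda\in V\setminus\{\infty\}\}$ is bounded in $Q_{\mathcal{P}}(X)$; $\sigma_W(Q_{\mathcal{P}},T)=\mathbb{C}_\infty\setminus\rho_W(Q_{\mathcal{P}},T)$. For $T\in(Q_{\mathcal{P}}(X))_0$ one has $\infty\notin\sigma_W(Q_{\mathcal{P}},T)$, so $\sigma_W(Q_{\mathcal{P}},T)$ is a compact subset of $\mathbb{C}$. For $D\subset\mathbb{C}$ relatively compact and open, $\mathcal{O}(D)$ is the unital algebra of complex functions holomorphic on $D$ and continuous on $\overline D$, with the norm $\sup_{z\in D}|f(z)|$. For $K\subset\mathbb{C}$ compact, $\mathcal{A}(K)$ is the unital algebra of germs on $K$: equivalence classes $\tilde f$ of functions $f\in\bigcup_D\mathcal{O}(D)$ ($D\supset K$ relatively compact open), where $f_1\in\mathcal{O}(D_1)$ and $f_2\in\mathcal{O}(D_2)$ are equivalent iff there is an open $D$ with $K\subset D\subset D_1\cap D_2$ and $f_1|_D=f_2|_D$. It carries the (locally convex) inductive limit topology of the spaces $\mathcal{O}(D)$, $D\supset K$, under the canonical maps $f\mapsto\tilde f$. *)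

theory Defs
  imports "HOL-Analysis.Analysis"
begin

section \<open>Locally convex topologies\<close>

text \<open>
  Three complex vector spaces are topologised below: a space \<open>X\<close> (a whole type), an algebra of
  operators on \<open>X\<close> (a set of functions) and an algebra of germs (a quotient set). The general
  notions therefore take the carrier, the addition and the scalar multiplication as arguments.
\<close>

definition convex_in :: "('b \<Rightarrow> 'b \<Rightarrow> 'b) \<Rightarrow> (complex \<Rightarrow> 'b \<Rightarrow> 'b) \<Rightarrow> 'b set \<Rightarrow> bool" where
  "convex_in add sc V \<longleftrightarrow>
     (\<forall>x\<in>V. \<forall>y\<in>V. \<forall>t\<in>{0..1}. add (sc (of_real t) x) (sc (of_real (1 - t)) y) \<in> V)"

definition lc_topology ::
  "'b set \<Rightarrow> ('b \<Rightarrow> 'b \<Rightarrow> 'b) \<Rightarrow> (complex \<Rightarrow> 'b \<Rightarrow> 'b) \<Rightarrow> 'b topology \<Rightarrow> bool" where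
  "lc_topology S add sc \<tau> \<longleftrightarrow>
     topspace \<tau> = S \<and>
     continuous_map (prod_topology \<tau> \<tau>) \<tau> (\<lambda>(x, y). add x y) \<and>
     continuous_map (prod_topology euclidean \<tau>) \<tau> (\<lambda>(c, x). sc c x) \<and>
     (\<forall>U x. openin \<tau> U \<and> x \<in> U \<longrightarrow>
        (\<exists>V. openin \<tau> V \<and> x \<in> V \<and> V \<subseteq> U \<and> convex_in add sc V))"

text \<open>
  The generating set contains \<open>S\<close> itself, so that the underlying set is \<open>S\<close> even for an empty
  family of seminorms.
\<close>

definition seminorm_topology :: "'b::minus set \<Rightarrow> ('b \<Rightarrow> real) set \<Rightarrow> 'b topology" where
  "seminorm_topology S P =
     topology_generated_by
       (insert S {{y \<in> S. p (y - x) < e} | p x e. p \<in> P \<and> x \<in> S \<and> 0 < e})"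

text \<open>Von Neumann boundedness; \<open>z\<close> is the zero vector.\<close>

definition bounded_in :: "(complex \<Rightarrow> 'b \<Rightarrow> 'b) \<Rightarrow> 'b \<Rightarrow> 'b topology \<Rightarrow> 'b set \<Rightarrow> bool" where
  "bounded_in sc z \<tau> B \<longleftrightarrow>
     (\<forall>U. openin \<tau> U \<and> z \<in> U \<longrightarrow> (\<exists>r>0. B \<subseteq> sc (complex_of_real r) ` U))"

definition sequentially_complete :: "'a::{ab_group_add,topological_space} set \<Rightarrow> bool" where
  "sequentially_complete S \<longleftrightarrow>
     (\<forall>x :: nat \<Rightarrow> 'a.
        (\<forall>n. x n \<in> S) \<and>
        (\<forall>U. open U \<and> 0 \<in> U \<longrightarrow> (\<exists>N. \<forall>m\<ge>N. \<forall>n\<ge>N. x m - x n \<in> U)) \<longrightarrow>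
        (\<exists>l\<in>S. x \<longlonglongrightarrow> l))"

section \<open>Calibrations and the algebra of quotient bounded operators\<close>

definition seminorm :: "(complex \<Rightarrow> 'a::ab_group_add \<Rightarrow> 'a) \<Rightarrow> ('a \<Rightarrow> real) \<Rightarrow> bool" where
  "seminorm sc p \<longleftrightarrow>
     (\<forall>x. 0 \<le> p x) \<and> (\<forall>x y. p (x + y) \<le> p x + p y) \<and> (\<forall>c x. p (sc c x) = norm c * p x)"

definition calibration ::
  "(complex \<Rightarrow> 'a::{ab_group_add,topological_space} \<Rightarrow> 'a) \<Rightarrow> ('a \<Rightarrow> real) set \<Rightarrow> bool" where
  "calibration sc P \<longleftrightarrow> (\<forall>p\<in>P. seminorm sc p) \<and> seminorm_topology UNIV P = euclidean"

definition principal_calibration ::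
  "(complex \<Rightarrow> 'a::{ab_group_add,topological_space} \<Rightarrow> 'a) \<Rightarrow> ('a \<Rightarrow> real) set \<Rightarrow> bool" where
  "principal_calibration sc P \<longleftrightarrow>
     calibration sc P \<and>
     (\<forall>p\<^sub>1\<in>P. \<forall>p\<^sub>2\<in>P. \<exists>p\<^sub>3\<in>P. (\<forall>x. p\<^sub>1 x \<le> p\<^sub>3 x) \<and> (\<forall>x. p\<^sub>2 x \<le> p\<^sub>3 x))"

definition Q_ops ::
  "(complex \<Rightarrow> 'a::ab_group_add \<Rightarrow> 'a) \<Rightarrow> ('a \<Rightarrow> real) set \<Rightarrow> ('a \<Rightarrow> 'a) set" where
  "Q_ops sc P =
     {T. Vector_Spaces.linear sc sc T \<and> (\<forall>p\<in>P. \<exists>c>0. \<forall>x. p (T x) \<le> c * p x)}"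

definition op_seminorm :: "('a \<Rightarrow> real) \<Rightarrow> ('a \<Rightarrow> 'a) \<Rightarrow> real" where
  "op_seminorm p T = Inf {r. 0 < r \<and> (\<forall>x. p (T x) \<le> r * p x)}"

definition Q_topology ::
  "(complex \<Rightarrow> 'a::ab_group_add \<Rightarrow> 'a) \<Rightarrow> ('a \<Rightarrow> real) set \<Rightarrow> ('a \<Rightarrow> 'a) topology" where
  "Q_topology sc P = seminorm_topology (Q_ops sc P) (op_seminorm ` P)"

definition Q_bounded ::
  "(complex \<Rightarrow> 'a::ab_group_add \<Rightarrow> 'a) \<Rightarrow> ('a \<Rightarrow> real) set \<Rightarrow> ('a \<Rightarrow> 'a) set \<Rightarrow> bool" where
  "Q_bounded sc P B \<longleftrightarrow>
     bounded_in (\<lambda>c A x. sc c (A x)) (\<lambda>x. 0) (Q_topology sc P) B"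

definition Q_bounded_elements ::
  "(complex \<Rightarrow> 'a::ab_group_add \<Rightarrow> 'a) \<Rightarrow> ('a \<Rightarrow> real) set \<Rightarrow> ('a \<Rightarrow> 'a) set" where
  "Q_bounded_elements sc P =
     {T \<in> Q_ops sc P. \<exists>\<alpha>. \<alpha> \<noteq> 0 \<and> Q_bounded sc P {(\<lambda>x. sc \<alpha> (T x)) ^^ n | n. 1 \<le> n}}"

definition Q_invertible ::
  "(complex \<Rightarrow> 'a::ab_group_add \<Rightarrow> 'a) \<Rightarrow> ('a \<Rightarrow> real) set \<Rightarrow> ('a \<Rightarrow> 'a) \<Rightarrow> bool" where
  "Q_invertible sc P A \<longleftrightarrow> A \<in> Q_ops sc P \<and> (\<exists>B \<in> Q_ops sc P. A \<circ> B = id \<and> B \<circ> A = id)"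

section \<open>The Waelbroeck spectrum\<close>

text \<open>The extended plane is \<open>complex option\<close>, with \<open>None\<close> for the point at infinity.\<close>

abbreviation riemann_sphere :: "complex option topology" where
  "riemann_sphere \<equiv> Alexandroff_compactification euclidean"

definition waelbroeck_resolvent_set ::
  "(complex \<Rightarrow> 'a::ab_group_add \<Rightarrow> 'a) \<Rightarrow> ('a \<Rightarrow> real) set \<Rightarrow> ('a \<Rightarrow> 'a) \<Rightarrow> complex option set"
  where
  "waelbroeck_resolvent_set sc P T =
     {w. \<exists>V. (\<exists>U. openin riemann_sphere U \<and> w \<in> U \<and> U \<subseteq> V) \<and>
        (\<forall>l. Some l \<in> V \<longrightarrow> Q_invertible sc P (\<lambda>x. sc l x - T x)) \<and>
        Q_bounded sc P {inv (\<lambda>x. sc l x - T x) | l. Some l \<in> V}}"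

definition waelbroeck_spectrum ::
  "(complex \<Rightarrow> 'a::ab_group_add \<Rightarrow> 'a) \<Rightarrow> ('a \<Rightarrow> real) set \<Rightarrow> ('a \<Rightarrow> 'a) \<Rightarrow> complex option set"
  where
  "waelbroeck_spectrum sc P T = UNIV - waelbroeck_resolvent_set sc P T"

section \<open>Germs of holomorphic functions\<close>

text \<open>
  Functions on \<open>closure D\<close> are represented by total functions, whose values outside \<open>closure D\<close>
  are ignored: neither the norm nor the germ of a function depends on them.
\<close>

definition hol_space :: "complex set \<Rightarrow> (complex \<Rightarrow> complex) set" where
  "hol_space D = {f. f holomorphic_on D \<and> continuous_on (closure D) f}"

definition sup_norm :: "complex set \<Rightarrow> (complex \<Rightarrow> complex) \<Rightarrow> real" where
  "sup_norm D f = (if D = {} then 0 else SUP z\<in>D. norm (f z))"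

definition hol_topology :: "complex set \<Rightarrow> (complex \<Rightarrow> complex) topology" where
  "hol_topology D = seminorm_topology (hol_space D) {sup_norm D}"

definition germ_nbhds :: "complex set \<Rightarrow> complex set set" where
  "germ_nbhds K = {D. open D \<and> bounded D \<and> K \<subseteq> D}"

type_synonym germ = "(complex set \<times> (complex \<Rightarrow> complex)) set"

definition germ_reps :: "complex set \<Rightarrow> (complex set \<times> (complex \<Rightarrow> complex)) set" where
  "germ_reps K = (SIGMA D:germ_nbhds K. hol_space D)"

definition germ_rel ::
  "complex set \<Rightarrow> ((complex set \<times> (complex \<Rightarrow> complex)) \<times> (complex set \<times> (complex \<Rightarrow> complex))) set"
  where
  "germ_rel K =
     {((D\<^sub>1, f\<^sub>1), (D\<^sub>2, f\<^sub>2)). (D\<^sub>1, f\<^sub>1) \<in> germ_reps K \<and> (D\<^sub>2, f\<^sub>2) \<in> germ_reps K \<and>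
        (\<exists>D. open D \<and> K \<subseteq> D \<and> D \<subseteq> D\<^sub>1 \<inter> D\<^sub>2 \<and> (\<forall>z\<in>D. f\<^sub>1 z = f\<^sub>2 z))}"

definition germs :: "complex set \<Rightarrow> germ set" where
  "germs K = germ_reps K // germ_rel K"

definition germ_of :: "complex set \<Rightarrow> complex set \<Rightarrow> (complex \<Rightarrow> complex) \<Rightarrow> germ" where
  "germ_of K D f = germ_rel K `` {(D, f)}"

text \<open>
  In the next four definitions all sets in the union are equal, the germ not depending on the
  chosen representatives (in the last one, on the chosen neighbourhood).
\<close>

definition germ_add :: "complex set \<Rightarrow> germ \<Rightarrow> germ \<Rightarrow> germ" where
  "germ_add K a b = (\<Union>(D, f)\<in>a. \<Union>(E, g)\<in>b. germ_of K (D \<inter> E) (\<lambda>z. f z + g z))"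

definition germ_mult :: "complex set \<Rightarrow> germ \<Rightarrow> germ \<Rightarrow> germ" where
  "germ_mult K a b = (\<Union>(D, f)\<in>a. \<Union>(E, g)\<in>b. germ_of K (D \<inter> E) (\<lambda>z. f z * g z))"

definition germ_scale :: "complex set \<Rightarrow> complex \<Rightarrow> germ \<Rightarrow> germ" where
  "germ_scale K c a = (\<Union>(D, f)\<in>a. germ_of K D (\<lambda>z. c * f z))"

definition germ_entire :: "complex set \<Rightarrow> (complex \<Rightarrow> complex) \<Rightarrow> germ" where
  "germ_entire K f = (\<Union>D\<in>germ_nbhds K. germ_of K D f)"

text \<open>
  The inductive limit topology is the finest locally convex topology for which all canonical maps
  are continuous. It is obtained as the join of all these topologies, which is again one of them.
\<close>

definition germ_topology :: "complex set \<Rightarrow> germ topology" where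
  "germ_topology K =
     topology_generated_by
       (\<Union>{{U. openin \<tau> U} | \<tau>. lc_topology (germs K) (germ_add K) (germ_scale K) \<tau> \<and>
             (\<forall>D\<in>germ_nbhds K. continuous_map (hol_topology D) \<tau> (germ_of K D))})"

text \<open>
  Membership in the extensional function space makes \<open>F\<close> a function on the germs only, so that
  uniqueness can be stated as an equality of functions.
\<close>

definition unital_algebra_morphism ::
  "(complex \<Rightarrow> 'a::ab_group_add \<Rightarrow> 'a) \<Rightarrow> ('a \<Rightarrow> real) set \<Rightarrow> complex set \<Rightarrow> (germ \<Rightarrow> 'a \<Rightarrow> 'a) \<Rightarrow> bool"
  where
  "unital_algebra_morphism sc P K F \<longleftrightarrow>
     F \<in> germs K \<rightarrow>\<^sub>E Q_ops sc P \<and>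
     (\<forall>a\<in>germs K. \<forall>b\<in>germs K. F (germ_add K a b) = (\<lambda>x. F a x + F b x)) \<and>
     (\<forall>c. \<forall>a\<in>germs K. F (germ_scale K c a) = (\<lambda>x. sc c (F a x))) \<and>
     (\<forall>a\<in>germs K. \<forall>b\<in>germs K. F (germ_mult K a b) = F a \<circ> F b) \<and>
     F (germ_entire K (\<lambda>z. 1)) = id"

end

theory Submission
  imports Defs "HOL-Complex_Analysis.Complex_Analysis"
begin

text \<open>
  The calculus is the Cauchy integral \<open>(1 / 2 \<pi> \<i>) \<integral> f(z) (z - T)\<^sup>-\<^sup>1 dz\<close> over a cycle around the
  Waelbroeck spectrum \<open>K\<close> inside the domain of \<open>f\<close>. The proof integrates only scalar functions and reaches
  operators through rational functions and limits.

  Boundedness of \<open>T\<close> makes the Neumann series converge outside a disc, with bounds that are uniform in the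
  parameter (\<open>Neumann_series\<close>). So \<open>K\<close> is compact and the resolvent is close to \<open>1 / z\<close> at infinity. The
  local boundedness in the definition of the Waelbroeck resolvent set, together with the resolvent identity,
  makes \<open>\<phi> (R z x)\<close> holomorphic off \<open>K\<close> for every functional \<open>\<phi>\<close> dominated by a seminorm of the
  calibration.

  The operator \<open>r(T)\<close> is defined by algebra when \<open>r\<close> is a rational function with poles off \<open>K\<close>. The heart of
  the proof is the estimate \<open>rational_calculus_estimate\<close>: for a neighbourhood \<open>W\<close> of \<open>K\<close>, the operator
  seminorm of \<open>r(T)\<close> is at most a constant times the supremum of \<open>r\<close> over \<open>W\<close>. It holds because
  \<open>\<phi> (r(T) x)\<close> is the Cauchy integral of \<open>r(z) \<phi> (R z x)\<close>: the difference of the two integrands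
  extends holomorphically over \<open>K\<close> (\<open>rational_calculus_extension\<close>), and the integral of \<open>\<phi> (R z y)\<close>
  is \<open>2 \<pi> \<i> \<phi> y\<close> by the behaviour at infinity (\<open>cycle_integral_resolvent\<close>). The Hahn-Banach theorem
  recovers the seminorm from the functionals. The cycles exist around every compact set
  (\<open>exists_cauchy_cycle\<close>).

  By Runge's theorem every function holomorphic near \<open>K\<close> is a uniform limit of such rational functions on a
  smaller neighbourhood (\<open>Runge_approximation\<close>), and by the estimate the corresponding operators form a
  Cauchy sequence, which converges because the algebra of quotient bounded operators is sequentially complete
  (\<open>Q_complete\<close>). The estimate passes to the limit. It shows that the limit depends on the germ only and that
  the resulting map is continuous on functions with the supremum norm. The map is an algebra morphism because
  it is one on rational functions, and it is continuous for the inductive limit topology because the topology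
  that it pulls back to the germs is locally convex (\<open>lc_calculus_topology\<close>). Uniqueness follows from the same
  density: a morphism has no choice on rational functions, and a continuous one has none on their limits.
\<close>

section \<open>The Hahn-Banach theorem for seminorms\<close>

text \<open>
  Homogeneity is asked for as an inequality only: this half passes to infima at once, and applying
  it to \<open>t\<close> and to \<open>1 / t\<close> gives back the equality.
\<close>

definition sublinear :: "(complex \<Rightarrow> 'a::ab_group_add \<Rightarrow> 'a) \<Rightarrow> ('a \<Rightarrow> real) \<Rightarrow> bool" where
  "sublinear sc q \<longleftrightarrow>
     (\<forall>x y. q (x + y) \<le> q x + q y) \<and> (\<forall>t\<ge>0. \<forall>x. q (sc (of_real t) x) \<le> t * q x)"

context
  fixes sc :: "complex \<Rightarrow> 'a::ab_group_add \<Rightarrow> 'a"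
  assumes vs: "vector_space sc"
begin

interpretation vector_space sc by (rule vs)

lemma sublinear_zero:
  assumes "sublinear sc q"
  shows "q 0 = 0"
proof -
  have "q (0 + 0) \<le> q 0 + q 0" "q (sc (of_real 0) 0) \<le> 0 * q 0"
    using assms unfolding sublinear_def by blast+
  then show ?thesis by simp
qed

lemma sublinear_scale:
  assumes q: "sublinear sc q" and t: "t \<ge> 0"
  shows "q (sc (of_real t) x) = t * q x"
proof (cases "t = 0")
  case True
  then show ?thesis using sublinear_zero[OF q] by simp
next
  case False
  have "q (sc (of_real (1/t)) (sc (of_real t) x)) \<le> (1/t) * q (sc (of_real t) x)"
    using q t unfolding sublinear_def by (metis divide_nonneg_nonneg zero_le_one)
  moreover have "q (sc (of_real t) x) \<le> t * q x" using q t unfolding sublinear_def by blast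
  ultimately show ?thesis using False t by (simp add: field_simps)
qed

lemma sublinear_minus:
  assumes q: "sublinear sc q"
  shows "- q (- x) \<le> q x"
  using q sublinear_zero[OF q] unfolding sublinear_def
  by (smt (verit) add.right_inverse)

text \<open>
  \<open>tilt q y\<close> is the largest sublinear \<open>r \<le> q\<close> with \<open>r (- y) \<le> - q y\<close>: any such \<open>r\<close> satisfies
  \<open>r x \<le> r (x + t y) + t r (- y) \<le> q (x + t y) - t q y\<close>.
\<close>

definition tilt :: "('a \<Rightarrow> real) \<Rightarrow> 'a \<Rightarrow> 'a \<Rightarrow> real" where
  "tilt q y x = (INF t\<in>{0..}. q (x + sc (of_real t) y) - t * q y)"

lemma tilt_le:
  assumes q: "sublinear sc q" and t: "t \<ge> 0"
  shows "tilt q y x \<le> q (x + sc (of_real t) y) - t * q y"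
  unfolding tilt_def
proof (rule cINF_lower)
  show "bdd_below ((\<lambda>t. q (x + sc (complex_of_real t) y) - t * q y) ` {0..})"
  proof (rule bdd_belowI2)
    fix t :: real assume "t \<in> {0..}"
    then have t: "t \<ge> 0" by simp
    have "q ((x + sc (of_real t) y) + - x) \<le> q (x + sc (of_real t) y) + q (- x)"
      using q unfolding sublinear_def by blast
    then show "- q (- x) \<le> q (x + sc (complex_of_real t) y) - t * q y"
      using sublinear_scale[OF q t, of y] by simp
  qed
qed (use t in auto)

lemma le_tilt:
  assumes "\<And>t. t \<ge> 0 \<Longrightarrow> m \<le> q (x + sc (of_real t) y) - t * q y"
  shows "m \<le> tilt q y x"
  unfolding tilt_def by (rule cINF_greatest) (use assms in auto)

lemma sublinear_tilt:
  assumes q: "sublinear sc q"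
  shows "sublinear sc (tilt q y)"
  unfolding sublinear_def
proof (intro conjI allI impI)
  fix x1 x2
  have "tilt q y (x1 + x2) - (q (x2 + sc (of_real t2) y) - t2 * q y) \<le> tilt q y x1" if t2: "t2 \<ge> 0" for t2
  proof (rule le_tilt)
    fix t1 :: real assume t1: "t1 \<ge> 0"
    have "tilt q y (x1 + x2) \<le> q (x1 + x2 + sc (of_real (t1 + t2)) y) - (t1 + t2) * q y"
      by (rule tilt_le[OF q]) (use t1 t2 in auto)
    also have "x1 + x2 + sc (of_real (t1 + t2)) y = (x1 + sc (of_real t1) y) + (x2 + sc (of_real t2) y)"
      by (simp add: scale_left_distrib algebra_simps)
    also have "q \<dots> \<le> q (x1 + sc (of_real t1) y) + q (x2 + sc (of_real t2) y)"
      using q unfolding sublinear_def by blast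
    finally show "tilt q y (x1 + x2) - (q (x2 + sc (of_real t2) y) - t2 * q y)
      \<le> q (x1 + sc (of_real t1) y) - t1 * q y" by (simp add: algebra_simps)
  qed
  then have "tilt q y (x1 + x2) - tilt q y x1 \<le> tilt q y x2"
    by (intro le_tilt) (simp add: algebra_simps)
  then show "tilt q y (x1 + x2) \<le> tilt q y x1 + tilt q y x2" by simp
next
  fix s :: real and x
  assume s: "s \<ge> 0"
  show "tilt q y (sc (of_real s) x) \<le> s * tilt q y x"
  proof (cases "s = 0")
    case True
    then show ?thesis using tilt_le[OF q, of 0 y 0] sublinear_zero[OF q] by simp
  next
    case False
    have "tilt q y (sc (of_real s) x) / s \<le> tilt q y x"
    proof (rule le_tilt)
      fix t :: real assume t: "t \<ge> 0"
      have "tilt q y (sc (of_real s) x) \<le> q (sc (of_real s) x + sc (of_real (s * t)) y) - s * t * q y"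
        by (rule tilt_le[OF q]) (use s t in auto)
      also have "sc (of_real s) x + sc (of_real (s * t)) y = sc (of_real s) (x + sc (of_real t) y)"
        by (simp add: scale_right_distrib)
      also have "q \<dots> \<le> s * q (x + sc (of_real t) y)"
        using q s unfolding sublinear_def by blast
      finally show "tilt q y (sc (of_real s) x) / s \<le> q (x + sc (of_real t) y) - t * q y"
        using s False by (simp add: field_simps)
    qed
    then show ?thesis using s False by (simp add: field_simps)
  qed
qed

text \<open>
  Zorn's lemma downwards. The pointwise infimum of a chain is finite because every sublinear
  \<open>q \<le> p\<close> satisfies \<open>q x \<ge> - p (- x)\<close>, and subadditivity survives because any two members of
  a chain have a common lower bound in it.
\<close>

lemma exists_minimal_sublinear:
  assumes p: "sublinear sc p"
  obtains q where "sublinear sc q" "q \<le> p"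
    "\<And>r. sublinear sc r \<Longrightarrow> r \<le> q \<Longrightarrow> r = q"
proof -
  define A where "A = {q. sublinear sc q \<and> q \<le> p}"
  have "\<exists>m\<in>A. \<forall>a\<in>A. a \<le> m \<longrightarrow> a = m"
  proof (rule predicate_Zorn[where P = "\<lambda>m a. a \<le> m"])
    show "partial_order_on A (relation_of (\<lambda>m a. a \<le> m) A)"
      by (rule partial_order_on_relation_ofI) auto
    fix C assume C: "C \<in> Chains (relation_of (\<lambda>m a. a \<le> m) A)"
    then have CA: "C \<subseteq> A" by (rule Chains_relation_of)
    have tot: "q1 \<le> q2 \<or> q2 \<le> q1" if "q1 \<in> C" "q2 \<in> C" for q1 q2
      using C that unfolding Chains_def relation_of_def by blast
    show "\<exists>u\<in>A. \<forall>a\<in>C. u \<le> a"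
    proof (cases "C = {}")
      case True
      then show ?thesis using p by (auto simp: A_def)
    next
      case False
      define u where "u x = (INF q\<in>C. q x)" for x
      have u_le: "u x \<le> q x" if "q \<in> C" for q x
        unfolding u_def
      proof (rule cINF_lower[OF _ that])
        show "bdd_below ((\<lambda>q. q x) ` C)"
        proof (rule bdd_belowI2)
          fix q assume "q \<in> C"
          then have "sublinear sc q" "q (- x) \<le> p (- x)" using CA by (auto simp: A_def le_fun_def)
          then show "- p (- x) \<le> q x" using sublinear_minus[of q x] by linarith
        qed
      qed
      have le_u: "m \<le> u x" if "\<And>q. q \<in> C \<Longrightarrow> m \<le> q x" for m x
        unfolding u_def using False that by (intro cINF_greatest) auto
      have "sublinear sc u"
        unfolding sublinear_def
      proof (intro conjI allI impI)
        fix x y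
        have "u (x + y) - q2 y \<le> u x" if q2: "q2 \<in> C" for q2
        proof (rule le_u)
          fix q1 assume q1: "q1 \<in> C"
          obtain q where q: "q \<in> C" "q \<le> q1" "q \<le> q2" using tot[OF q1 q2] q1 q2 by blast
          have "u (x + y) \<le> q (x + y)" using u_le q by blast
          also have "\<dots> \<le> q x + q y" using q(1) CA unfolding A_def sublinear_def by blast
          also have "\<dots> \<le> q1 x + q2 y" using q by (simp add: le_fun_def add_mono)
          finally show "u (x + y) - q2 y \<le> q1 x" by simp
        qed
        then have "u (x + y) - u x \<le> u y" by (intro le_u) (simp add: algebra_simps)
        then show "u (x + y) \<le> u x + u y" by simp
      next
        fix t :: real and x assume t: "t \<ge> 0"
        have sub: "u (sc (of_real t) x) \<le> t * q x" if "q \<in> C" for q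
        proof -
          have "sublinear sc q" using that CA by (auto simp: A_def)
          then have "q (sc (of_real t) x) \<le> t * q x" using sublinear_scale[OF _ t, of q x] by simp
          then show ?thesis using u_le[OF that, of "sc (of_real t) x"] by linarith
        qed
        show "u (sc (of_real t) x) \<le> t * u x"
        proof (cases "t = 0")
          case True
          then show ?thesis using sub False by auto
        next
          case t0: False
          have "u (sc (of_real t) x) / t \<le> u x"
            by (rule le_u) (use sub t t0 in \<open>simp add: field_simps\<close>)
          then show ?thesis using t t0 by (simp add: field_simps)
        qed
      qed
      moreover have "u \<le> p"
        proof -
        obtain q where "q \<in> C" using False by blast
        then have "q \<le> p" "\<And>x. u x \<le> q x" using u_le CA by (auto simp: A_def)
        then show ?thesis unfolding le_fun_def by (meson order_trans)
      qed
      ultimately show ?thesis using u_le by (auto simp: A_def le_fun_def)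
    qed
  qed
  then obtain m where "m \<in> A" "\<And>a. a \<in> A \<Longrightarrow> a \<le> m \<Longrightarrow> a = m" by blast
  then have m: "sublinear sc m" "m \<le> p" and min: "\<And>a. sublinear sc a \<Longrightarrow> a \<le> p \<Longrightarrow> a \<le> m \<Longrightarrow> a = m"
    by (auto simp: A_def)
  show thesis
    by (rule that[OF m]) (use min m(2) order_trans in blast)
qed

text \<open>
  A minimal sublinear functional cannot be lowered by tilting it, so it is odd, and an odd sublinear
  functional is linear. Minimising below \<open>tilt p x0\<close> instead of \<open>p\<close> prevents the value at \<open>x0\<close>
  from dropping below \<open>p x0\<close>.
\<close>

lemma exists_dominated_real_functional:
  assumes p: "sublinear sc p"
  obtains u where "\<And>x y. u (x + y) = u x + u y" "\<And>t x. u (sc (of_real t) x) = t * u x"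
    "\<And>x. u x \<le> p x" "u x0 = p x0"
proof -
  obtain u where u: "sublinear sc u" "u \<le> tilt p x0"
    and min: "\<And>r. sublinear sc r \<Longrightarrow> r \<le> u \<Longrightarrow> r = u"
    by (rule exists_minimal_sublinear[OF sublinear_tilt[OF p, of x0]]) blast
  have le_p: "u x \<le> p x" for x
    using u(2) tilt_le[OF p, of 0 x0 x] by (auto simp: le_fun_def intro: order_trans)
  have neg: "u (- y) = - u y" for y
  proof -
    have "tilt u y \<le> u" using tilt_le[OF u(1), of 0 y] by (auto simp: le_fun_def)
    then have "tilt u y = u" by (intro min sublinear_tilt u(1))
    then have "u (- y) \<le> - u y"
      using tilt_le[OF u(1), of 1 y "- y"] sublinear_zero[OF u(1)] by simp
    then show ?thesis using sublinear_minus[OF u(1), of y] by simp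
  qed
  have add: "u (x + y) = u x + u y" for x y
  proof -
    have "u (x + y + - y) \<le> u (x + y) + u (- y)" "u (x + y) \<le> u x + u y"
      using u(1) unfolding sublinear_def by blast+
    then show ?thesis by (simp add: neg)
  qed
  have "u (sc (of_real t) x) = t * u x" for t x
  proof (cases "t \<ge> 0")
    case True
    then show ?thesis by (rule sublinear_scale[OF u(1)])
  next
    case False
    have "u (sc (of_real (- t)) x) = - t * u x" using False by (intro sublinear_scale[OF u(1)]) simp
    then show ?thesis by (simp add: neg)
  qed
  moreover have "u x0 = p x0"
  proof -
    have "u (- x0) \<le> - p x0"
      using u(2) tilt_le[OF p, of 1 x0 "- x0"] sublinear_zero[OF p]
      by (auto simp: le_fun_def intro: order_trans)
    then show ?thesis using neg le_p[of x0] by simp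
  qed
  ultimately show thesis using that add le_p by blast
qed

end

definition dominated_functional ::
  "(complex \<Rightarrow> 'a::ab_group_add \<Rightarrow> 'a) \<Rightarrow> ('a \<Rightarrow> real) \<Rightarrow> ('a \<Rightarrow> complex) \<Rightarrow> bool" where
  "dominated_functional sc p \<phi> \<longleftrightarrow>
     (\<forall>x y. \<phi> (x + y) = \<phi> x + \<phi> y) \<and> (\<forall>c x. \<phi> (sc c x) = c * \<phi> x) \<and> (\<forall>x. norm (\<phi> x) \<le> p x)"

text \<open>
  The complex functional is built from its real part \<open>u\<close> as \<open>u x - \<i> u (\<i> x)\<close>; rotating \<open>x\<close> so
  that its value becomes a nonnegative real turns the bound on \<open>u\<close> into a bound on the modulus.
\<close>

theorem Hahn_Banach_seminorm:
  assumes vs: "vector_space sc" and p: "seminorm sc p"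
  obtains \<phi> where "dominated_functional sc p \<phi>" "norm (\<phi> x0) = p x0"
proof -
  interpret vector_space sc by (rule vs)
  have "sublinear sc p" using p unfolding seminorm_def sublinear_def by auto
  then obtain u where add: "\<And>x y. u (x + y) = u x + u y"
    and scale: "\<And>t x. u (sc (of_real t) x) = t * u x"
    and le: "\<And>x. u x \<le> p x" and eq: "u x0 = p x0"
    by (rule exists_dominated_real_functional[OF vs, where ?x0.0 = x0]) blast
  define \<phi> where "\<phi> x = Complex (u x) (- u (sc \<i> x))" for x
  have 1: "\<phi> (x + y) = \<phi> x + \<phi> y" for x y
    by (simp add: \<phi>_def add scale_right_distrib complex_eq_iff)
  have 2: "\<phi> (sc c x) = c * \<phi> x" for c x
  proof -
    have *: "u (sc c x) = Re c * u x + Im c * u (sc \<i> x)" for c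
    proof -
      have "sc c x = sc (of_real (Re c)) x + sc (of_real (Im c)) (sc \<i> x)"
        by (simp add: scale_left_distrib[symmetric] complex_eq_iff)
      then show ?thesis by (simp only: add scale)
    qed
    have "u (sc \<i> (sc c x)) = - Im c * u x + Re c * u (sc \<i> x)"
      using *[of "\<i> * c"] by (simp del: scale_left_commute)
    then show ?thesis by (simp add: \<phi>_def complex_eq_iff *[of c] algebra_simps)
  qed
  have 3: "norm (\<phi> x) \<le> p x" for x
  proof (cases "\<phi> x = 0")
    case True
    then show ?thesis using p by (simp add: seminorm_def)
  next
    case False
    \<comment> \<open>the unimodular factor that rotates \<open>\<phi> x\<close> to its modulus\<close>
    define w where "w = cnj (\<phi> x) / norm (\<phi> x)"
    have "\<phi> (sc w x) = of_real (norm (\<phi> x))"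
      using False by (simp add: 2 w_def complex_norm_square[symmetric] mult.commute[of "cnj _"] power2_eq_square)
    then have "u (sc w x) = norm (\<phi> x)" by (simp add: \<phi>_def complex_eq_iff)
    moreover have "p (sc w x) = p x" using p False by (simp add: seminorm_def w_def norm_divide)
    ultimately show ?thesis using le[of "sc w x"] by simp
  qed
  have "p x0 \<le> norm (\<phi> x0)"
    using complex_Re_le_cmod[of "\<phi> x0"] by (simp add: \<phi>_def eq)
  then have "norm (\<phi> x0) = p x0" using 3[of x0] by simp
  moreover have "dominated_functional sc p \<phi>" unfolding dominated_functional_def using 1 2 3 by blast
  ultimately show thesis using that by blast
qed

section \<open>Cauchy cycles around a compact set\<close>

text \<open>
  A cycle in \<open>U - K\<close>, given as a finite family of weighted segments, that bounds inside \<open>U\<close> and is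
  homologous in \<open>- K\<close> to a large circle. Both homological conditions are expressed by the integrals
  they force, because only these are used. In the last clause, \<open>k z = L / z + O(1 / z\<^sup>2)\<close> at infinity,
  and \<open>L\<close> is the coefficient picked up by the large circle; \<open>k z = 1 / (z - z\<^sub>0)\<close> with \<open>z\<^sub>0 \<in> K\<close>
  and scalar functions of the resolvent are instances.
\<close>

definition cauchy_cycle ::
  "complex set \<Rightarrow> complex set \<Rightarrow> 'i set \<Rightarrow> ('i \<Rightarrow> complex) \<Rightarrow> ('i \<Rightarrow> complex) \<Rightarrow> ('i \<Rightarrow> complex) \<Rightarrow> bool"
  where
  "cauchy_cycle K U I w a b \<longleftrightarrow>
     finite I \<and>
     (\<forall>i\<in>I. closed_segment (a i) (b i) \<subseteq> U - K) \<and>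
     (\<forall>f. f holomorphic_on U \<longrightarrow> (\<Sum>i\<in>I. w i * contour_integral (linepath (a i) (b i)) f) = 0) \<and>
     (\<forall>k L \<rho> M. k holomorphic_on (- K) \<and> (\<forall>z. norm z > \<rho> \<longrightarrow> norm (z * (z * k z - L)) \<le> M) \<longrightarrow>
        (\<Sum>i\<in>I. w i * contour_integral (linepath (a i) (b i)) k) = 2 * pi * \<i> * L)"

text \<open>
  The grid is shifted by half a mesh so that \<open>0\<close> lies inside a cell and on no edge, which keeps
  \<open>1 / z\<close> integrable along all edges.
\<close>

definition grid_pt :: "real \<Rightarrow> int \<Rightarrow> int \<Rightarrow> complex" where
  "grid_pt d m n = Complex (d * (of_int m - 1/2)) (d * (of_int n - 1/2))"

definition cell :: "real \<Rightarrow> int \<times> int \<Rightarrow> complex set" where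
  "cell d = (\<lambda>(m, n). cbox (grid_pt d m n) (grid_pt d (m + 1) (n + 1)))"

text \<open>
  The flag distinguishes the horizontal edge that starts at a grid point from the vertical one.
\<close>

type_synonym edge = "bool \<times> int \<times> int"

definition src :: "real \<Rightarrow> edge \<Rightarrow> complex" where
  "src d = (\<lambda>(h, m, n). grid_pt d m n)"

definition tgt :: "real \<Rightarrow> edge \<Rightarrow> complex" where
  "tgt d = (\<lambda>(h, m, n). if h then grid_pt d (m + 1) n else grid_pt d m (n + 1))"

text \<open>
  The coefficient of an edge in the sum of the counterclockwise boundaries of the cells in \<open>S\<close>.
\<close>

definition edge_weight :: "(int \<times> int) set \<Rightarrow> edge \<Rightarrow> int" where
  "edge_weight S = (\<lambda>(h, m, n).
     if h then of_bool ((m, n) \<in> S) - of_bool ((m, n - 1) \<in> S)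
     else of_bool ((m - 1, n) \<in> S) - of_bool ((m, n) \<in> S))"

definition boundary_edges :: "(int \<times> int) set \<Rightarrow> edge set" where
  "boundary_edges S = {e. edge_weight S e \<noteq> 0}"

definition cell_sum :: "(edge \<Rightarrow> complex) \<Rightarrow> int \<times> int \<Rightarrow> complex" where
  "cell_sum G = (\<lambda>(m, n). G (True, m, n) + G (False, m + 1, n) - G (True, m, n + 1) - G (False, m, n))"

lemma finite_boundary_edges:
  assumes "finite S"
  shows "finite (boundary_edges S)"
proof (rule finite_subset)
  show "boundary_edges S \<subseteq> UNIV \<times> (S \<union> (\<lambda>(m, n). (m, n + 1)) ` S \<union> (\<lambda>(m, n). (m + 1, n)) ` S)"
    by (force simp: boundary_edges_def edge_weight_def image_iff split: if_splits)
qed (use assms in simp)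

text \<open>
  An edge between two cells of \<open>S\<close> is traversed once in each direction. This purely combinatorial
  cancellation holds for any edge function \<open>G\<close>, even for one that has arbitrary values on the edges
  that cancel; integrals that do not exist, or differences of a function that is a primitive only
  far away, are therefore allowed.
\<close>

lemma sum_cell_sum:
  assumes S: "finite S"
  shows "(\<Sum>q\<in>S. cell_sum G q) = (\<Sum>e\<in>boundary_edges S. of_int (edge_weight S e) * G e)"
proof -
  define B where "B = S \<union> (\<lambda>(m, n). (m, n + 1)) ` S \<union> (\<lambda>(m, n). (m + 1, n)) ` S"
  have B: "finite B" "S \<subseteq> B" using S by (auto simp: B_def)
  have shift: "(\<Sum>q\<in>S. g (s q)) = (\<Sum>q\<in>B. of_bool (q \<in> s ` S) * g q)"
    if "inj s" "s ` S \<subseteq> B" for s :: "int \<times> int \<Rightarrow> int \<times> int" and g :: "int \<times> int \<Rightarrow> complex"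
  proof -
    have "(\<Sum>q\<in>S. g (s q)) = (\<Sum>q\<in>s ` S. g q)"
      using that(1) by (simp add: sum.reindex inj_on_subset)
    also have "\<dots> = (\<Sum>q\<in>B. of_bool (q \<in> s ` S) * g q)"
      using B(1) that(2) by (intro sum.mono_neutral_cong_left) auto
    finally show ?thesis .
  qed
  have "(\<Sum>q\<in>S. cell_sum G q) =
     (\<Sum>q\<in>S. G (True, q)) + (\<Sum>q\<in>S. G (False, (\<lambda>(m, n). (m + 1, n)) q))
     - (\<Sum>q\<in>S. G (True, (\<lambda>(m, n). (m, n + 1)) q)) - (\<Sum>q\<in>S. G (False, q))"
    by (simp add: cell_sum_def case_prod_unfold sum.distrib sum_subtractf)
  also have "(\<Sum>q\<in>S. G (True, q)) = (\<Sum>q\<in>B. of_bool (q \<in> S) * G (True, q))"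
    using shift[of "\<lambda>q. q" "\<lambda>q. G (True, q)"] B by simp
  also have "(\<Sum>q\<in>S. G (False, q)) = (\<Sum>q\<in>B. of_bool (q \<in> S) * G (False, q))"
    using shift[of "\<lambda>q. q" "\<lambda>q. G (False, q)"] B by simp
  also have "(\<Sum>q\<in>S. G (False, (\<lambda>(m, n). (m + 1, n)) q)) =
      (\<Sum>q\<in>B. of_bool (q \<in> (\<lambda>(m, n). (m + 1, n)) ` S) * G (False, q))"
    by (rule shift[of _ "\<lambda>q. G (False, q)"]) (auto simp: inj_def B_def)
  also have "(\<Sum>q\<in>S. G (True, (\<lambda>(m, n). (m, n + 1)) q)) =
      (\<Sum>q\<in>B. of_bool (q \<in> (\<lambda>(m, n). (m, n + 1)) ` S) * G (True, q))"
    by (rule shift[of _ "\<lambda>q. G (True, q)"]) (auto simp: inj_def B_def)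
  finally have "(\<Sum>q\<in>S. cell_sum G q) =
     (\<Sum>q\<in>B. of_bool (q \<in> S) * G (True, q)) +
     (\<Sum>q\<in>B. of_bool (q \<in> (\<lambda>(m, n). (m + 1, n)) ` S) * G (False, q)) -
     (\<Sum>q\<in>B. of_bool (q \<in> (\<lambda>(m, n). (m, n + 1)) ` S) * G (True, q)) -
     (\<Sum>q\<in>B. of_bool (q \<in> S) * G (False, q))" .
  also have "\<dots> = (\<Sum>q\<in>B. of_int (edge_weight S (True, q)) * G (True, q))
      + (\<Sum>q\<in>B. of_int (edge_weight S (False, q)) * G (False, q))"
  proof -
    have 1: "q \<in> (\<lambda>(m, n). (m + 1, n)) ` S \<longleftrightarrow> (fst q - 1, snd q) \<in> S" for q :: "int \<times> int"
      by (cases q) (force simp: image_iff)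
    have 2: "q \<in> (\<lambda>(m, n). (m, n + 1)) ` S \<longleftrightarrow> (fst q, snd q - 1) \<in> S" for q :: "int \<times> int"
      by (cases q) (force simp: image_iff)
    show ?thesis unfolding 1 2
      by (simp add: edge_weight_def case_prod_unfold left_diff_distrib sum_subtractf)
  qed
  also have "\<dots> = (\<Sum>e\<in>UNIV \<times> B. of_int (edge_weight S e) * G e)"
    by (simp add: UNIV_bool sum.cartesian_product' add.commute)
  also have "\<dots> = (\<Sum>e\<in>boundary_edges S. of_int (edge_weight S e) * G e)"
  proof (rule sum.mono_neutral_right)
    show "boundary_edges S \<subseteq> UNIV \<times> B"
      by (force simp: boundary_edges_def edge_weight_def B_def image_iff split: if_splits)
  qed (use B in \<open>auto simp: boundary_edges_def\<close>)
  finally show ?thesis .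
qed

context
  fixes d :: real
  assumes d: "d > 0"
begin

lemma mem_cell:
  "z \<in> cell d (m, n) \<longleftrightarrow> \<bar>Re z - d * of_int m\<bar> \<le> d / 2 \<and> \<bar>Im z - d * of_int n\<bar> \<le> d / 2"
  unfolding abs_diff_le_iff
  by (auto simp: cell_def grid_pt_def in_cbox_complex_iff algebra_simps)

lemma convex_cell: "convex (cell d q)"
  by (cases q) (simp add: cell_def)

lemma edge_subset_cell:
  "closed_segment (src d (True, m, n)) (tgt d (True, m, n)) \<subseteq> cell d (m, n)"
  "closed_segment (src d (True, m, n)) (tgt d (True, m, n)) \<subseteq> cell d (m, n - 1)"
  "closed_segment (src d (False, m, n)) (tgt d (False, m, n)) \<subseteq> cell d (m, n)"
  "closed_segment (src d (False, m, n)) (tgt d (False, m, n)) \<subseteq> cell d (m - 1, n)"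
  using d by (intro closed_segment_subset convex_cell;
    simp add: src_def tgt_def mem_cell grid_pt_def algebra_simps abs_if)+

definition edge_integral :: "(complex \<Rightarrow> complex) \<Rightarrow> edge \<Rightarrow> complex" where
  "edge_integral k e = contour_integral (linepath (src d e) (tgt d e)) k"

lemma cell_sum_edge_integral:
  assumes k: "continuous_on (cell d (m, n) - box (grid_pt d m n) (grid_pt d (m + 1) (n + 1))) k"
  shows "contour_integral (rectpath (grid_pt d m n) (grid_pt d (m + 1) (n + 1))) k
         = cell_sum (edge_integral k) (m, n)"
proof -
  let ?p = "grid_pt d"
  let ?R = "rectpath (?p m n) (?p (m + 1) (n + 1))"
  have R: "?R = linepath (?p m n) (?p (m + 1) n) +++ linepath (?p (m + 1) n) (?p (m + 1) (n + 1)) +++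
      linepath (?p (m + 1) (n + 1)) (?p m (n + 1)) +++ linepath (?p m (n + 1)) (?p m n)"
    by (simp add: rectpath_def Let_def grid_pt_def)
  have "path_image ?R = cell d (m, n) - box (?p m n) (?p (m + 1) (n + 1))"
    unfolding cell_def prod.case
    by (rule path_image_rectpath_cbox_minus_box) (use d in \<open>auto simp: grid_pt_def\<close>)
  then have sub: "closed_segment (?p m n) (?p (m + 1) n) \<union> closed_segment (?p (m + 1) n) (?p (m + 1) (n + 1))
     \<union> closed_segment (?p (m + 1) (n + 1)) (?p m (n + 1)) \<union> closed_segment (?p m (n + 1)) (?p m n)
      = cell d (m, n) - box (?p m n) (?p (m + 1) (n + 1))"
    unfolding R by (simp add: path_image_join Un_assoc)
  have c: "continuous_on (closed_segment (?p m n) (?p (m + 1) n)) k"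
    "continuous_on (closed_segment (?p (m + 1) n) (?p (m + 1) (n + 1))) k"
    "continuous_on (closed_segment (?p (m + 1) (n + 1)) (?p m (n + 1))) k"
    "continuous_on (closed_segment (?p m (n + 1)) (?p m n)) k"
    by (rule continuous_on_subset[OF k], use sub in blast)+
  note i = c[THEN contour_integrable_continuous_linepath]
  have "contour_integral ?R k = contour_integral (linepath (?p m n) (?p (m + 1) n)) k
     + (contour_integral (linepath (?p (m + 1) n) (?p (m + 1) (n + 1))) k
     + (contour_integral (linepath (?p (m + 1) (n + 1)) (?p m (n + 1))) k
     + contour_integral (linepath (?p m (n + 1)) (?p m n)) k))"
    unfolding R
    by (subst contour_integral_join; (intro contour_integrable_joinI i valid_path_join valid_path_linepath)?; simp)+
  then show "contour_integral ?R k = cell_sum (edge_integral k) (m, n)"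
    using contour_integral_reverse_linepath[OF c(3)] contour_integral_reverse_linepath[OF c(4)]
    by (simp add: cell_sum_def edge_integral_def src_def tgt_def)
qed

lemma cell_sum_holomorphic:
  assumes "k holomorphic_on cell d q"
  shows "cell_sum (edge_integral k) q = 0"
proof (cases q)
  case (Pair m n)
  let ?R = "rectpath (grid_pt d m n) (grid_pt d (m + 1) (n + 1))"
  have "(k has_contour_integral 0) ?R"
  proof (rule Cauchy_theorem_convex_simple[OF assms convex_cell])
    show "path_image ?R \<subseteq> cell d q"
      unfolding Pair cell_def prod.case using d
      by (subst path_image_rectpath_cbox_minus_box) (auto simp: grid_pt_def)
  qed auto
  moreover have "continuous_on (cell d (m, n) - box (grid_pt d m n) (grid_pt d (m + 1) (n + 1))) k"
    using assms Pair by (metis holomorphic_on_imp_continuous_on continuous_on_subset Diff_subset)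
  ultimately show ?thesis
    using cell_sum_edge_integral Pair contour_integral_unique by metis
qed

lemma cell_sum_inverse:
  "cell_sum (edge_integral (\<lambda>z. 1 / z)) q = (if q = (0, 0) then 2 * pi * \<i> else 0)"
proof (cases "q = (0, 0)")
  case True
  let ?R = "rectpath (grid_pt d 0 0) (grid_pt d 1 1)"
  have box: "0 \<in> box (grid_pt d 0 0) (grid_pt d 1 1)"
    using d by (simp add: in_box_complex_iff grid_pt_def)
  then have "continuous_on (cell d (0, 0) - box (grid_pt d 0 0) (grid_pt d (0 + 1) (0 + 1))) (\<lambda>z. 1 / z)"
    by (intro continuous_intros) auto
  then have "contour_integral ?R (\<lambda>z. 1 / z) = cell_sum (edge_integral (\<lambda>z. 1 / z)) (0, 0)"
    using cell_sum_edge_integral[of 0 0 "\<lambda>z. 1 / z"] by simp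
  moreover have "path_image ?R = cbox (grid_pt d 0 0) (grid_pt d 1 1) - box (grid_pt d 0 0) (grid_pt d 1 1)"
    by (rule path_image_rectpath_cbox_minus_box) (use d in \<open>auto simp: grid_pt_def\<close>)
  then have "1 / (2 * pi * \<i>) * contour_integral ?R (\<lambda>z. 1 / z) = 1"
    using winding_number_valid_path[of ?R 0] winding_number_rectpath[OF box] box by simp
  ultimately show ?thesis using True by (simp add: field_simps)
next
  case False
  obtain m n where q: "q = (m, n)" by (cases q)
  have "0 \<notin> cell d q"
  proof
    assume "0 \<in> cell d q"
    then have "\<bar>d * of_int m\<bar> \<le> d / 2" "\<bar>d * of_int n\<bar> \<le> d / 2" by (auto simp: q mem_cell)
    then have "\<bar>real_of_int m\<bar> \<le> 1 / 2" "\<bar>real_of_int n\<bar> \<le> 1 / 2" using d by (auto simp: abs_mult field_simps)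
    then have "m = 0" "n = 0" by linarith+
    then show False using False q by simp
  qed
  then have "cell_sum (edge_integral (\<lambda>z. 1 / z)) q = 0"
    by (intro cell_sum_holomorphic holomorphic_intros) auto
  then show ?thesis using False by simp
qed

definition cells_meeting :: "complex set \<Rightarrow> (int \<times> int) set" where
  "cells_meeting K = {q. cell d q \<inter> K \<noteq> {}}"

lemma finite_cells_meeting:
  assumes "bounded K"
  shows "finite (cells_meeting K)"
proof -
  obtain R where R: "\<And>z. z \<in> K \<Longrightarrow> norm z \<le> R" using assms unfolding bounded_iff by blast
  define N where "N = \<lceil>R / d\<rceil> + 1"
  have "cells_meeting K \<subseteq> {-N..N} \<times> {-N..N}"
  proof
    fix q assume "q \<in> cells_meeting K"
    then obtain m n z where q: "q = (m, n)" and z: "z \<in> K" "z \<in> cell d (m, n)"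
      unfolding cells_meeting_def by (cases q) blast
    have "\<bar>Re z\<bar> \<le> R" "\<bar>Im z\<bar> \<le> R"
      using R[OF z(1)] abs_Re_le_cmod[of z] abs_Im_le_cmod[of z] by linarith+
    then have "\<bar>d * of_int m\<bar> \<le> R + d / 2" "\<bar>d * of_int n\<bar> \<le> R + d / 2"
      using z(2) unfolding mem_cell by linarith+
    then have "\<bar>real_of_int m\<bar> \<le> R / d + 1" "\<bar>real_of_int n\<bar> \<le> R / d + 1"
      using d by (auto simp: abs_mult field_simps)
    then have "\<bar>m\<bar> \<le> N" "\<bar>n\<bar> \<le> N" unfolding N_def by linarith+
    then show "q \<in> {-N..N} \<times> {-N..N}" by (auto simp: q)
  qed
  then show ?thesis by (rule finite_subset) simp
qed

text \<open>
  An edge lies in both cells next to it. An edge of nonzero weight therefore stays in the union of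
  the cells of \<open>S\<close> and also touches a cell outside \<open>S\<close>; if \<open>S\<close> contains all cells that meet \<open>K\<close>,
  the edge misses \<open>K\<close>.
\<close>

lemma boundary_edge_cells:
  assumes "e \<in> boundary_edges S"
  obtains q r where "q \<in> S" "r \<notin> S" "closed_segment (src d e) (tgt d e) \<subseteq> cell d q \<inter> cell d r"
proof -
  obtain h m n where e: "e = (h, m, n)" by (cases e)
  show thesis
  proof (cases h)
    case True
    then have "((m, n) \<in> S) \<noteq> ((m, n - 1) \<in> S)"
      using assms e by (auto simp: boundary_edges_def edge_weight_def)
    moreover have "closed_segment (src d e) (tgt d e) \<subseteq> cell d (m, n) \<inter> cell d (m, n - 1)"
      using edge_subset_cell(1,2)[of m n] True e by simp
    ultimately show thesis using that[of "(m, n)" "(m, n - 1)"] that[of "(m, n - 1)" "(m, n)"]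
      by (metis Int_commute)
  next
    case False
    then have "((m, n) \<in> S) \<noteq> ((m - 1, n) \<in> S)"
      using assms e by (auto simp: boundary_edges_def edge_weight_def)
    moreover have "closed_segment (src d e) (tgt d e) \<subseteq> cell d (m, n) \<inter> cell d (m - 1, n)"
      using edge_subset_cell(3,4)[of m n] False e by simp
    ultimately show thesis using that[of "(m, n)" "(m - 1, n)"] that[of "(m - 1, n)" "(m, n)"]
      by (metis Int_commute)
  qed
qed

lemma boundary_edge_disjoint:
  assumes "e \<in> boundary_edges (cells_meeting K)"
  shows "closed_segment (src d e) (tgt d e) \<inter> K = {}"
proof -
  obtain r where "r \<notin> cells_meeting K" "closed_segment (src d e) (tgt d e) \<subseteq> cell d r"
    using boundary_edge_cells[OF assms] by (metis Int_subset_iff)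
  then show ?thesis unfolding cells_meeting_def by blast
qed

lemma cell_sum_primitive: "cell_sum (\<lambda>e. g (tgt d e) - g (src d e)) q = 0"
  by (cases q) (simp add: cell_sum_def src_def tgt_def)

end

text \<open>
  Under \<open>w = 1 / z\<close> the differential \<open>(k z - L / z) dz\<close> becomes \<open>- q w dw\<close> with \<open>q\<close> bounded on
  a punctured disc. The singularity of \<open>q\<close> is removable, and a holomorphic function on a disc has
  a primitive.
\<close>

lemma primitive_near_infinity:
  assumes \<rho>: "\<rho> > 0" and k: "k holomorphic_on {z. norm z > \<rho>}"
    and M: "\<And>z. norm z > \<rho> \<Longrightarrow> norm (z * (z * k z - L)) \<le> M"
  obtains g where "\<And>z. norm z > \<rho> \<Longrightarrow> (g has_field_derivative (k z - L / z)) (at z)"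
proof -
  define B where "B = ball (0::complex) (1 / \<rho>)"
  define q where "q w = (k (1 / w) - L * w) / w\<^sup>2" for w
  have big: "norm (1 / w) > \<rho>" if "w \<in> B - {0}" for w
    using that \<rho> by (auto simp: B_def norm_divide field_simps)
  have q_hol: "q holomorphic_on B - {0}"
  proof -
    have "(k \<circ> (\<lambda>w. 1 / w)) holomorphic_on B - {0}"
      by (rule holomorphic_on_compose_gen[OF _ k]) (use big in \<open>auto intro!: holomorphic_intros\<close>)
    then show ?thesis unfolding q_def o_def by (intro holomorphic_intros) auto
  qed
  have q_bd: "norm (q w) \<le> M" if "w \<in> B - {0}" for w
  proof -
    have "q w = (1 / w) * ((1 / w) * k (1 / w) - L)"
      using that by (simp add: q_def power2_eq_square field_simps)
    then show ?thesis using M[OF big[OF that]] by simp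
  qed
  have "\<exists>Q. Q holomorphic_on B \<and> (\<forall>w\<in>B - {0}. Q w = q w)"
  proof (subst holomorphic_on_extend_bounded[OF q_hol])
    show "0 \<in> interior B" using \<rho> by (simp add: B_def interior_open)
    have "eventually (\<lambda>w. w \<in> B - {0}) (at 0)"
      using \<rho> by (intro eventually_at_in_open) (auto simp: B_def)
    then show "\<exists>M. eventually (\<lambda>w. norm (q w) \<le> M) (at 0)"
      by (intro exI[of _ M]) (auto elim!: eventually_mono intro: q_bd)
  qed
  then obtain Q where Q: "Q holomorphic_on B" "\<And>w. w \<in> B - {0} \<Longrightarrow> Q w = q w" by blast
  obtain P where P: "\<And>w. w \<in> B \<Longrightarrow> (P has_field_derivative Q w) (at w within B)"
    by (rule holomorphic_convex_primitive'[OF _ _ Q(1)]) (auto simp: B_def)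
  have "((\<lambda>z. - P (1 / z)) has_field_derivative (k z - L / z)) (at z)" if z: "norm z > \<rho>" for z
  proof -
    have z0: "z \<noteq> 0" using z \<rho> by auto
    have zB: "1 / z \<in> B - {0}" using z \<rho> z0 by (auto simp: B_def norm_divide field_simps)
    have "(P has_field_derivative q (1 / z)) (at (1 / z))"
      using P[of "1 / z"] zB Q(2)[of "1 / z"] by (simp add: B_def at_within_open[of _ "ball 0 (1 / \<rho>)"])
    moreover have "((\<lambda>z. 1 / z) has_field_derivative (- 1 / z\<^sup>2)) (at z)"
      using z0 by (auto intro!: derivative_eq_intros simp: power2_eq_square field_simps)
    ultimately have "((\<lambda>z. P (1 / z)) has_field_derivative (q (1 / z) * (- 1 / z\<^sup>2))) (at z)"
      by (rule DERIV_chain2)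
    then have "((\<lambda>z. - P (1 / z)) has_field_derivative - (q (1 / z) * (- 1 / z\<^sup>2))) (at z)"
      by (rule DERIV_minus)
    moreover have "- (q (1 / z) * (- 1 / z\<^sup>2)) = k z - L / z"
      using z0 by (simp add: q_def power2_eq_square field_simps)
    ultimately show ?thesis by simp
  qed
  then show thesis by (rule that)
qed

text \<open>
  The cycle is the boundary of the union \<open>S\<close> of all cells of a fine grid that meet \<open>K\<close>. Its integrals
  over functions holomorphic on \<open>U\<close> vanish cell by cell. For a function \<open>k\<close> that is holomorphic off
  \<open>K\<close> only, \<open>S\<close> is enlarged to the set \<open>S'\<close> of cells that meet a large disc: the added cells miss \<open>K\<close>
  and contribute nothing, and on the boundary of \<open>S'\<close> the function \<open>k - L / z\<close> has a primitive, so that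
  only the integral of \<open>L / z\<close> remains, to which the cell around \<open>0\<close> contributes everything.
\<close>

theorem exists_cauchy_cycle:
  assumes K: "compact K" and U: "open U" and KU: "K \<subseteq> U"
  obtains I :: "edge set" and w a b where "cauchy_cycle K U I w a b"
proof -
  obtain \<epsilon> where \<epsilon>: "\<epsilon> > 0" "(\<Union>x\<in>K. ball x \<epsilon>) \<subseteq> U"
    using compact_subset_open_imp_ball_epsilon_subset[OF K U KU] by blast
  \<comment> \<open>a cell has diameter at most \<open>2 d\<close>, which is below \<open>\<epsilon>\<close>\<close>
  define d where "d = \<epsilon> / 4"
  have d: "d > 0" using \<epsilon> by (simp add: d_def)
  define S where "S = cells_meeting d K"
  have finS: "finite S" unfolding S_def by (rule finite_cells_meeting[OF d compact_imp_bounded[OF K]])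
  have cell_U: "cell d q \<subseteq> U" if qS: "q \<in> S" for q
  proof
    fix z assume z: "z \<in> cell d q"
    obtain x where x: "x \<in> K" "x \<in> cell d q" using qS unfolding S_def cells_meeting_def[OF d] by blast
    obtain m n where q: "q = (m, n)" by (cases q)
    have "\<bar>Re (z - x)\<bar> \<le> d" "\<bar>Im (z - x)\<bar> \<le> d"
      using x(2) z unfolding q mem_cell[OF d] minus_complex.sel by linarith+
    then have "norm (z - x) \<le> 2 * d" using cmod_le[of "z - x"] by linarith
    also have "\<dots> < \<epsilon>" using \<epsilon> by (simp add: d_def)
    finally have "z \<in> ball x \<epsilon>" by (simp add: dist_norm norm_minus_commute)
    then show "z \<in> U" using \<epsilon>(2) x(1) by blast
  qed
  let ?E = "boundary_edges S"
  let ?int = "edge_integral d"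
  have 1: "closed_segment (src d e) (tgt d e) \<subseteq> U - K" if e: "e \<in> ?E" for e
  proof -
    obtain q where q: "q \<in> S" "closed_segment (src d e) (tgt d e) \<subseteq> cell d q"
      using boundary_edge_cells[OF d e] by (metis Int_subset_iff)
    moreover have "closed_segment (src d e) (tgt d e) \<inter> K = {}"
      using boundary_edge_disjoint[OF d] e unfolding S_def by blast
    ultimately show ?thesis using cell_U[OF q(1)] by blast
  qed
  have 2: "(\<Sum>e\<in>?E. of_int (edge_weight S e) * ?int f e) = 0" if "f holomorphic_on U" for f
  proof -
    have "(\<Sum>q\<in>S. cell_sum (?int f) q) = 0"
      by (rule sum.neutral) (use cell_sum_holomorphic[OF d] cell_U that holomorphic_on_subset in blast)
    then show ?thesis by (simp add: sum_cell_sum[OF finS])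
  qed
  have 3: "(\<Sum>e\<in>?E. of_int (edge_weight S e) * ?int k e) = 2 * pi * \<i> * L"
    if k: "k holomorphic_on (- K)" and M: "\<And>z. norm z > \<rho>0 \<Longrightarrow> norm (z * (z * k z - L)) \<le> M"
    for k L \<rho>0 M
  proof -
    obtain R where R: "\<And>z. z \<in> K \<Longrightarrow> norm z \<le> R"
      using compact_imp_bounded[OF K] unfolding bounded_iff by blast
    define \<rho> where "\<rho> = max 1 (max R \<rho>0)"
    have \<rho>: "\<rho> > 0" and K\<rho>: "K \<subseteq> cball 0 \<rho>" using R by (auto simp: \<rho>_def) (metis max.coboundedI1 max.coboundedI2)
    define S' where "S' = cells_meeting d (cball 0 \<rho>)"
    let ?E' = "boundary_edges S'"
    have finS': "finite S'" unfolding S'_def by (rule finite_cells_meeting[OF d]) simp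
    have SS': "S \<subseteq> S'" using K\<rho> unfolding S_def S'_def cells_meeting_def[OF d] by blast
    have far: "norm z > \<rho>" if "e \<in> ?E'" "z \<in> closed_segment (src d e) (tgt d e)" for e z
      using boundary_edge_disjoint[OF d, of e "cball 0 \<rho>"] that unfolding S'_def by force
    have out: "{z. norm z > \<rho>} \<subseteq> - K" using K\<rho> by auto
    obtain g where g: "\<And>z. norm z > \<rho> \<Longrightarrow> (g has_field_derivative (k z - L / z)) (at z)"
    proof (rule primitive_near_infinity[OF \<rho> holomorphic_on_subset[OF k out]])
      show "norm (z * (z * k z - L)) \<le> M" if "\<rho> < norm z" for z
        by (rule M) (use that in \<open>simp add: \<rho>_def\<close>)
    qed blast
    have int: "?int k e = g (tgt d e) - g (src d e) + L * ?int (\<lambda>z. 1 / z) e" if e: "e \<in> ?E'" for e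
    proof -
      let ?l = "linepath (src d e) (tgt d e)"
      have "((\<lambda>z. k z - L / z) has_contour_integral (g (pathfinish ?l) - g (pathstart ?l))) ?l"
        by (rule contour_integral_primitive[where S = "{z. norm z > \<rho>}"])
          (use far[OF e] in \<open>auto intro: has_field_derivative_at_within g\<close>)
      moreover have "(\<lambda>z. 1 / z) contour_integrable_on ?l"
        by (rule contour_integrable_continuous_linepath, intro continuous_intros)
          (use far[OF e] \<rho> in force)
      ultimately have "((\<lambda>z. (k z - L / z) + L * (1 / z)) has_contour_integral
          (g (pathfinish ?l) - g (pathstart ?l) + L * contour_integral ?l (\<lambda>z. 1 / z))) ?l"
        by (intro has_contour_integral_add has_contour_integral_lmul has_contour_integral_integral)
      then show ?thesis by (simp add: edge_integral_def[OF d] contour_integral_unique)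
    qed
    have "(\<Sum>e\<in>?E. of_int (edge_weight S e) * ?int k e) = (\<Sum>q\<in>S. cell_sum (?int k) q)"
      by (simp add: sum_cell_sum[OF finS])
    also have "\<dots> = (\<Sum>q\<in>S'. cell_sum (?int k) q)"
    proof (rule sum.mono_neutral_left[OF finS' SS'], rule ballI)
      fix q assume "q \<in> S' - S"
      then have "cell d q \<subseteq> - K" unfolding S_def cells_meeting_def[OF d] by blast
      then show "cell_sum (?int k) q = 0"
        using cell_sum_holomorphic[OF d] holomorphic_on_subset[OF k] by blast
    qed
    also have "\<dots> = (\<Sum>e\<in>?E'. of_int (edge_weight S' e) * ?int k e)"
      by (simp add: sum_cell_sum[OF finS'])
    also have "\<dots> = (\<Sum>e\<in>?E'. of_int (edge_weight S' e) * (g (tgt d e) - g (src d e)))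
        + L * (\<Sum>e\<in>?E'. of_int (edge_weight S' e) * ?int (\<lambda>z. 1 / z) e)"
      by (simp add: int distrib_left sum.distrib sum_distrib_left mult.left_commute)
    also have "\<dots> = (\<Sum>q\<in>S'. cell_sum (\<lambda>e. g (tgt d e) - g (src d e)) q)
        + L * (\<Sum>q\<in>S'. cell_sum (?int (\<lambda>z. 1 / z)) q)"
      by (simp only: sum_cell_sum[OF finS'])
    also have "\<dots> = L * (2 * pi * \<i>)"
    proof -
      have "(0, 0) \<in> S'"
        using \<rho> d mem_cell[OF d, of 0 0 0] unfolding S'_def cells_meeting_def[OF d]
        by (auto intro!: exI[of _ 0] simp del: ex_in_conv simp: ex_in_conv[symmetric])
      then show ?thesis by (simp add: cell_sum_primitive[OF d] cell_sum_inverse[OF d] finS')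
    qed
    finally show ?thesis by (simp add: mult.commute)
  qed
  have "cauchy_cycle K U ?E (\<lambda>e. of_int (edge_weight S e)) (src d) (tgt d)"
    unfolding cauchy_cycle_def
    using finite_boundary_edges[OF finS] 1 2 3 unfolding edge_integral_def[OF d] by blast
  then show thesis by (rule that)
qed

section \<open>Runge's theorem\<close>

lemma cauchy_cycle_formula:
  assumes C: "cauchy_cycle K U I w a b" and U: "open U" "f holomorphic_on U" and z: "z \<in> K"
  shows "(\<Sum>i\<in>I. w i * contour_integral (linepath (a i) (b i)) (\<lambda>\<zeta>. f \<zeta> / (\<zeta> - z))) = 2 * pi * \<i> * f z"
proof -
  define F where "F \<zeta> = (if \<zeta> = z then deriv f z else (f \<zeta> - f z) / (\<zeta> - z))" for \<zeta>
  have F: "F holomorphic_on U" unfolding F_def by (rule pole_lemma_open[OF U(2,1)])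
  have kern: "(\<Sum>i\<in>I. w i * contour_integral (linepath (a i) (b i)) (\<lambda>\<zeta>. 1 / (\<zeta> - z))) = 2 * pi * \<i> * 1"
  proof -
    have "(\<lambda>\<zeta>. 1 / (\<zeta> - z)) holomorphic_on (- K)" using z by (intro holomorphic_intros) auto
    moreover have "norm (\<zeta> * (\<zeta> * (1 / (\<zeta> - z)) - 1)) \<le> 2 * norm z" if "norm \<zeta> > 2 * norm z" for \<zeta>
    proof -
      have "\<zeta> \<noteq> z" using that by (smt (verit) norm_ge_zero)
      then have "\<zeta> * (\<zeta> * (1 / (\<zeta> - z)) - 1) = z * (\<zeta> / (\<zeta> - z))" by (simp add: field_simps)
      moreover have "norm \<zeta> \<le> 2 * norm (\<zeta> - z)"
        using that norm_triangle_ineq2[of \<zeta> z] by linarith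
      then have "norm (\<zeta> / (\<zeta> - z)) \<le> 2"
        using \<open>\<zeta> \<noteq> z\<close> by (simp add: norm_divide field_simps)
      then have "norm (z * (\<zeta> / (\<zeta> - z))) \<le> norm z * 2"
        unfolding norm_mult by (intro mult_left_mono) auto
      ultimately show ?thesis by simp
    qed
    ultimately show ?thesis using C unfolding cauchy_cycle_def by blast
  qed
  have "contour_integral (linepath (a i) (b i)) (\<lambda>\<zeta>. f \<zeta> / (\<zeta> - z)) =
      contour_integral (linepath (a i) (b i)) F + f z * contour_integral (linepath (a i) (b i)) (\<lambda>\<zeta>. 1 / (\<zeta> - z))"
    if i: "i \<in> I" for i
  proof -
    let ?l = "linepath (a i) (b i)"
    have seg: "closed_segment (a i) (b i) \<subseteq> U - K" using C i unfolding cauchy_cycle_def by blast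
    have "F contour_integrable_on ?l"
      using seg F by (intro contour_integrable_continuous_linepath)
        (metis Diff_subset continuous_on_subset holomorphic_on_imp_continuous_on)
    moreover have "(\<lambda>\<zeta>. 1 / (\<zeta> - z)) contour_integrable_on ?l"
      by (rule contour_integrable_continuous_linepath, intro continuous_intros) (use seg z in auto)
    ultimately have "((\<lambda>\<zeta>. F \<zeta> + f z * (1 / (\<zeta> - z))) has_contour_integral
        (contour_integral ?l F + f z * contour_integral ?l (\<lambda>\<zeta>. 1 / (\<zeta> - z)))) ?l"
      by (intro has_contour_integral_add has_contour_integral_lmul has_contour_integral_integral)
    moreover have "contour_integral ?l (\<lambda>\<zeta>. f \<zeta> / (\<zeta> - z)) = contour_integral ?l (\<lambda>\<zeta>. F \<zeta> + f z * (1 / (\<zeta> - z)))"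
    proof (rule contour_integral_eq)
      fix \<zeta> assume "\<zeta> \<in> path_image ?l"
      then have "\<zeta> \<noteq> z" using seg z by auto
      then show "f \<zeta> / (\<zeta> - z) = F \<zeta> + f z * (1 / (\<zeta> - z))" by (simp add: F_def diff_divide_distrib)
    qed
    ultimately show ?thesis by (simp add: contour_integral_unique)
  qed
  then have "(\<Sum>i\<in>I. w i * contour_integral (linepath (a i) (b i)) (\<lambda>\<zeta>. f \<zeta> / (\<zeta> - z))) =
     (\<Sum>i\<in>I. w i * contour_integral (linepath (a i) (b i)) F) +
     f z * (\<Sum>i\<in>I. w i * contour_integral (linepath (a i) (b i)) (\<lambda>\<zeta>. 1 / (\<zeta> - z)))"
    by (simp add: distrib_left sum.distrib sum_distrib_left mult.left_commute)
  moreover have "(\<Sum>i\<in>I. w i * contour_integral (linepath (a i) (b i)) F) = 0"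
    using C F unfolding cauchy_cycle_def by blast
  ultimately show ?thesis by (simp add: kern)
qed

inductive fraction_sum :: "complex set \<Rightarrow> (complex \<Rightarrow> complex) \<Rightarrow> bool" for A where
  zero: "fraction_sum A (\<lambda>z. 0)"
| add: "fraction_sum A r \<Longrightarrow> \<mu> \<in> A \<Longrightarrow> fraction_sum A (\<lambda>z. c / (\<mu> - z) + r z)"

lemma fraction_sum_plus:
  assumes "fraction_sum A r" "fraction_sum A s"
  shows "fraction_sum A (\<lambda>z. r z + s z)"
  using assms(1)
proof induction
  case zero
  then show ?case using assms(2) by simp
next
  case (add r \<mu> c)
  then have "fraction_sum A (\<lambda>z. c / (\<mu> - z) + (r z + s z))" by (intro fraction_sum.add)
  then show ?case by (simp add: add.assoc)
qed

lemma fraction_sum_scale: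
  assumes "fraction_sum A r"
  shows "fraction_sum A (\<lambda>z. k * r z)"
  using assms
proof induction
  case zero
  then show ?case by (simp add: fraction_sum.zero)
next
  case (add r \<mu> c)
  then have "fraction_sum A (\<lambda>z. (k * c) / (\<mu> - z) + k * r z)" by (intro fraction_sum.add)
  then show ?case by (simp add: distrib_left)
qed

lemma fraction_sum_mono: "fraction_sum A r \<Longrightarrow> A \<subseteq> B \<Longrightarrow> fraction_sum B r"
  by (induction rule: fraction_sum.induct) (auto intro: fraction_sum.intros)

lemma fraction_sum_finite_sum:
  assumes "finite I" "\<And>i. i \<in> I \<Longrightarrow> fraction_sum A (r i)"
  shows "fraction_sum A (\<lambda>z. \<Sum>i\<in>I. r i z)"
  using assms by (induction I) (auto intro: fraction_sum.zero fraction_sum_plus)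

lemma fraction_sum_single: "\<mu> \<in> A \<Longrightarrow> fraction_sum A (\<lambda>z. c / (\<mu> - z))"
  using fraction_sum.add[OF fraction_sum.zero, of \<mu> A c] by simp

lemma riemann_sum_error:
  fixes g :: "real \<Rightarrow> complex"
  assumes g: "continuous_on {0..1} g" and N: "N > 0"
    and e: "\<And>s t. s \<in> {0..1} \<Longrightarrow> t \<in> {0..1} \<Longrightarrow> \<bar>s - t\<bar> \<le> 1 / real N \<Longrightarrow> norm (g s - g t) \<le> e"
  shows "norm (integral {0..1} g - (\<Sum>j<N. g (real j / N) / N)) \<le> e"
proof -
  have "norm (integral {0..real n / N} g - (\<Sum>j<n. g (real j / N) / N)) \<le> e * (n / N)" if "n \<le> N" for n
    using that
  proof (induction n)
    case 0
    then show ?case by simp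
  next
    case (Suc n)
    let ?s = "real n / N" and ?t = "real (Suc n) / N"
    have st: "0 \<le> ?s" "?s \<le> ?t" "?t \<le> 1" "?t - ?s = 1 / N" using Suc.prems N by (auto simp: field_simps)
    have gt: "continuous_on {0..?t} g" and gst: "continuous_on {?s..?t} g"
      by (rule continuous_on_subset[OF g], use st(1,3) in \<open>simp add: atLeastatMost_subset_iff\<close>)+
    have split: "integral {0..?t} g = integral {0..?s} g + integral {?s..?t} g"
      by (rule Henstock_Kurzweil_Integration.integral_combine[symmetric])
        (use st gt integrable_continuous_real in auto)
    have "integral {?s..?t} (\<lambda>x. g x - g ?s) = integral {?s..?t} g - integral {?s..?t} (\<lambda>x. g ?s)"
      by (rule Henstock_Kurzweil_Integration.integral_diff) (use gst integrable_continuous_real in auto)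
    then have "integral {?s..?t} g - g ?s / N = integral {?s..?t} (\<lambda>x. g x - g ?s)"
      using st by (simp add: scaleR_conv_of_real divide_inverse mult.commute)
    also have "norm \<dots> \<le> e * (?t - ?s)"
    proof (rule integral_bound)
      fix x assume "x \<in> {?s..?t}"
      then have "x \<in> {0..1}" "?s \<in> {0..1}" "\<bar>x - ?s\<bar> \<le> 1 / N"
        using st unfolding atLeastAtMost_iff by linarith+
      then show "norm (g x - g ?s) \<le> e" by (rule e)
    qed (use st(2) gst in \<open>auto intro!: continuous_intros\<close>)
    finally have step: "norm (integral {?s..?t} g - g ?s / N) \<le> e * (1 / N)" using st by simp
    have "integral {0..?t} g - (\<Sum>j<Suc n. g (real j / N) / N) =
        (integral {0..?s} g - (\<Sum>j<n. g (real j / N) / N)) + (integral {?s..?t} g - g ?s / N)"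
      unfolding split sum.lessThan_Suc by (simp only: algebra_simps)
    then have "norm (integral {0..?t} g - (\<Sum>j<Suc n. g (real j / N) / N)) \<le> e * (n / N) + e * (1 / N)"
      using Suc.IH Suc.prems step norm_triangle_mono by (smt (verit) Suc_leD)
    also have "\<dots> = e * ?t" using N by (simp add: field_simps)
    finally show ?case .
  qed
  from this[of N] show ?thesis using N by simp
qed

text \<open>
  The integrand is uniformly continuous in the parameter of the segment and in \<open>z\<close> jointly, so that
  its Riemann sums converge uniformly for \<open>z \<in> K\<close>. As functions of \<open>z\<close> they are sums of simple
  fractions.
\<close>

lemma segment_kernel_approx:
  assumes K: "compact K" and seg: "closed_segment a b \<inter> K = {}"
    and f: "continuous_on (closed_segment a b) f" and \<epsilon>: "\<epsilon> > 0"
  obtains r where "fraction_sum (closed_segment a b) r"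
    "\<And>z. z \<in> K \<Longrightarrow> norm (contour_integral (linepath a b) (\<lambda>\<zeta>. f \<zeta> / (\<zeta> - z)) - r z) \<le> \<epsilon>"
proof -
  let ?l = "linepath a b"
  define h where "h = (\<lambda>(t, z). f (?l t) / (?l t - z) * (b - a))"
  have l: "?l t \<in> closed_segment a b" if "t \<in> {0..1}" for t
    using that by (metis imageI path_image_def path_image_linepath)
  have cont: "continuous_on ({0..1} \<times> K) h"
  proof -
    have cl: "continuous_on ({0..1} \<times> K) (\<lambda>p. ?l (fst p))"
      by (auto simp: linepath_def intro!: continuous_intros)
    have "continuous_on ({0..1} \<times> K) (\<lambda>p. f (?l (fst p)))"
      by (rule continuous_on_compose2[OF f cl]) (use l in auto)
    then show ?thesis unfolding h_def case_prod_unfold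
    proof (intro continuous_intros cl ballI)
      fix p :: "real \<times> complex" assume "p \<in> {0..1} \<times> K"
      then show "?l (fst p) - snd p \<noteq> 0" using l[of "fst p"] seg by auto
    qed
  qed
  then have "uniformly_continuous_on ({0..1} \<times> K) h"
    using K by (intro compact_uniformly_continuous compact_Times) auto
  then obtain \<delta> where \<delta>: "\<delta> > 0"
    and unif: "\<And>p q. p \<in> {0..1} \<times> K \<Longrightarrow> q \<in> {0..1} \<times> K \<Longrightarrow> dist q p < \<delta> \<Longrightarrow> dist (h q) (h p) < \<epsilon>"
    unfolding uniformly_continuous_on_def using \<epsilon> by metis
  obtain N :: nat where N: "N > 0" "1 / N < \<delta>"
    using reals_Archimedean[OF \<delta>] by (metis inverse_eq_divide zero_less_Suc)
  define r where "r z = (\<Sum>j<N. (f (?l (real j / N)) * (b - a) / N) / (?l (real j / N) - z))" for z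
  have "fraction_sum (closed_segment a b) r"
    unfolding r_def
    by (intro fraction_sum_finite_sum fraction_sum_single l) (use N in auto)
  moreover have "norm (contour_integral ?l (\<lambda>\<zeta>. f \<zeta> / (\<zeta> - z)) - r z) \<le> \<epsilon>" if z: "z \<in> K" for z
  proof -
    have "contour_integral ?l (\<lambda>\<zeta>. f \<zeta> / (\<zeta> - z)) = integral {0..1} (\<lambda>t. h (t, z))"
      by (simp add: contour_integral_integral h_def)
    moreover have "r z = (\<Sum>j<N. h (real j / N, z) / N)" by (simp add: r_def h_def field_simps)
    moreover have "norm (integral {0..1} (\<lambda>t. h (t, z)) - (\<Sum>j<N. h (real j / N, z) / N)) \<le> \<epsilon>"
    proof (rule riemann_sum_error[OF _ N(1)])
      show "continuous_on {0..1} (\<lambda>t. h (t, z))"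
        by (rule continuous_on_compose2[OF cont]) (use z in \<open>auto intro!: continuous_intros\<close>)
      show "norm (h (s, z) - h (t, z)) \<le> \<epsilon>"
        if "s \<in> {0..1}" "t \<in> {0..1}" "\<bar>s - t\<bar> \<le> 1 / real N" for s t
        using unif[of "(t, z)" "(s, z)"] that z N by (simp add: dist_Pair_Pair dist_norm)
    qed
    ultimately show ?thesis by simp
  qed
  ultimately show thesis by (rule that)
qed

text \<open>
  The poles are kept in \<open>U - K\<close>, not just outside \<open>K\<close>; they are points of the cycle in the Cauchy
  formula.
\<close>

theorem Runge_approximation:
  assumes K: "compact K" and U: "open U" and KU: "K \<subseteq> U" and f: "f holomorphic_on U" and \<epsilon>: "\<epsilon> > 0"
  obtains r where "fraction_sum (U - K) r" "\<And>z. z \<in> K \<Longrightarrow> norm (f z - r z) \<le> \<epsilon>"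
proof -
  obtain I :: "edge set" and w a b where C: "cauchy_cycle K U I w a b"
    by (rule exists_cauchy_cycle[OF K U KU]) blast
  then have I: "finite I" and seg: "\<And>i. i \<in> I \<Longrightarrow> closed_segment (a i) (b i) \<subseteq> U - K"
    unfolding cauchy_cycle_def by blast+
  \<comment> \<open>the errors on the segments are weighted by \<open>norm (w i)\<close>; the \<open>1\<close> avoids a zero divisor\<close>
  define W where "W = 1 + (\<Sum>i\<in>I. norm (w i))"
  have W: "W > 0" unfolding W_def by (simp add: add_pos_nonneg sum_nonneg)
  have "\<exists>r. fraction_sum (U - K) r \<and>
      (\<forall>z\<in>K. norm (contour_integral (linepath (a i) (b i)) (\<lambda>\<zeta>. f \<zeta> / (\<zeta> - z)) - r z) \<le> \<epsilon> / W)"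
    if i: "i \<in> I" for i
  proof -
    obtain r where "fraction_sum (closed_segment (a i) (b i)) r"
      "\<And>z. z \<in> K \<Longrightarrow> norm (contour_integral (linepath (a i) (b i)) (\<lambda>\<zeta>. f \<zeta> / (\<zeta> - z)) - r z) \<le> \<epsilon> / W"
    proof (rule segment_kernel_approx[OF K])
      show "closed_segment (a i) (b i) \<inter> K = {}" using seg[OF i] by blast
      show "continuous_on (closed_segment (a i) (b i)) f"
        using f seg[OF i] by (metis Diff_subset continuous_on_subset holomorphic_on_imp_continuous_on)
      show "\<epsilon> / W > 0" using \<epsilon> W by simp
    qed blast
    then show ?thesis using seg[OF i] fraction_sum_mono by blast
  qed
  then obtain r where r: "\<And>i. i \<in> I \<Longrightarrow> fraction_sum (U - K) (r i)"
    "\<And>i z. i \<in> I \<Longrightarrow> z \<in> K \<Longrightarrow>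
       norm (contour_integral (linepath (a i) (b i)) (\<lambda>\<zeta>. f \<zeta> / (\<zeta> - z)) - r i z) \<le> \<epsilon> / W"
    by metis
  define s where "s z = (\<Sum>i\<in>I. (w i / (2 * pi * \<i>)) * r i z)" for z
  have "fraction_sum (U - K) s"
    unfolding s_def by (intro fraction_sum_finite_sum fraction_sum_scale I r)
  moreover have "norm (f z - s z) \<le> \<epsilon>" if z: "z \<in> K" for z
  proof -
    let ?J = "\<lambda>i. contour_integral (linepath (a i) (b i)) (\<lambda>\<zeta>. f \<zeta> / (\<zeta> - z))"
    have "f z = (\<Sum>i\<in>I. w i * ?J i) / (2 * pi * \<i>)"
      using cauchy_cycle_formula[OF C U f z] by simp
    also have "\<dots> - s z = (\<Sum>i\<in>I. (w i / (2 * pi * \<i>)) * (?J i - r i z))"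
      by (simp add: s_def sum_divide_distrib sum_subtractf right_diff_distrib)
    also have "norm \<dots> \<le> (\<Sum>i\<in>I. norm (w i) * (\<epsilon> / W))"
    proof (rule sum_norm_le)
      fix i assume i: "i \<in> I"
      have "norm (w i / (2 * pi * \<i>)) \<le> norm (w i) / 1"
        unfolding norm_divide by (intro divide_left_mono) (use pi_gt3 in \<open>auto simp: norm_mult\<close>)
      then show "norm (w i / (2 * pi * \<i>) * (?J i - r i z)) \<le> norm (w i) * (\<epsilon> / W)"
        unfolding norm_mult using r(2)[OF i z] by (intro mult_mono) auto
    qed
    also have "\<dots> = (\<Sum>i\<in>I. norm (w i)) * (\<epsilon> / W)" by (simp only: sum_distrib_right)
    also have "\<dots> \<le> W * (\<epsilon> / W)" using W \<epsilon> by (intro mult_right_mono) (auto simp: W_def)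
    finally show ?thesis using W by simp
  qed
  ultimately show thesis by (rule that)
qed

section \<open>Seminorm topologies\<close>

lemma tendsto_zero_le:
  assumes "\<And>n. 0 \<le> (f n :: real)" "\<And>n. f n \<le> g n" "g \<longlonglongrightarrow> 0"
  shows "f \<longlonglongrightarrow> 0"
  by (rule tendsto_sandwich[OF _ _ tendsto_const assms(3)]) (use assms in auto)

definition seminorm_ball :: "'b::minus set \<Rightarrow> ('b \<Rightarrow> real) set \<Rightarrow> 'b \<Rightarrow> real \<Rightarrow> 'b set" where
  "seminorm_ball S F x e = {y \<in> S. \<forall>p\<in>F. p (y - x) < e}"

text \<open>
  Apart from the calibration, the topologies of this development come from functions that behave like
  seminorms on part of their domain only: operator seminorms on the quotient bounded operators, supremum norms on functions
  bounded on the domain. This predicate collects what the theory of their balls requires.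
\<close>

definition distance_family :: "'b::minus set \<Rightarrow> ('b \<Rightarrow> real) set \<Rightarrow> bool" where
  "distance_family S P \<longleftrightarrow>
     (\<forall>p\<in>P. (\<forall>x\<in>S. p (x - x) = 0) \<and>
            (\<forall>x\<in>S. \<forall>y\<in>S. \<forall>z\<in>S. p (z - x) \<le> p (z - y) + p (y - x)))"

lemma topspace_seminorm_topology [simp]: "topspace (seminorm_topology S P) = S"
  by (auto simp: seminorm_topology_def)

context
  fixes S :: "'b::minus set" and P
  assumes dist: "distance_family S P"
begin

lemma distance_self: "p \<in> P \<Longrightarrow> x \<in> S \<Longrightarrow> p (x - x) = 0"
  and distance_triangle: "p \<in> P \<Longrightarrow> x \<in> S \<Longrightarrow> y \<in> S \<Longrightarrow> z \<in> S \<Longrightarrow> p (z - x) \<le> p (z - y) + p (y - x)"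
  using dist unfolding distance_family_def by blast+

lemma openin_seminorm_ball:
  assumes "finite F" "F \<subseteq> P" "x \<in> S" "e > 0"
  shows "openin (seminorm_topology S P) (seminorm_ball S F x e)"
  using assms(1,2)
proof (induction F)
  case empty
  then show ?case
    by (simp add: seminorm_ball_def seminorm_topology_def topology_generated_by_Basis)
next
  case (insert p F)
  have "openin (seminorm_topology S P) {y \<in> S. p (y - x) < e}"
    unfolding seminorm_topology_def
    by (rule topology_generated_by_Basis) (use insert.prems assms(3,4) in blast)
  moreover have "seminorm_ball S (insert p F) x e = {y \<in> S. p (y - x) < e} \<inter> seminorm_ball S F x e"
    by (auto simp: seminorm_ball_def)
  ultimately show ?case using insert by auto
qed

lemma openin_seminorm_topology_imp:
  assumes "openin (seminorm_topology S P) U" "x \<in> U"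
  obtains F e where "finite F" "F \<subseteq> P" "e > 0" "seminorm_ball S F x e \<subseteq> U"
proof -
  have "generate_topology_on (insert S {{y \<in> S. p (y - x) < e} | p x e. p \<in> P \<and> x \<in> S \<and> 0 < e}) U"
    using assms(1) unfolding seminorm_topology_def openin_topology_generated_by_iff .
  then have "\<forall>x\<in>U. \<exists>F e. finite F \<and> F \<subseteq> P \<and> e > 0 \<and> seminorm_ball S F x e \<subseteq> U"
  proof induction
    case Empty
    then show ?case by simp
  next
    case (Int A B)
    show ?case
    proof
      fix x assume "x \<in> A \<inter> B"
      then obtain F e G e' where "finite F" "F \<subseteq> P" "e > 0" "seminorm_ball S F x e \<subseteq> A"
        "finite G" "G \<subseteq> P" "e' > 0" "seminorm_ball S G x e' \<subseteq> B"
        using Int.IH by (metis IntD1 IntD2)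
      then show "\<exists>F e. finite F \<and> F \<subseteq> P \<and> e > 0 \<and> seminorm_ball S F x e \<subseteq> A \<inter> B"
        by (intro exI[of _ "F \<union> G"] exI[of _ "min e e'"]) (auto simp: seminorm_ball_def)
    qed
  next
    case (UN K)
    show ?case
    proof
      fix x assume "x \<in> \<Union>K"
      then obtain k where k: "k \<in> K" "x \<in> k" by blast
      then obtain F e where "finite F" "F \<subseteq> P" "e > 0" "seminorm_ball S F x e \<subseteq> k"
        using UN.IH[OF k(1)] by metis
      then show "\<exists>F e. finite F \<and> F \<subseteq> P \<and> e > 0 \<and> seminorm_ball S F x e \<subseteq> \<Union>K"
        using k(1) by (meson Union_upper order_trans)
    qed
  next
    case (Basis A)
    show ?case
    proof
      fix z assume z: "z \<in> A"
      consider "A = S" | p c e where "p \<in> P" "c \<in> S" "A = {y \<in> S. p (y - c) < e}" using Basis by blast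
      then show "\<exists>F e. finite F \<and> F \<subseteq> P \<and> e > 0 \<and> seminorm_ball S F z e \<subseteq> A"
      proof cases
        case 1
        then show ?thesis by (intro exI[of _ "{}"] exI[of _ 1]) (auto simp: seminorm_ball_def)
      next
        case 2
        have "seminorm_ball S {p} z (e - p (z - c)) \<subseteq> A"
        proof
          fix y assume "y \<in> seminorm_ball S {p} z (e - p (z - c))"
          then have y: "y \<in> S" "p (y - z) < e - p (z - c)" by (auto simp: seminorm_ball_def)
          have "p (y - c) \<le> p (y - z) + p (z - c)"
            using 2 z y by (intro distance_triangle) auto
          then show "y \<in> A" using 2 y by auto
        qed
        then show ?thesis using 2 z by (intro exI[of _ "{p}"] exI[of _ "e - p (z - c)"]) auto
      qed
    qed
  qed
  then show thesis using assms(2) that by blast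
qed

text \<open>
  Continuity can be tested with one seminorm at a time and with balls centred at the image point only,
  because the triangle inequality recentres the balls of the generating family.
\<close>

lemma continuous_map_into_seminorm_topology:
  assumes f: "\<And>x. x \<in> topspace X \<Longrightarrow> f x \<in> S"
    and near: "\<And>p x e. p \<in> P \<Longrightarrow> x \<in> topspace X \<Longrightarrow> e > 0 \<Longrightarrow>
       \<exists>U. openin X U \<and> x \<in> U \<and> (\<forall>y\<in>U. p (f y - f x) < e)"
  shows "continuous_map X (seminorm_topology S P) f"
  unfolding seminorm_topology_def
proof (rule continuous_on_generated_topo)
  show "f ` topspace X \<subseteq> \<Union> (insert S {{y \<in> S. p (y - x) < e} |p x e. p \<in> P \<and> x \<in> S \<and> 0 < e})"
    using f by auto
  fix U assume "U \<in> insert S {{y \<in> S. p (y - x) < e} |p x e. p \<in> P \<and> x \<in> S \<and> 0 < e}"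
  then consider "U = S" | p c e where "p \<in> P" "c \<in> S" "U = {y \<in> S. p (y - c) < e}" by blast
  then show "openin X (f -` U \<inter> topspace X)"
  proof cases
    case 1
    then have "f -` U \<inter> topspace X = topspace X" using f by auto
    then show ?thesis by simp
  next
    case 2
    show ?thesis
    proof (subst openin_subopen, rule ballI)
      fix x assume x: "x \<in> f -` U \<inter> topspace X"
      then have "e - p (f x - c) > 0" using 2 by auto
      then obtain W where W: "openin X W" "x \<in> W" "\<forall>y\<in>W. p (f y - f x) < e - p (f x - c)"
        using near[OF 2(1)] x by blast
      have "W \<subseteq> f -` U \<inter> topspace X"
      proof
        fix y assume y: "y \<in> W"
        then have yX: "y \<in> topspace X" using W(1) openin_subset by blast
        then have "p (f y - c) \<le> p (f y - f x) + p (f x - c)"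
          using x f 2 by (intro distance_triangle) auto
        then show "y \<in> f -` U \<inter> topspace X" using W(3) y yX f 2 by fastforce
      qed
      then show "\<exists>T. openin X T \<and> x \<in> T \<and> T \<subseteq> f -` U \<inter> topspace X" using W by blast
    qed
  qed
qed

end

section \<open>The algebra of quotient bounded operators\<close>

locale calibrated_space = vector_space sc
  for sc :: "complex \<Rightarrow> 'a::{ab_group_add,t2_space} \<Rightarrow> 'a" +
  fixes P :: "('a \<Rightarrow> real) set"
  assumes seminorms: "p \<in> P \<Longrightarrow> seminorm sc p"
    and topology: "seminorm_topology UNIV P = euclidean"
    and complete: "sequentially_complete (UNIV :: 'a set)"
begin

abbreviation Q :: "('a \<Rightarrow> 'a) set" where "Q \<equiv> Q_ops sc P"

abbreviation nrm :: "('a \<Rightarrow> real) \<Rightarrow> ('a \<Rightarrow> 'a) \<Rightarrow> real" where "nrm \<equiv> op_seminorm"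

lemma seminorm_nonneg: "p \<in> P \<Longrightarrow> 0 \<le> p x"
  and seminorm_triangle: "p \<in> P \<Longrightarrow> p (x + y) \<le> p x + p y"
  and seminorm_scale: "p \<in> P \<Longrightarrow> p (sc c x) = norm c * p x"
  using seminorms unfolding seminorm_def by blast+

lemma seminorm_zero: "p \<in> P \<Longrightarrow> p 0 = 0"
  using seminorm_scale[of p 0 0] by simp

lemma seminorm_minus: "p \<in> P \<Longrightarrow> p (- x) = p x"
  using seminorm_scale[of p "-1" x] by simp

lemma seminorm_diff: "p \<in> P \<Longrightarrow> p (x - y) \<le> p x + p y"
  using seminorm_triangle[of p x "- y"] by (simp add: seminorm_minus)

lemma seminorm_diff_triangle: "p \<in> P \<Longrightarrow> p (z - x) \<le> p (z - y) + p (y - x)"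
  using seminorm_triangle[of p "z - y" "y - x"] by simp

lemma distance_family_space: "distance_family UNIV P"
  unfolding distance_family_def using seminorm_diff_triangle seminorm_zero by simp

lemma open_seminorm_ball: "p \<in> P \<Longrightarrow> e > 0 \<Longrightarrow> open {y. p (y - x) < e}"
  using openin_seminorm_ball[OF distance_family_space, of "{p}" x e]
  by (simp add: topology seminorm_ball_def)

lemma open_contains_seminorm_ball:
  assumes "open U" "x \<in> U"
  obtains F e where "finite F" "F \<subseteq> P" "e > 0" "seminorm_ball UNIV F x e \<subseteq> U"
proof -
  have "openin (seminorm_topology UNIV P) U" using assms(1) by (simp add: topology)
  from openin_seminorm_topology_imp[OF distance_family_space this assms(2)] that show thesis .
qed

lemma seminorms_separate:
  assumes "\<And>p. p \<in> P \<Longrightarrow> p x = 0"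
  shows "x = 0"
proof (rule ccontr)
  assume "x \<noteq> 0"
  then obtain U where U: "open U" "0 \<in> U" "x \<notin> U" using separation_t1[of 0 x] by metis
  then obtain F e where F: "F \<subseteq> P" "e > 0" "seminorm_ball UNIV F 0 e \<subseteq> U"
    using open_contains_seminorm_ball[of U 0] by metis
  have "p x < e" if "p \<in> F" for p using assms[of p] F that by (metis subsetD)
  then have "x \<in> seminorm_ball UNIV F 0 e" by (simp add: seminorm_ball_def)
  then show False using F U by blast
qed

text \<open>
  Convergence is handled through the seminorms rather than through the topology of the type, so that
  estimates can be passed to the limit by real analysis.
\<close>

definition seminorm_limit :: "(nat \<Rightarrow> 'a) \<Rightarrow> 'a \<Rightarrow> bool" where
  "seminorm_limit X l \<longleftrightarrow> (\<forall>p\<in>P. (\<lambda>n. p (X n - l)) \<longlonglongrightarrow> 0)"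

lemma seminorm_limitD: "seminorm_limit X l \<Longrightarrow> p \<in> P \<Longrightarrow> (\<lambda>n. p (X n - l)) \<longlonglongrightarrow> 0"
  unfolding seminorm_limit_def by blast

lemma seminorm_limit_unique:
  assumes "seminorm_limit X l" "seminorm_limit X m"
  shows "l = m"
proof -
  have "p (l - m) = 0" if p: "p \<in> P" for p
  proof -
    have "(\<lambda>n. p (X n - l) + p (X n - m)) \<longlonglongrightarrow> 0 + 0"
      using assms p by (intro tendsto_add seminorm_limitD)
    moreover have "p (l - m) \<le> p (X n - l) + p (X n - m)" for n
      using seminorm_diff_triangle[OF p, of l m "X n"] seminorm_minus[OF p, of "X n - l"] by simp
    ultimately have "p (l - m) \<le> 0 + 0" by (intro LIMSEQ_le_const) auto
    then show ?thesis using seminorm_nonneg[OF p, of "l - m"] by simp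
  qed
  then show ?thesis using seminorms_separate[of "l - m"] by simp
qed

lemma seminorm_limit_add:
  assumes "seminorm_limit X l" "seminorm_limit Y m"
  shows "seminorm_limit (\<lambda>n. X n + Y n) (l + m)"
  unfolding seminorm_limit_def
proof
  fix p assume p: "p \<in> P"
  show "(\<lambda>n. p (X n + Y n - (l + m))) \<longlonglongrightarrow> 0"
  proof (rule tendsto_zero_le)
    show "(\<lambda>n. p (X n - l) + p (Y n - m)) \<longlonglongrightarrow> 0"
      using tendsto_add[OF seminorm_limitD[OF assms(1) p] seminorm_limitD[OF assms(2) p]] by simp
    show "p (X n + Y n - (l + m)) \<le> p (X n - l) + p (Y n - m)" for n
      using seminorm_triangle[OF p, of "X n - l" "Y n - m"] by (simp add: algebra_simps)
  qed (rule seminorm_nonneg[OF p])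
qed

lemma seminorm_limit_scale:
  assumes "seminorm_limit X l"
  shows "seminorm_limit (\<lambda>n. sc c (X n)) (sc c l)"
  unfolding seminorm_limit_def
proof
  fix p assume p: "p \<in> P"
  show "(\<lambda>n. p (sc c (X n) - sc c l)) \<longlonglongrightarrow> 0"
    using tendsto_mult_left[OF seminorm_limitD[OF assms p], of "norm c"]
    by (simp add: scale_right_diff_distrib[symmetric] seminorm_scale[OF p])
qed

lemma seminorm_Cauchy_limit:
  assumes "\<And>p e. p \<in> P \<Longrightarrow> e > 0 \<Longrightarrow> \<exists>N. \<forall>m\<ge>N. \<forall>n\<ge>N. p (X m - X n) < e"
  obtains l where "seminorm_limit X l"
proof -
  have "\<exists>N. \<forall>m\<ge>N. \<forall>n\<ge>N. X m - X n \<in> U" if U: "open U" "0 \<in> U" for U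
  proof -
    obtain F e where F: "finite F" "F \<subseteq> P" "e > 0" "seminorm_ball UNIV F 0 e \<subseteq> U"
      using open_contains_seminorm_ball[OF U] by metis
    have "\<exists>N. \<forall>p\<in>F. \<forall>m\<ge>N. \<forall>n\<ge>N. p (X m - X n) < e"
      using F(1,2)
    proof (induction F)
      case (insert p F)
      then obtain N1 N2 where "\<forall>m\<ge>N1. \<forall>n\<ge>N1. p (X m - X n) < e"
        "\<forall>p\<in>F. \<forall>m\<ge>N2. \<forall>n\<ge>N2. p (X m - X n) < e" using assms[of p e] F(3) by auto
      then show ?case by (intro exI[of _ "max N1 N2"]) auto
    qed simp
    then show ?thesis using F(4) by (force simp: seminorm_ball_def)
  qed
  then obtain l where l: "X \<longlonglongrightarrow> l" using complete unfolding sequentially_complete_def by blast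
  have "seminorm_limit X l"
    unfolding seminorm_limit_def
  proof
    fix p assume p: "p \<in> P"
    show "(\<lambda>n. p (X n - l)) \<longlonglongrightarrow> 0"
    proof (rule tendstoI)
      fix e :: real assume "e > 0"
      then have "eventually (\<lambda>n. X n \<in> {y. p (y - l) < e}) sequentially"
        using open_seminorm_ball[OF p] by (intro topological_tendstoD[OF l]) (auto simp: seminorm_zero[OF p])
      then show "eventually (\<lambda>n. dist (p (X n - l)) 0 < e) sequentially"
        using seminorm_nonneg[OF p] by (auto elim: eventually_mono)
    qed
  qed
  then show thesis by (rule that)
qed

lemma QI:
  assumes "\<And>x y. A (x + y) = A x + A y" "\<And>c x. A (sc c x) = sc c (A x)"
    and "\<And>p. p \<in> P \<Longrightarrow> \<exists>c. \<forall>x. p (A x) \<le> c * p x"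
  shows "A \<in> Q"
proof -
  have "\<exists>c>0. \<forall>x. p (A x) \<le> c * p x" if p: "p \<in> P" for p
  proof -
    obtain c where c: "\<forall>x. p (A x) \<le> c * p x" using assms(3)[OF p] by blast
    have "p (A x) \<le> max c 1 * p x" for x
      using c mult_right_mono[of c "max c 1" "p x"] seminorm_nonneg[OF p, of x] by (meson max.cobounded1 order_trans)
    then show ?thesis by (intro exI[of _ "max c 1"]) auto
  qed
  then show ?thesis
    unfolding Q_ops_def Vector_Spaces.linear_iff using assms(1,2) vector_space_axioms by blast
qed

lemma Q_add: "A \<in> Q \<Longrightarrow> A (x + y) = A x + A y"
  and Q_scale: "A \<in> Q \<Longrightarrow> A (sc c x) = sc c (A x)"
  unfolding Q_ops_def Vector_Spaces.linear_iff by blast+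

lemma Q_zero: "A \<in> Q \<Longrightarrow> A 0 = 0"
  using Q_scale[of A 0 0] by simp

lemma Q_minus: "A \<in> Q \<Longrightarrow> A (- x) = - A x"
  using Q_scale[of A "- 1" x] by simp

lemma Q_diff: "A \<in> Q \<Longrightarrow> A (x - y) = A x - A y"
  using Q_add[of A x "- y"] Q_minus by simp

lemma nrm_bound:
  assumes A: "A \<in> Q" and p: "p \<in> P"
  shows "p (A x) \<le> nrm p A * p x"
proof (cases "p x = 0")
  case True
  obtain c where "\<forall>x. p (A x) \<le> c * p x" using A p unfolding Q_ops_def by blast
  then have "p (A x) \<le> c * p x" by blast
  then show ?thesis using True by simp
next
  case False
  then have px: "p x > 0" using seminorm_nonneg[OF p, of x] by simp
  have "p (A x) / p x \<le> nrm p A"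
    unfolding op_seminorm_def
    by (rule cInf_greatest) (use A p px in \<open>auto simp: Q_ops_def field_simps\<close>)
  then show ?thesis using px by (simp add: field_simps)
qed

lemma nrm_le:
  assumes p: "p \<in> P" and c: "0 \<le> c" and le: "\<And>x. p (A x) \<le> c * p x"
  shows "nrm p A \<le> c"
proof (rule dense_ge)
  fix r assume r: "c < r"
  have "p (A x) \<le> r * p x" for x
    using le[of x] mult_right_mono[of c r "p x"] r seminorm_nonneg[OF p, of x] by linarith
  then show "nrm p A \<le> r"
    unfolding op_seminorm_def using r c by (intro cInf_lower bdd_belowI[of _ 0]) auto
qed

lemma nrm_nonneg: "A \<in> Q \<Longrightarrow> p \<in> P \<Longrightarrow> 0 \<le> nrm p A"
  unfolding op_seminorm_def by (rule cInf_greatest) (auto simp: Q_ops_def)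

lemma id_in_Q: "id \<in> Q"
  by (rule QI) (auto intro: exI[of _ 1])

lemma add_bound:
  assumes "A \<in> Q" "B \<in> Q" "p \<in> P"
  shows "p (A x + B x) \<le> (nrm p A + nrm p B) * p x"
  using nrm_bound[OF assms(1,3), of x] nrm_bound[OF assms(2,3), of x]
    seminorm_triangle[OF assms(3), of "A x" "B x"] by (simp add: algebra_simps)

lemma diff_bound:
  assumes "A \<in> Q" "B \<in> Q" "p \<in> P"
  shows "p (A x - B x) \<le> (nrm p A + nrm p B) * p x"
  using nrm_bound[OF assms(1,3), of x] nrm_bound[OF assms(2,3), of x]
    seminorm_diff[OF assms(3), of "A x" "B x"] by (simp add: algebra_simps)

lemma scale_bound:
  assumes "A \<in> Q" "p \<in> P"
  shows "p (sc c (A x)) \<le> (norm c * nrm p A) * p x"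
  using mult_left_mono[OF nrm_bound[OF assms, of x], of "norm c"]
  by (simp add: seminorm_scale[OF assms(2)] mult.assoc)

lemma comp_bound:
  assumes "A \<in> Q" "B \<in> Q" "p \<in> P"
  shows "p (A (B x)) \<le> (nrm p A * nrm p B) * p x"
  using nrm_bound[OF assms(1,3), of "B x"]
    mult_left_mono[OF nrm_bound[OF assms(2,3), of x] nrm_nonneg[OF assms(1,3)]]
  by (simp add: mult.assoc)

lemma add_in_Q: "A \<in> Q \<Longrightarrow> B \<in> Q \<Longrightarrow> (\<lambda>x. A x + B x) \<in> Q"
  by (rule QI) (auto simp: Q_add Q_scale scale_right_distrib algebra_simps intro: add_bound)

lemma diff_in_Q: "A \<in> Q \<Longrightarrow> B \<in> Q \<Longrightarrow> A - B \<in> Q"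
  by (rule QI) (auto simp: fun_diff_def Q_add Q_scale scale_right_diff_distrib algebra_simps intro: diff_bound)

lemma scale_in_Q: "A \<in> Q \<Longrightarrow> (\<lambda>x. sc c (A x)) \<in> Q"
  by (rule QI) (auto simp: Q_add Q_scale scale_right_distrib mult.commute intro: scale_bound)

lemma comp_in_Q: "A \<in> Q \<Longrightarrow> B \<in> Q \<Longrightarrow> A \<circ> B \<in> Q"
  by (rule QI) (auto simp: Q_add Q_scale intro: comp_bound)

lemma nrm_add: "A \<in> Q \<Longrightarrow> B \<in> Q \<Longrightarrow> p \<in> P \<Longrightarrow> nrm p (\<lambda>x. A x + B x) \<le> nrm p A + nrm p B"
  by (rule nrm_le) (auto intro: add_bound nrm_nonneg add_nonneg_nonneg)

lemma nrm_scale: "A \<in> Q \<Longrightarrow> p \<in> P \<Longrightarrow> nrm p (\<lambda>x. sc c (A x)) \<le> norm c * nrm p A"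
  by (rule nrm_le) (auto intro: scale_bound nrm_nonneg mult_nonneg_nonneg)

lemma nrm_comp: "A \<in> Q \<Longrightarrow> B \<in> Q \<Longrightarrow> p \<in> P \<Longrightarrow> nrm p (A \<circ> B) \<le> nrm p A * nrm p B"
  by (rule nrm_le) (auto intro: comp_bound nrm_nonneg mult_nonneg_nonneg)

lemma nrm_triangle:
  assumes "A \<in> Q" "B \<in> Q" "C \<in> Q" "p \<in> P"
  shows "nrm p (C - A) \<le> nrm p (C - B) + nrm p (B - A)"
  using nrm_add[OF diff_in_Q[OF assms(3,2)] diff_in_Q[OF assms(2,1)] assms(4)]
  by (simp add: fun_diff_def)

lemma nrm_diff_commute: "p \<in> P \<Longrightarrow> nrm p (A - B) = nrm p (B - A)"
  unfolding op_seminorm_def using seminorm_minus[of p] by (simp add: fun_diff_def) (metis minus_diff_eq)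

lemma nrm_zero: "p \<in> P \<Longrightarrow> nrm p (\<lambda>x. 0) = 0"
  using nrm_le[of p 0 "\<lambda>x. 0"] nrm_nonneg[of "\<lambda>x. 0" p]
  by (metis QI add_0 mult_zero_left order_antisym order_refl scale_zero_right seminorm_zero)

lemma distance_family_Q: "distance_family Q (nrm ` P)"
  unfolding distance_family_def using nrm_triangle nrm_zero by (auto simp: fun_diff_def)

lemma nrm_separates:
  assumes "A \<in> Q" "B \<in> Q" "\<And>p. p \<in> P \<Longrightarrow> nrm p (A - B) \<le> 0"
  shows "A = B"
proof
  fix x
  have "p (A x - B x) = 0" if p: "p \<in> P" for p
    using nrm_bound[OF diff_in_Q[OF assms(1,2)] p, of x] assms(3)[OF p] seminorm_nonneg[OF p, of x]
      seminorm_nonneg[OF p, of "A x - B x"] by (simp add: mult_nonpos_nonneg) (smt (verit) mult_nonpos_nonneg)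
  then show "A x = B x" using seminorms_separate[of "A x - B x"] by simp
qed

definition Q_limit :: "(nat \<Rightarrow> 'a \<Rightarrow> 'a) \<Rightarrow> ('a \<Rightarrow> 'a) \<Rightarrow> bool" where
  "Q_limit A B \<longleftrightarrow> (\<forall>p\<in>P. (\<lambda>n. nrm p (A n - B)) \<longlonglongrightarrow> 0)"

text \<open>
  Pointwise limits exist by completeness of the space. The Cauchy estimate is uniform in \<open>x\<close> relative
  to \<open>p x\<close>, and letting one index tend to infinity turns it into convergence in the operator seminorm.
\<close>

lemma Q_complete:
  assumes A: "\<And>n. A n \<in> Q"
    and cauchy: "\<And>p e. p \<in> P \<Longrightarrow> e > 0 \<Longrightarrow> \<exists>N. \<forall>m\<ge>N. \<forall>n\<ge>N. nrm p (A m - A n) \<le> e"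
  obtains B where "B \<in> Q" "Q_limit A B"
proof -
  have diff: "p (A m x - A n x) \<le> nrm p (A m - A n) * p x" if "p \<in> P" for p m n x
    using nrm_bound[OF diff_in_Q[OF A A] that, of m n x] by simp
  have "\<exists>l. seminorm_limit (\<lambda>n. A n x) l" for x
  proof -
    have "\<exists>N. \<forall>m\<ge>N. \<forall>n\<ge>N. p (A m x - A n x) < e" if p: "p \<in> P" and e: "e > 0" for p e
    proof -
      define e' where "e' = e / (p x + 1)"
      have px: "p x + 1 > 0" using seminorm_nonneg[OF p, of x] by simp
      then have e': "e' > 0" using e by (simp add: e'_def)
      obtain N where N: "\<forall>m\<ge>N. \<forall>n\<ge>N. nrm p (A m - A n) \<le> e'" using cauchy[OF p e'] by blast
      have "p (A m x - A n x) < e" if "m \<ge> N" "n \<ge> N" for m n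
      proof -
        have "p (A m x - A n x) \<le> e' * p x"
          using diff[OF p, of m x n] N that mult_right_mono[of _ e' "p x"] seminorm_nonneg[OF p, of x]
          by (meson order_trans)
        also have "\<dots> < e' * (p x + 1)" using e' by simp
        finally show ?thesis using px by (simp add: e'_def)
      qed
      then show ?thesis by blast
    qed
    then show ?thesis using seminorm_Cauchy_limit[of "\<lambda>n. A n x"] by blast
  qed
  then obtain B where B: "\<And>x. seminorm_limit (\<lambda>n. A n x) (B x)" by metis
  have close: "p (A n x - B x) \<le> e * p x"
    if p: "p \<in> P" and N: "\<forall>m\<ge>N. \<forall>n\<ge>N. nrm p (A m - A n) \<le> e" and n: "n \<ge> N" for p N e n x
  proof -
    have "p (A n x - B x) \<le> e * p x + p (A m x - B x)" if m: "m \<ge> N" for m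
    proof -
      have "p (A n x - A m x) \<le> e * p x"
        using diff[OF p, of n x m] N m n mult_right_mono[of _ e "p x"] seminorm_nonneg[OF p, of x]
        by (meson order_trans)
      then show ?thesis using seminorm_diff_triangle[OF p, of "A n x" "B x" "A m x"] by linarith
    qed
    moreover have "(\<lambda>m. e * p x + p (A m x - B x)) \<longlonglongrightarrow> e * p x + 0"
      by (intro tendsto_intros seminorm_limitD[OF B p])
    ultimately have "p (A n x - B x) \<le> e * p x + 0" by (intro LIMSEQ_le_const) auto
    then show ?thesis by simp
  qed
  have BQ: "B \<in> Q"
  proof (rule QI)
    show "B (x + y) = B x + B y" for x y
      by (rule seminorm_limit_unique[OF B]) (use seminorm_limit_add[OF B B] in \<open>simp add: Q_add[OF A]\<close>)
    show "B (sc c x) = sc c (B x)" for c x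
      by (rule seminorm_limit_unique[OF B]) (use seminorm_limit_scale[OF B] in \<open>simp add: Q_scale[OF A]\<close>)
    fix p assume p: "p \<in> P"
    obtain N where N: "\<forall>m\<ge>N. \<forall>n\<ge>N. nrm p (A m - A n) \<le> 1" using cauchy[OF p, of 1] by auto
    have "p (B x) \<le> (nrm p (A N) + 1) * p x" for x
      using seminorm_diff[OF p, of "A N x" "A N x - B x"] close[OF p N order_refl, of x]
        nrm_bound[OF A p, of N x] by (simp add: algebra_simps)
    then show "\<exists>c. \<forall>x. p (B x) \<le> c * p x" by blast
  qed
  moreover have "Q_limit A B"
    unfolding Q_limit_def
  proof
    fix p assume p: "p \<in> P"
    show "(\<lambda>n. nrm p (A n - B)) \<longlonglongrightarrow> 0"
    proof (rule LIMSEQ_I)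
      fix e :: real assume e: "e > 0"
      obtain N where N: "\<forall>m\<ge>N. \<forall>n\<ge>N. nrm p (A m - A n) \<le> e / 2" using cauchy[OF p, of "e / 2"] e by auto
      have "nrm p (A n - B) \<le> e / 2" if "n \<ge> N" for n
        using close[OF p N that] e by (intro nrm_le[OF p]) auto
      then show "\<exists>N. \<forall>n\<ge>N. norm (nrm p (A n - B) - 0) < e"
        using nrm_nonneg[OF diff_in_Q[OF A BQ] p] e by (intro exI[of _ N]) fastforce
    qed
  qed
  ultimately show thesis by (rule that)
qed

lemma openin_Q_ball: "p \<in> P \<Longrightarrow> A \<in> Q \<Longrightarrow> e > 0 \<Longrightarrow> openin (Q_topology sc P) {B \<in> Q. nrm p (B - A) < e}"
  using openin_seminorm_ball[OF distance_family_Q, of "{nrm p}" A e]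
  by (simp add: Q_topology_def seminorm_ball_def)

lemma zero_in_Q: "(\<lambda>x. 0) \<in> Q"
  by (rule QI) (auto simp: seminorm_zero intro: exI[of _ 0])

text \<open>
  Boundedness in the sense of von Neumann is boundedness in each operator seminorm; the next two lemmas
  are the two directions. For the converse, a neighbourhood of zero only involves finitely many
  seminorms, which one scalar can dominate.
\<close>

lemma Q_boundedD:
  assumes B: "Q_bounded sc P B" and p: "p \<in> P"
  obtains M where "M \<ge> 0" "\<And>A. A \<in> B \<Longrightarrow> A \<in> Q \<and> nrm p A \<le> M"
proof -
  let ?U = "{A \<in> Q. nrm p (A - (\<lambda>x. 0)) < 1}"
  have "openin (Q_topology sc P) ?U" "(\<lambda>x. 0) \<in> ?U"
    using openin_Q_ball[OF p zero_in_Q, of 1] zero_in_Q nrm_zero[OF p] by (auto simp: fun_diff_def)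
  then obtain r :: real where r: "r > 0" "B \<subseteq> (\<lambda>A x. sc (complex_of_real r) (A x)) ` ?U"
    using B unfolding Q_bounded_def bounded_in_def by blast
  show thesis
  proof (rule that[of r])
    fix A assume "A \<in> B"
    then obtain C where C: "C \<in> Q" "nrm p C < 1" "A = (\<lambda>x. sc (complex_of_real r) (C x))"
      using r(2) by (auto simp: fun_diff_def)
    have "nrm p A \<le> r * nrm p C" using nrm_scale[OF C(1) p, of "of_real r"] C(3) r(1) by simp
    also have "\<dots> \<le> r" using C(2) r(1) by simp
    finally show "A \<in> Q \<and> nrm p A \<le> r" using scale_in_Q[OF C(1)] C(3) by simp
  qed (use r in simp)
qed

lemma Q_boundedI:
  assumes B: "B \<subseteq> Q" and M: "\<And>p. p \<in> P \<Longrightarrow> \<exists>M. \<forall>A\<in>B. nrm p A \<le> M"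
  shows "Q_bounded sc P B"
  unfolding Q_bounded_def bounded_in_def
proof (intro allI impI, elim conjE)
  fix U assume U: "openin (Q_topology sc P) U" "(\<lambda>x. 0) \<in> U"
  obtain F e where F: "finite F" "F \<subseteq> nrm ` P" "e > 0" "seminorm_ball Q F (\<lambda>x. 0) e \<subseteq> U"
    by (rule openin_seminorm_topology_imp[OF distance_family_Q U(1)[unfolded Q_topology_def] U(2)])
  have "\<forall>q\<in>F. \<exists>M. \<forall>A\<in>B. q A \<le> M" using M F(2) by blast
  then obtain N where N: "\<And>q A. q \<in> F \<Longrightarrow> A \<in> B \<Longrightarrow> q A \<le> N q" by metis
  \<comment> \<open>large enough for every seminorm in \<open>F\<close> to be below \<open>e\<close> on the scaled set\<close>
  define r where "r = 1 + (\<Sum>q\<in>F. \<bar>N q\<bar>) / e"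
  have r: "r > 0" unfolding r_def using F(3) by (simp add: add_pos_nonneg sum_nonneg)
  have "B \<subseteq> (\<lambda>A x. sc (complex_of_real r) (A x)) ` U"
  proof
    fix A assume A: "A \<in> B"
    define C where "C = (\<lambda>x. sc (of_real (1 / r)) (A x))"
    have AQ: "A \<in> Q" using A B by blast
    have "C \<in> seminorm_ball Q F (\<lambda>x. 0) e"
      unfolding seminorm_ball_def
    proof (intro CollectI conjI ballI)
      show "C \<in> Q" unfolding C_def by (rule scale_in_Q[OF AQ])
      fix q assume q: "q \<in> F"
      then obtain p where p: "p \<in> P" "q = nrm p" using F(2) by blast
      have "q C \<le> (1 / r) * q A"
        using nrm_scale[OF AQ p(1), of "of_real (1 / r)"] r unfolding C_def p(2) by (simp add: norm_divide)
      also have "\<dots> < e"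
      proof -
        have "q A \<le> \<bar>N q\<bar>" using N[OF q A] by linarith
        also have "\<dots> \<le> (\<Sum>q\<in>F. \<bar>N q\<bar>)" using q F(1) by (intro member_le_sum) auto
        also have "\<dots> < r * e" unfolding r_def using F(3) by (simp add: field_simps)
        finally show ?thesis using r by (simp add: field_simps)
      qed
      finally show "q (C - (\<lambda>x. 0)) < e" by (simp add: fun_diff_def)
    qed
    then have "C \<in> U" using F(4) by blast
    moreover have "A = (\<lambda>x. sc (complex_of_real r) (C x))" using r by (simp add: C_def)
    ultimately show "A \<in> (\<lambda>A x. sc (complex_of_real r) (A x)) ` U" by blast
  qed
  then show "\<exists>r>0. B \<subseteq> (\<lambda>A x. sc (complex_of_real r) (A x)) ` U" using r by blast
qed

lemma continuous_map_into_Q: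
  assumes "\<And>x. x \<in> topspace X \<Longrightarrow> f x \<in> Q"
    and "\<And>p x e. p \<in> P \<Longrightarrow> x \<in> topspace X \<Longrightarrow> e > 0 \<Longrightarrow>
       \<exists>U. openin X U \<and> x \<in> U \<and> (\<forall>y\<in>U. nrm p (f y - f x) < e)"
  shows "continuous_map X (Q_topology sc P) f"
  unfolding Q_topology_def
  by (rule continuous_map_into_seminorm_topology[OF distance_family_Q]) (use assms in blast)+

text \<open>
  This makes the pullback of the topology along an algebra morphism a locally convex topology, which
  is how the universal property of the inductive limit is used below.
\<close>

lemma lc_topology_Q: "lc_topology Q (\<lambda>A B x. A x + B x) (\<lambda>c A x. sc c (A x)) (Q_topology sc P)"
  unfolding lc_topology_def
proof (intro conjI allI impI)
  let ?T = "Q_topology sc P"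
  show top: "topspace ?T = Q" by (simp add: Q_topology_def)
  show "continuous_map (prod_topology ?T ?T) ?T (\<lambda>(A, B) x. A x + B x)"
  proof (rule continuous_map_into_Q)
    fix AB assume "AB \<in> topspace (prod_topology ?T ?T)"
    then show "(\<lambda>(A, B) x. A x + B x) AB \<in> Q" using add_in_Q top by auto
  next
    fix p e AB assume p: "p \<in> P" and AB: "AB \<in> topspace (prod_topology ?T ?T)" and e: "e > (0::real)"
    obtain A B where [simp]: "AB = (A, B)" by (cases AB)
    have A: "A \<in> Q" "B \<in> Q" using AB top by auto
    let ?U = "{C \<in> Q. nrm p (C - A) < e / 2} \<times> {C \<in> Q. nrm p (C - B) < e / 2}"
    have "openin (prod_topology ?T ?T) ?U"
      using openin_Q_ball[OF p A(1), of "e/2"] openin_Q_ball[OF p A(2), of "e/2"] e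
      by (simp add: openin_prod_Times_iff)
    moreover have "AB \<in> ?U" using A e nrm_zero[OF p] by (simp add: fun_diff_def)
    moreover have "nrm p ((\<lambda>(A, B) x. A x + B x) y - (\<lambda>(A, B) x. A x + B x) AB) < e" if "y \<in> ?U" for y
    proof -
      obtain C D where y: "y = (C, D)" by (cases y)
      then have C: "C \<in> Q" "D \<in> Q" "nrm p (C - A) < e / 2" "nrm p (D - B) < e / 2" using that by auto
      have "nrm p (\<lambda>x. (C - A) x + (D - B) x) < e"
        using nrm_add[OF diff_in_Q[OF C(1) A(1)] diff_in_Q[OF C(2) A(2)] p] C by linarith
      then show ?thesis by (simp add: y fun_diff_def algebra_simps)
    qed
    ultimately show "\<exists>U. openin (prod_topology ?T ?T) U \<and> AB \<in> U \<and>
        (\<forall>y\<in>U. nrm p ((\<lambda>(A, B) x. A x + B x) y - (\<lambda>(A, B) x. A x + B x) AB) < e)" by blast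
  qed
  show "continuous_map (prod_topology euclidean ?T) ?T (\<lambda>(c, A) x. sc c (A x))"
  proof (rule continuous_map_into_Q)
    fix cA :: "complex \<times> ('a \<Rightarrow> 'a)" assume "cA \<in> topspace (prod_topology euclidean ?T)"
    then show "(\<lambda>(c, A) x. sc c (A x)) cA \<in> Q" using scale_in_Q top by auto
  next
    fix p e and cA :: "complex \<times> ('a \<Rightarrow> 'a)"
    assume p: "p \<in> P" and cA: "cA \<in> topspace (prod_topology euclidean ?T)" and e: "e > (0::real)"
    obtain c A where [simp]: "cA = (c, A)" by (cases cA)
    have A: "A \<in> Q" using cA top by auto
    \<comment> \<open>\<open>b C - c A = b (C - A) + (b - c) A\<close>, with half of \<open>e\<close> for each summand\<close>
    define \<delta> where "\<delta> = min 1 (e / (2 * (nrm p A + 1)))"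
    define \<eta> where "\<eta> = e / (2 * (norm c + 1))"
    have cancel: "k * (e / (2 * k)) = e / 2" if "k > 0" for k :: real using that by simp
    have nA: "nrm p A \<ge> 0" by (rule nrm_nonneg[OF A p])
    have \<delta>: "\<delta> > 0" "\<delta> \<le> 1" and \<eta>: "\<eta> > 0" using e nA unfolding \<delta>_def \<eta>_def
      by (auto intro!: divide_pos_pos simp: add_nonneg_pos)
    let ?U = "ball c \<delta> \<times> {C \<in> Q. nrm p (C - A) < \<eta>}"
    have "openin (prod_topology euclidean ?T) ?U"
      using openin_Q_ball[OF p A \<eta>] by (simp add: openin_prod_Times_iff)
    moreover have "cA \<in> ?U" using A \<delta> \<eta> nrm_zero[OF p] by (simp add: fun_diff_def)
    moreover have "nrm p ((\<lambda>(c, A) x. sc c (A x)) y - (\<lambda>(c, A) x. sc c (A x)) cA) < e" if "y \<in> ?U" for y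
    proof -
      obtain b C where y: "y = (b, C)" by (cases y)
      then have C: "C \<in> Q" "nrm p (C - A) < \<eta>" and b: "norm (b - c) < \<delta>"
        using that by (auto simp: dist_norm norm_minus_commute)
      have nb: "norm b \<le> norm c + 1" using b \<delta> norm_triangle_sub[of b c] by linarith
      have "nrm p (\<lambda>x. sc b ((C - A) x) + sc (b - c) (A x)) \<le>
          nrm p (\<lambda>x. sc b ((C - A) x)) + nrm p (\<lambda>x. sc (b - c) (A x))"
        by (intro nrm_add scale_in_Q diff_in_Q C A p)
      also have "\<dots> \<le> norm b * nrm p (C - A) + norm (b - c) * nrm p A"
        by (intro add_mono nrm_scale diff_in_Q C A p)
      also have "norm b * nrm p (C - A) \<le> (norm c + 1) * nrm p (C - A)"
        by (intro mult_right_mono nb nrm_nonneg diff_in_Q C A p)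
      also have "(norm c + 1) * nrm p (C - A) < (norm c + 1) * \<eta>"
        using C(2) by (intro mult_strict_left_mono) (auto simp: add_nonneg_pos)
      also have "(norm c + 1) * \<eta> = e / 2" unfolding \<eta>_def by (rule cancel) (simp add: add_nonneg_pos)
      also have "norm (b - c) * nrm p A \<le> \<delta> * (nrm p A + 1)"
        using b nA \<delta> by (intro mult_mono) auto
      also have "\<delta> * (nrm p A + 1) \<le> e / (2 * (nrm p A + 1)) * (nrm p A + 1)"
        unfolding \<delta>_def using nA by (intro mult_right_mono) auto
      also have "\<dots> = e / 2" using nA by (simp add: field_simps)
      finally have "nrm p (\<lambda>x. sc b ((C - A) x) + sc (b - c) (A x)) < e" by simp
      then show ?thesis
        by (simp add: y fun_diff_def scale_right_diff_distrib scale_left_diff_distrib)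
    qed
    ultimately show "\<exists>U. openin (prod_topology euclidean ?T) U \<and> cA \<in> U \<and>
        (\<forall>y\<in>U. nrm p ((\<lambda>(c, A) x. sc c (A x)) y - (\<lambda>(c, A) x. sc c (A x)) cA) < e)" by blast
  qed
  fix U A assume "openin ?T U \<and> A \<in> U"
  then have U: "openin ?T U" "A \<in> U" by auto
  then have A: "A \<in> Q" using openin_subset top by blast
  obtain F e where F: "finite F" "F \<subseteq> nrm ` P" "e > 0" "seminorm_ball Q F A e \<subseteq> U"
    by (rule openin_seminorm_topology_imp[OF distance_family_Q U(1)[unfolded Q_topology_def] U(2)])
  have "openin ?T (seminorm_ball Q F A e)"
    unfolding Q_topology_def by (rule openin_seminorm_ball[OF distance_family_Q F(1,2) A F(3)])
  moreover have "A \<in> seminorm_ball Q F A e"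
    using A F nrm_zero by (auto simp: seminorm_ball_def fun_diff_def)
  moreover have "convex_in (\<lambda>A B x. A x + B x) (\<lambda>c A x. sc c (A x)) (seminorm_ball Q F A e)"
    unfolding convex_in_def
  proof (intro ballI)
    fix B C and t :: real
    assume B: "B \<in> seminorm_ball Q F A e" and C: "C \<in> seminorm_ball Q F A e" and t: "t \<in> {0..1}"
    let ?D = "\<lambda>x. sc (complex_of_real t) (B x) + sc (complex_of_real (1 - t)) (C x)"
    have BQ: "B \<in> Q" "C \<in> Q" using B C by (auto simp: seminorm_ball_def)
    have "q (?D - A) < e" if q: "q \<in> F" for q
    proof -
      obtain p where p: "p \<in> P" "q = nrm p" using q F(2) by blast
      have "?D - A = (\<lambda>x. sc (of_real t) ((B - A) x) + sc (of_real (1 - t)) ((C - A) x))"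
        by (simp add: fun_diff_def fun_eq_iff scale_right_diff_distrib scale_left_diff_distrib)
      then have "q (?D - A) \<le> nrm p (\<lambda>x. sc (of_real t) ((B - A) x)) + nrm p (\<lambda>x. sc (of_real (1 - t)) ((C - A) x))"
        unfolding p(2) by (simp only:) (intro nrm_add scale_in_Q diff_in_Q BQ A p(1))
      also have "\<dots> \<le> norm (complex_of_real t) * nrm p (B - A) + norm (complex_of_real (1 - t)) * nrm p (C - A)"
        by (intro add_mono nrm_scale diff_in_Q BQ A p(1))
      also have "\<dots> = t * nrm p (B - A) + (1 - t) * nrm p (C - A)" using t by (simp flip: of_real_diff)
      also have "\<dots> < e"
        using t B C q p(2) by (intro convex_bound_lt) (auto simp: seminorm_ball_def)
      finally show ?thesis .
    qed
    then show "?D \<in> seminorm_ball Q F A e"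
      unfolding seminorm_ball_def using add_in_Q[OF scale_in_Q[OF BQ(1)] scale_in_Q[OF BQ(2)]] by auto
  qed
  ultimately show "\<exists>V. openin ?T V \<and> A \<in> V \<and> V \<subseteq> U \<and> convex_in (\<lambda>A B x. A x + B x) (\<lambda>c A x. sc c (A x)) V"
    using F(4) by blast
qed

end

section \<open>The Neumann series\<close>

context calibrated_space
begin

lemma geometric_tail:
  fixes B :: "nat \<Rightarrow> 'a \<Rightarrow> 'a"
  assumes B: "\<And>n. B n \<in> Q" and p: "p \<in> P" and M: "M \<ge> 0" "\<And>n. nrm p (B n) \<le> M * (1/2) ^ n"
  shows "n \<ge> m \<Longrightarrow> p ((\<Sum>k<n. B k x) - (\<Sum>k<m. B k x)) \<le> 2 * M * (1/2) ^ m * p x - 2 * M * (1/2) ^ n * p x"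
proof (induction n rule: dec_induct)
  case base
  then show ?case by (simp add: seminorm_zero[OF p])
next
  case (step n)
  have "p (B n x) \<le> M * (1/2) ^ n * p x"
    using nrm_bound[OF B p, of n x] mult_right_mono[OF M(2)[of n] seminorm_nonneg[OF p, of x]] by linarith
  then have "p (((\<Sum>k<n. B k x) - (\<Sum>k<m. B k x)) + B n x) \<le>
      (2 * M * (1/2) ^ m * p x - 2 * M * (1/2) ^ n * p x) + M * (1/2) ^ n * p x"
    using seminorm_triangle[OF p] step.IH by (smt (verit))
  then show ?case by (simp add: algebra_simps)
qed

lemma sum_in_Q: "(\<And>k. k < (n :: nat) \<Longrightarrow> B k \<in> Q) \<Longrightarrow> (\<lambda>x. \<Sum>k<n. B k x) \<in> Q"
proof (induction n)
  case (Suc n)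
  then show ?case using add_in_Q[of "\<lambda>x. \<Sum>k<n. B k x" "B n"] by simp
qed (simp add: zero_in_Q)

lemma geometric_series:
  fixes B :: "nat \<Rightarrow> 'a \<Rightarrow> 'a"
  assumes B: "\<And>n. B n \<in> Q" and M: "\<And>p. p \<in> P \<Longrightarrow> M p \<ge> 0"
    "\<And>p n. p \<in> P \<Longrightarrow> nrm p (B n) \<le> M p * (1/2) ^ n"
  obtains C where "C \<in> Q" "Q_limit (\<lambda>n x. \<Sum>k<n. B k x) C" "\<And>p. p \<in> P \<Longrightarrow> nrm p C \<le> 2 * M p"
proof -
  define S where "S n x = (\<Sum>k<n. B k x)" for n x
  have S: "S n \<in> Q" for n unfolding S_def by (rule sum_in_Q) (rule B)
  have tail: "nrm p (S n - S m) \<le> 2 * M p * (1/2) ^ m" if "p \<in> P" "m \<le> n" for p n m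
  proof (rule nrm_le[OF that(1)])
    fix x
    have "p ((S n - S m) x) \<le> 2 * M p * (1/2) ^ m * p x - 2 * M p * (1/2) ^ n * p x"
      using geometric_tail[OF B that(1) M(1)[OF that(1)] M(2)[OF that(1)] that(2), of x] by (simp add: S_def)
    also have "\<dots> \<le> 2 * M p * (1/2) ^ m * p x" using M(1) seminorm_nonneg that(1) by simp
    finally show "p ((S n - S m) x) \<le> 2 * M p * (1/2) ^ m * p x" .
  qed (use M that in simp)
  have "\<exists>N. \<forall>m\<ge>N. \<forall>n\<ge>N. nrm p (S m - S n) \<le> e" if p: "p \<in> P" and e: "e > 0" for p e
  proof -
    have "(\<lambda>n. 2 * M p * (1/2) ^ n) \<longlonglongrightarrow> 2 * M p * 0"
      by (intro tendsto_intros LIMSEQ_power_zero) simp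
    then have "eventually (\<lambda>n. 2 * M p * (1/2) ^ n < e) sequentially"
      using e by (intro order_tendstoD) auto
    then obtain N where N: "\<And>n. n \<ge> N \<Longrightarrow> 2 * M p * (1/2) ^ n < e"
      unfolding eventually_sequentially by blast
    have "nrm p (S m - S n) \<le> e" if "m \<ge> N" "n \<ge> N" for m n
    proof (cases "m \<le> n")
      case True
      then show ?thesis using tail[OF p True] N[OF that(1)] nrm_diff_commute[OF p, of "S m" "S n"] by simp
    next
      case False
      then show ?thesis using tail[OF p, of n m] N[OF that(2)] by simp
    qed
    then show ?thesis by blast
  qed
  then obtain C where C: "C \<in> Q" "Q_limit S C" by (rule Q_complete[OF S]) blast
  have "nrm p C \<le> 2 * M p" if p: "p \<in> P" for p
  proof -
    have "nrm p C \<le> 2 * M p + nrm p (S n - C)" for n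
    proof -
      have "S 0 = (\<lambda>x. 0)" by (simp add: S_def fun_eq_iff)
      then have "nrm p (S n) \<le> 2 * M p" using tail[OF p, of 0 n] by (simp add: fun_diff_def)
      moreover have "nrm p (C - (\<lambda>x. 0)) \<le> nrm p (C - S n) + nrm p (S n - (\<lambda>x. 0))"
        by (rule nrm_triangle[OF zero_in_Q S C(1) p])
      ultimately show ?thesis using nrm_diff_commute[OF p, of C "S n"] by (simp add: fun_diff_def)
    qed
    moreover have "(\<lambda>n. 2 * M p + nrm p (S n - C)) \<longlonglongrightarrow> 2 * M p + 0"
      using C(2) p unfolding Q_limit_def by (intro tendsto_intros) blast
    ultimately have "nrm p C \<le> 2 * M p + 0" by (intro LIMSEQ_le_const) auto
    then show ?thesis by simp
  qed
  then show thesis using that C unfolding S_def by blast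
qed

lemma Q_limit_apply:
  assumes "Q_limit A B" "\<And>n. A n \<in> Q" "B \<in> Q"
  shows "seminorm_limit (\<lambda>n. A n x) (B x)"
  unfolding seminorm_limit_def
proof
  fix p assume p: "p \<in> P"
  have "(\<lambda>n. nrm p (A n - B) * p x) \<longlonglongrightarrow> 0 * p x"
    using assms(1) p unfolding Q_limit_def by (intro tendsto_intros) blast
  then show "(\<lambda>n. p (A n x - B x)) \<longlonglongrightarrow> 0"
    using nrm_bound[OF diff_in_Q[OF assms(2,3)] p, of _ x] seminorm_nonneg[OF p]
    by (intro tendsto_zero_le[of "\<lambda>n. p (A n x - B x)" "\<lambda>n. nrm p (A n - B) * p x"]) auto
qed

lemma seminorm_limit_Q:
  assumes "A \<in> Q" "seminorm_limit X l"
  shows "seminorm_limit (\<lambda>n. A (X n)) (A l)"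
  unfolding seminorm_limit_def
proof
  fix p assume p: "p \<in> P"
  have "(\<lambda>n. nrm p A * p (X n - l)) \<longlonglongrightarrow> nrm p A * 0"
    by (intro tendsto_intros seminorm_limitD[OF assms(2) p])
  then show "(\<lambda>n. p (A (X n) - A l)) \<longlonglongrightarrow> 0"
    using nrm_bound[OF assms(1) p, of "X _ - l"] seminorm_nonneg[OF p]
    by (intro tendsto_zero_le[of "\<lambda>n. p (A (X n) - A l)" "\<lambda>n. nrm p A * p (X n - l)"])
      (auto simp: Q_diff[OF assms(1)])
qed

lemma Q_invertibleI:
  assumes "A \<in> Q" "B \<in> Q" "\<And>x. A (B x) = x" "\<And>x. B (A x) = x"
  shows "Q_invertible sc P A" "inv A = B"
proof -
  have "A \<circ> B = id" "B \<circ> A = id" using assms(3,4) by auto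
  then show "Q_invertible sc P A" "inv A = B"
    unfolding Q_invertible_def using assms(1,2) inv_unique_comp by blast+
qed

lemma funpow_in_Q: "A \<in> Q \<Longrightarrow> A ^^ n \<in> Q"
  by (induction n) (auto intro: comp_in_Q simp: id_in_Q[unfolded id_def] id_def)

lemma shift_in_Q: "A \<in> Q \<Longrightarrow> (\<lambda>x. sc l x - A x) \<in> Q"
  using diff_in_Q[OF scale_in_Q[OF id_in_Q, of l]] by (simp add: fun_diff_def)

lemma funpow_scale:
  assumes "A \<in> Q"
  shows "((\<lambda>x. sc c (A x)) ^^ n) x = sc (c ^ n) ((A ^^ n) x)"
  by (induction n) (auto simp: Q_scale[OF assms])

text \<open>
  If the powers of \<open>\<alpha> T\<close> are bounded, then for \<open>norm l > 2 / norm \<alpha>\<close> the terms of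
  \<open>(\<Sum>n. T ^^ n / l ^ (n + 1))\<close> decay like \<open>(1/2) ^ n\<close>, with a constant that does not depend on \<open>l\<close>. The
  bound on the sum is therefore uniform in \<open>l\<close>, as boundedness of the resolvent near infinity requires.
\<close>

lemma Neumann_series:
  assumes T: "T \<in> Q_bounded_elements sc P"
  obtains \<rho> M where "\<rho> > 0" "\<And>l. norm l > \<rho> \<Longrightarrow> Q_invertible sc P (\<lambda>x. sc l x - T x)"
    "\<And>p l. p \<in> P \<Longrightarrow> norm l > \<rho> \<Longrightarrow> nrm p (inv (\<lambda>x. sc l x - T x)) \<le> M p"
proof -
  obtain \<alpha> where \<alpha>: "\<alpha> \<noteq> 0" and TQ: "T \<in> Q"
    and bd: "Q_bounded sc P {(\<lambda>x. sc \<alpha> (T x)) ^^ n | n. 1 \<le> n}"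
    using T unfolding Q_bounded_elements_def by blast
  have "\<exists>M\<ge>0. \<forall>n. nrm p ((\<lambda>x. sc \<alpha> (T x)) ^^ n) \<le> M" if p: "p \<in> P" for p
  proof -
    obtain M where M: "M \<ge> 0" "\<And>A. A \<in> {(\<lambda>x. sc \<alpha> (T x)) ^^ n | n. 1 \<le> n} \<Longrightarrow> A \<in> Q \<and> nrm p A \<le> M"
      by (rule Q_boundedD[OF bd p]) blast
    \<comment> \<open>the power with exponent \<open>0\<close> is not covered by the hypothesis, hence the extra summand\<close>
    have "nrm p ((\<lambda>x. sc \<alpha> (T x)) ^^ n) \<le> M + nrm p id" for n
    proof (cases "n = 0")
      case True
      then show ?thesis using M(1) by (simp add: id_def)
    next
      case False
      then have "(\<lambda>x. sc \<alpha> (T x)) ^^ n \<in> {(\<lambda>x. sc \<alpha> (T x)) ^^ n | n. 1 \<le> n}" by auto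
      then have "nrm p ((\<lambda>x. sc \<alpha> (T x)) ^^ n) \<le> M" using M(2) by blast
      then show ?thesis using nrm_nonneg[OF id_in_Q p] by linarith
    qed
    then show ?thesis using M(1) nrm_nonneg[OF id_in_Q p] by (intro exI[of _ "M + nrm p id"]) auto
  qed
  then obtain M where M: "\<And>p. p \<in> P \<Longrightarrow> M p \<ge> 0"
    "\<And>p n. p \<in> P \<Longrightarrow> nrm p ((\<lambda>x. sc \<alpha> (T x)) ^^ n) \<le> M p" by metis
  define \<rho> where "\<rho> = 2 / norm \<alpha>"
  have \<rho>: "\<rho> > 0" using \<alpha> by (simp add: \<rho>_def)
  have main: "Q_invertible sc P (\<lambda>x. sc l x - T x) \<and>
      (\<forall>p\<in>P. nrm p (inv (\<lambda>x. sc l x - T x)) \<le> 2 * (M p / \<rho>))" if l: "norm l > \<rho>" for l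
  proof -
    have l0: "l \<noteq> 0" using l \<rho> by auto
    define B where "B n x = sc (inverse l ^ Suc n) ((T ^^ n) x)" for n x
    have B: "B n \<in> Q" for n unfolding B_def by (intro scale_in_Q funpow_in_Q TQ)
    have Bn: "nrm p (B n) \<le> M p / \<rho> * (1/2) ^ n" if p: "p \<in> P" for p n
    proof -
      have "B n = (\<lambda>x. sc (inverse l * inverse (\<alpha> * l) ^ n) (((\<lambda>x. sc \<alpha> (T x)) ^^ n) x))"
      proof
        fix x
        have "inverse l ^ Suc n = (inverse l * inverse (\<alpha> * l) ^ n) * \<alpha> ^ n"
          using \<alpha> l0 by (simp add: power_mult_distrib power_inverse field_simps)
        then show "B n x = sc (inverse l * inverse (\<alpha> * l) ^ n) (((\<lambda>x. sc \<alpha> (T x)) ^^ n) x)"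
          unfolding B_def funpow_scale[OF TQ] scale_scale by simp
      qed
      then have "nrm p (B n) \<le> norm (inverse l * inverse (\<alpha> * l) ^ n) * nrm p ((\<lambda>x. sc \<alpha> (T x)) ^^ n)"
        using nrm_scale[OF funpow_in_Q[OF scale_in_Q[OF TQ]] p] by simp
      also have "\<dots> \<le> ((1 / \<rho>) * (1/2) ^ n) * M p"
      proof (rule mult_mono[OF _ M(2)[OF p]])
        have "norm (inverse l) \<le> 1 / \<rho>"
          using le_imp_inverse_le[of \<rho> "norm l"] l \<rho> by (simp add: norm_inverse divide_inverse)
        moreover have "norm (inverse (\<alpha> * l)) \<le> 1 / 2"
        proof -
          have "2 \<le> norm (\<alpha> * l)" using l \<alpha> by (simp add: \<rho>_def norm_mult field_simps)
          then show ?thesis using le_imp_inverse_le[of 2 "norm (\<alpha> * l)"]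
            by (simp only: norm_inverse) simp
        qed
        ultimately show "norm (inverse l * inverse (\<alpha> * l) ^ n) \<le> (1 / \<rho>) * (1/2) ^ n"
          unfolding norm_mult norm_power using \<rho> by (intro mult_mono power_mono) auto
      qed (use \<rho> nrm_nonneg[OF funpow_in_Q[OF scale_in_Q[OF TQ]] p] in auto)
      finally show ?thesis by (simp add: mult.commute)
    qed
    have Mr: "M p / \<rho> \<ge> 0" if "p \<in> P" for p using M(1)[OF that] \<rho> by simp
    obtain C where C: "C \<in> Q" "Q_limit (\<lambda>n x. \<Sum>k<n. B k x) C"
      "\<And>p. p \<in> P \<Longrightarrow> nrm p C \<le> 2 * (M p / \<rho>)"
      using geometric_series[OF B Mr Bn] by blast
    define S where "S n x = (\<Sum>k<n. B k x)" for n x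
    have SQ: "S n \<in> Q" for n unfolding S_def by (rule sum_in_Q) (rule B)
    have S: "seminorm_limit (\<lambda>n. S n x) (C x)" for x
      by (rule Q_limit_apply[OF _ SQ C(1)]) (use C(2) in \<open>simp add: S_def[abs_def]\<close>)
    let ?A = "\<lambda>x. sc l x - T x"
    have A: "?A \<in> Q" by (rule shift_in_Q[OF TQ])
    have Tpow: "T ((T ^^ n) x) = (T ^^ n) (T x)" for n x by (simp add: funpow_swap1)
    \<comment> \<open>the product of \<open>l - T\<close> with the partial sums telescopes\<close>
    have AB: "?A (B n x) = sc (inverse l ^ n) ((T ^^ n) x) - sc (inverse l ^ Suc n) ((T ^^ Suc n) x)" for n x
      using l0 by (simp add: B_def Q_scale[OF TQ])
    have BA: "B n (?A x) = ?A (B n x)" for n x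
      unfolding AB using l0
      by (simp add: B_def Q_diff[OF funpow_in_Q[OF TQ]] Q_scale[OF funpow_in_Q[OF TQ]]
          scale_right_diff_distrib Tpow)
    have lB: "sc l (B n x) = sc (inverse l ^ n) ((T ^^ n) x)" for n x
      using l0 by (simp add: B_def)
    have AS: "?A (S n x) = x - sc l (B n x)" for n x
    proof (induction n)
      case 0
      then show ?case using l0 by (simp add: S_def B_def Q_zero[OF TQ])
    next
      case (Suc n)
      have "?A (S (Suc n) x) = ?A (S n x) + ?A (B n x)"
        using Q_add[OF A, of "S n x" "B n x"] by (simp add: S_def)
      also have "\<dots> = x - sc l (B (Suc n) x)"
        unfolding Suc AB unfolding lB by simp
      finally show ?case .
    qed
    have SA: "S n (?A x) = ?A (S n x)" for n x
    proof (induction n)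
      case 0
      then show ?case by (simp add: S_def Q_zero[OF TQ])
    next
      case (Suc n)
      then show ?case using Q_add[OF A, of "S n x" "B n x"] BA[of n x] by (simp add: S_def)
    qed
    have lim: "seminorm_limit (\<lambda>n. x - sc l (B n x)) x" for x
      unfolding seminorm_limit_def
    proof
      fix p assume p: "p \<in> P"
      show "(\<lambda>n. p (x - sc l (B n x) - x)) \<longlonglongrightarrow> 0"
      proof (rule tendsto_zero_le)
        show "p (x - sc l (B n x) - x) \<le> norm l * (M p / \<rho> * (1/2) ^ n) * p x" for n
          using mult_left_mono[OF order_trans[OF nrm_bound[OF B p, of n x]
              mult_right_mono[OF Bn[OF p, of n] seminorm_nonneg[OF p, of x]]], of "norm l"]
            seminorm_minus[OF p, of "sc l (B n x)"]
          by (simp add: seminorm_scale[OF p] mult.assoc)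
        have "(\<lambda>n. norm l * (M p / \<rho> * (1/2) ^ n) * p x) \<longlonglongrightarrow> norm l * (M p / \<rho> * 0) * p x"
          by (intro tendsto_intros LIMSEQ_power_zero) simp
        then show "(\<lambda>n. norm l * (M p / \<rho> * (1/2) ^ n) * p x) \<longlonglongrightarrow> 0" by simp
      qed (rule seminorm_nonneg[OF p])
    qed
    have "?A (C x) = x" for x
      using seminorm_limit_unique[OF seminorm_limit_Q[OF A S, of x]] lim[of x] by (simp add: AS)
    moreover have "C (?A x) = x" for x
      using seminorm_limit_unique[OF S[of "?A x"]] lim[of x] by (simp add: SA AS)
    ultimately have "Q_invertible sc P ?A" "inv ?A = C"
      by (intro Q_invertibleI[OF A C(1)]; simp)+
    then show ?thesis using C(3) by simp
  qed
  show thesis by (rule that[OF \<rho>, of "\<lambda>p. 2 * (M p / \<rho>)"]) (use main in blast)+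
qed

end

section \<open>The resolvent\<close>

locale bounded_operator = calibrated_space +
  fixes T :: "'a \<Rightarrow> 'a" and K :: "complex set"
  assumes bounded_element: "T \<in> Q_bounded_elements sc P"
    and spectrum: "K = {z. Some z \<in> waelbroeck_spectrum sc P T}"
begin

abbreviation R :: "complex \<Rightarrow> 'a \<Rightarrow> 'a" where "R l \<equiv> inv (\<lambda>x. sc l x - T x)"

lemma T_in_Q: "T \<in> Q"
  using bounded_element unfolding Q_bounded_elements_def by blast

text \<open>
  Around a finite point, neighbourhoods on the sphere can be shrunk to neighbourhoods in the plane.
\<close>

lemma outside_spectrum_iff:
  "z \<notin> K \<longleftrightarrow> (\<exists>V. open V \<and> z \<in> V \<and> (\<forall>l\<in>V. Q_invertible sc P (\<lambda>x. sc l x - T x)) \<and>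
     Q_bounded sc P {R l | l. l \<in> V})"
proof
  assume "z \<notin> K"
  then obtain V U where U: "openin riemann_sphere U" "Some z \<in> U" "U \<subseteq> V"
    and inv: "\<forall>l. Some l \<in> V \<longrightarrow> Q_invertible sc P (\<lambda>x. sc l x - T x)"
    and bd: "Q_bounded sc P {R l | l. Some l \<in> V}"
    unfolding spectrum waelbroeck_spectrum_def waelbroeck_resolvent_set_def by blast
  have "openin euclidean {l. l \<in> topspace (euclidean :: complex topology) \<and> Some l \<in> U}"
    by (rule openin_continuous_map_preimage[OF continuous_map_Some U(1)])
  then have "open {l. Some l \<in> U}" by simp
  moreover have "Q_bounded sc P {R l | l. l \<in> {l. Some l \<in> U}}"
    using bd U(3) unfolding Q_bounded_def bounded_in_def by (smt (verit) mem_Collect_eq subset_iff)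
  ultimately show "\<exists>V. open V \<and> z \<in> V \<and> (\<forall>l\<in>V. Q_invertible sc P (\<lambda>x. sc l x - T x)) \<and>
      Q_bounded sc P {R l | l. l \<in> V}"
    using U inv by (intro exI[of _ "{l. Some l \<in> U}"]) auto
next
  assume "\<exists>V. open V \<and> z \<in> V \<and> (\<forall>l\<in>V. Q_invertible sc P (\<lambda>x. sc l x - T x)) \<and>
      Q_bounded sc P {R l | l. l \<in> V}"
  then obtain V where V: "open V" "z \<in> V" "\<forall>l\<in>V. Q_invertible sc P (\<lambda>x. sc l x - T x)"
    "Q_bounded sc P {R l | l. l \<in> V}" by blast
  have "{R l | l. Some l \<in> Some ` V} = {R l | l. l \<in> V}" by blast
  then have "Some z \<in> waelbroeck_resolvent_set sc P T"
    unfolding waelbroeck_resolvent_set_def using V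
    by (intro CollectI exI[of _ "Some ` V"] conjI exI[of _ "Some ` V"]) auto
  then show "z \<notin> K" by (simp add: spectrum waelbroeck_spectrum_def)
qed

lemma resolvent_locally_bounded:
  assumes "z \<notin> K"
  obtains V where "open V" "z \<in> V" "V \<inter> K = {}" "\<And>p. p \<in> P \<Longrightarrow> \<exists>M. \<forall>l\<in>V. nrm p (R l) \<le> M"
proof -
  obtain V where V: "open V" "z \<in> V" "\<forall>l\<in>V. Q_invertible sc P (\<lambda>x. sc l x - T x)"
    "Q_bounded sc P {R l | l. l \<in> V}" using assms outside_spectrum_iff by blast
  have "V \<inter> K = {}" using V outside_spectrum_iff by blast
  moreover have "\<exists>M. \<forall>l\<in>V. nrm p (R l) \<le> M" if p: "p \<in> P" for p
  proof -
    obtain M where "\<And>A. A \<in> {R l | l. l \<in> V} \<Longrightarrow> A \<in> Q \<and> nrm p A \<le> M"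
      by (rule Q_boundedD[OF V(4) p]) blast
    then show ?thesis by (intro exI[of _ M]) blast
  qed
  ultimately show thesis using that V by blast
qed

lemma
  assumes "l \<notin> K"
  shows resolvent_in_Q: "R l \<in> Q"
    and resolvent_right: "sc l (R l x) - T (R l x) = x"
    and resolvent_left: "R l (sc l x - T x) = x"
proof -
  have "Q_invertible sc P (\<lambda>x. sc l x - T x)" using assms outside_spectrum_iff by blast
  then obtain B where B: "B \<in> Q" "(\<lambda>x. sc l x - T x) \<circ> B = id" "B \<circ> (\<lambda>x. sc l x - T x) = id"
    unfolding Q_invertible_def by blast
  then have [simp]: "R l = B" using inv_unique_comp by blast
  show "R l \<in> Q" using B by simp
  show "sc l (R l x) - T (R l x) = x" "R l (sc l x - T x) = x"
    using B(2,3) by (auto simp: fun_eq_iff)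
qed

lemma resolvent_identity:
  assumes "l \<notin> K" "m \<notin> K"
  shows "R l x - R m x = sc (m - l) (R l (R m x))"
proof -
  note Rl = resolvent_in_Q[OF assms(1)]
  have "R l (sc m (R m x) - T (R m x)) - R l (sc l (R m x) - T (R m x)) = sc (m - l) (R l (R m x))"
    by (simp add: Q_diff[OF Rl] Q_scale[OF Rl] scale_left_diff_distrib)
  then show ?thesis using resolvent_right[OF assms(2), of x] resolvent_left[OF assms(1), of "R m x"] by simp
qed

lemma resolvent_bounded_near_infinity:
  obtains \<rho> M where "\<rho> > 0" "K \<subseteq> cball 0 \<rho>" "\<And>p l. p \<in> P \<Longrightarrow> norm l > \<rho> \<Longrightarrow> nrm p (R l) \<le> M p"
proof -
  obtain \<rho> M where \<rho>: "\<rho> > 0" and inv: "\<And>l. norm l > \<rho> \<Longrightarrow> Q_invertible sc P (\<lambda>x. sc l x - T x)"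
    and M: "\<And>p l. p \<in> P \<Longrightarrow> norm l > \<rho> \<Longrightarrow> nrm p (R l) \<le> M p"
    by (rule Neumann_series[OF bounded_element]) blast
  have RQ: "R l \<in> Q" if l: "norm l > \<rho>" for l
    using inv[OF l] inv_unique_comp unfolding Q_invertible_def by metis
  have "z \<notin> K" if "norm z > \<rho>" for z
    unfolding outside_spectrum_iff
  proof (intro exI[of _ "- cball 0 \<rho>"] conjI)
    show "Q_bounded sc P {R l | l. l \<in> - cball 0 \<rho>}"
      by (rule Q_boundedI) (use RQ M in \<open>auto simp: not_le\<close>)
  qed (use that inv in auto)
  then have "K \<subseteq> cball 0 \<rho>" by force
  then show thesis using that \<rho> M by blast
qed

lemma compact_spectrum: "compact K"
proof -
  obtain \<rho> where "K \<subseteq> cball 0 \<rho>" by (rule resolvent_bounded_near_infinity)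
  then have "bounded K" using bounded_subset bounded_cball by blast
  moreover have "open (- K)"
  proof (subst open_subopen, rule ballI)
    fix z assume "z \<in> - K"
    then obtain V where "open V" "z \<in> V" "V \<inter> K = {}" by (metis ComplD resolvent_locally_bounded)
    then show "\<exists>V. open V \<and> z \<in> V \<and> V \<subseteq> - K" by blast
  qed
  ultimately show ?thesis using compact_eq_bounded_closed closed_def by blast
qed

lemma resolvent_bounded_on_compact:
  assumes C: "compact C" "C \<inter> K = {}" and p: "p \<in> P"
  obtains M where "M \<ge> 0" "\<And>l. l \<in> C \<Longrightarrow> nrm p (R l) \<le> M"
proof -
  have "\<exists>V. open V \<and> z \<in> V \<and> (\<exists>M. \<forall>l\<in>V. nrm p (R l) \<le> M)" if "z \<in> C" for z
    using resolvent_locally_bounded[of z] C(2) that p by (metis disjoint_iff)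
  then obtain V where V: "\<And>z. z \<in> C \<Longrightarrow> open (V z) \<and> z \<in> V z \<and> (\<exists>M. \<forall>l\<in>V z. nrm p (R l) \<le> M)" by metis
  then obtain M where M: "\<And>z l. z \<in> C \<Longrightarrow> l \<in> V z \<Longrightarrow> nrm p (R l) \<le> M z" by metis
  obtain D where D: "D \<subseteq> C" "finite D" "C \<subseteq> (\<Union>z\<in>D. V z)"
    using compactE_image[OF C(1), of C V] V by blast
  show thesis
  proof (rule that[of "\<Sum>z\<in>D. \<bar>M z\<bar>"])
    fix l assume "l \<in> C"
    then obtain z where z: "z \<in> D" "l \<in> V z" using D by blast
    have "nrm p (R l) \<le> \<bar>M z\<bar>" using M[of z l] z D by force
    also have "\<dots> \<le> (\<Sum>z\<in>D. \<bar>M z\<bar>)" using z D by (intro member_le_sum) auto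
    finally show "nrm p (R l) \<le> (\<Sum>z\<in>D. \<bar>M z\<bar>)" .
  qed (simp add: sum_nonneg)
qed

context
  fixes p \<phi>
  assumes p: "p \<in> P" and \<phi>: "dominated_functional sc p \<phi>"
begin

lemma functional_add: "\<phi> (x + y) = \<phi> x + \<phi> y"
  and functional_scale: "\<phi> (sc c x) = c * \<phi> x"
  and functional_le: "norm (\<phi> x) \<le> p x"
  using \<phi> unfolding dominated_functional_def by blast+

lemma functional_diff: "\<phi> (x - y) = \<phi> x - \<phi> y"
  using functional_add[of "x - y" y] by simp

text \<open>
  The resolvent identity expresses the difference quotient of \<open>R\<close> at \<open>a\<close> as \<open>- R z (R a x)\<close>, and
  the local boundedness built into the Waelbroeck resolvent set makes this continuous in \<open>z\<close>.
\<close>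

lemma resolvent_functional_holomorphic: "(\<lambda>z. \<phi> (R z x)) holomorphic_on (- K)"
proof -
  have "((\<lambda>z. \<phi> (R z x)) has_field_derivative - \<phi> (R a (R a x))) (at a)" if a: "a \<in> - K" for a
    unfolding has_field_derivative_iff
  proof -
    obtain V where V: "open V" "a \<in> V" "V \<inter> K = {}" and "\<exists>M. \<forall>l\<in>V. nrm p (R l) \<le> M"
      using resolvent_locally_bounded[of a] a p by (metis ComplD)
    then obtain M where M: "\<And>l. l \<in> V \<Longrightarrow> nrm p (R l) \<le> M" by blast
    have evV: "eventually (\<lambda>z. z \<in> V - {a}) (at a)" by (rule eventually_at_in_open[OF V(1,2)])
    have aK: "a \<notin> K" using a by simp
    define y where "y = R a x"
    have lim: "((\<lambda>z. \<phi> (R z y)) \<longlongrightarrow> \<phi> (R a y)) (at a)"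
    proof (rule Lim_transform_bound[where g = "\<lambda>z. of_real (norm (z - a) * (M * p (R a y)))" and f = "\<lambda>z. \<phi> (R z y) - \<phi> (R a y)", THEN LIM_zero_cancel])
      show "\<forall>\<^sub>F z in at a. norm (\<phi> (R z y) - \<phi> (R a y)) \<le> norm (of_real (norm (z - a) * (M * p (R a y))) :: real)"
        using evV
      proof eventually_elim
        case (elim z)
        have zK: "z \<notin> K" using V(3) elim by blast
        have "R z y - R a y = sc (a - z) (R z (R a y))" by (rule resolvent_identity[OF zK aK])
        then have "norm (\<phi> (R z y) - \<phi> (R a y)) = norm (a - z) * norm (\<phi> (R z (R a y)))"
          by (simp add: functional_diff[symmetric] functional_scale norm_mult)
        also have "norm (\<phi> (R z (R a y))) \<le> M * p (R a y)"
          using functional_le[of "R z (R a y)"] nrm_bound[OF resolvent_in_Q[OF zK] p, of "R a y"]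
            mult_right_mono[OF M[of z] seminorm_nonneg[OF p, of "R a y"]] elim by auto
        finally have "norm (\<phi> (R z y) - \<phi> (R a y)) \<le> norm (z - a) * (M * p (R a y))"
          by (simp add: norm_minus_commute mult_left_mono)
        then show ?case by simp
      qed
      show "((\<lambda>z. of_real (norm (z - a) * (M * p (R a y))) :: real) \<longlongrightarrow> 0) (at a)"
        by (auto intro!: tendsto_eq_intros)
    qed
    show "((\<lambda>z. (\<phi> (R z x) - \<phi> (R a x)) / (z - a)) \<longlongrightarrow> - \<phi> (R a (R a x))) (at a)"
    proof (rule Lim_transform_eventually)
      show "((\<lambda>z. - \<phi> (R z y)) \<longlongrightarrow> - \<phi> (R a (R a x))) (at a)"
        using tendsto_minus[OF lim] by (simp add: y_def)
      show "\<forall>\<^sub>F z in at a. - \<phi> (R z y) = (\<phi> (R z x) - \<phi> (R a x)) / (z - a)"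
        using evV
      proof eventually_elim
        case (elim z)
        have zK: "z \<notin> K" using V(3) elim by blast
        have "\<phi> (R z x) - \<phi> (R a x) = (a - z) * \<phi> (R z y)"
          unfolding y_def functional_diff[symmetric] resolvent_identity[OF zK aK] functional_scale ..
        then show ?case using elim by (simp add: field_simps)
      qed
    qed
  qed
  moreover have "open (- K)" using compact_spectrum compact_imp_closed by blast
  ultimately show ?thesis unfolding holomorphic_on_open[OF \<open>open (- K)\<close>] by blast
qed

text \<open>
  Iterating \<open>z R z = 1 + R z T\<close> gives \<open>z (z R z - 1) = T + R z T\<^sup>2\<close>, which is bounded near infinity. So
  \<open>R z\<close> is \<open>1 / z\<close> up to order two, and the normalisation of the cycle applies.
\<close>

lemma cycle_integral_resolvent:
  assumes C: "cauchy_cycle K U I w a b"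
  shows "(\<Sum>i\<in>I. w i * contour_integral (linepath (a i) (b i)) (\<lambda>z. \<phi> (R z x))) = 2 * pi * \<i> * \<phi> x"
proof -
  obtain \<rho> M where \<rho>: "\<rho> > 0" "K \<subseteq> cball 0 \<rho>" and M: "\<And>p l. p \<in> P \<Longrightarrow> norm l > \<rho> \<Longrightarrow> nrm p (R l) \<le> M p"
    by (rule resolvent_bounded_near_infinity) blast
  have "norm (z * (z * \<phi> (R z x) - \<phi> x)) \<le> p (T x) + M p * p (T (T x))" if z: "norm z > \<rho>" for z
  proof -
    have zK: "z \<notin> K" using \<rho>(2) z by auto
    note RQ = resolvent_in_Q[OF zK]
    have step: "sc z (R z y) = y + R z (T y)" for y
      using resolvent_left[OF zK, of y] by (simp add: Q_diff[OF RQ] Q_scale[OF RQ] algebra_simps)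
    have "z * \<phi> (R z y) = \<phi> y + \<phi> (R z (T y))" for y
      using step[of y] by (metis functional_add functional_scale)
    then have "z * (z * \<phi> (R z x) - \<phi> x) = \<phi> (T x) + \<phi> (R z (T (T x)))" by (simp add: algebra_simps)
    then have "norm (z * (z * \<phi> (R z x) - \<phi> x)) \<le> norm (\<phi> (T x)) + norm (\<phi> (R z (T (T x))))"
      using norm_triangle_ineq by simp
    also have "\<dots> \<le> p (T x) + M p * p (T (T x))"
      using functional_le[of "T x"] functional_le[of "R z (T (T x))"] nrm_bound[OF RQ p, of "T (T x)"]
        mult_right_mono[OF M[OF p z] seminorm_nonneg[OF p, of "T (T x)"]] by linarith
    finally show ?thesis .
  qed
  then show ?thesis using C resolvent_functional_holomorphic unfolding cauchy_cycle_def by blast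
qed

end

end

section \<open>The rational calculus\<close>

context bounded_operator
begin

text \<open>
  Rational functions with poles outside \<open>C\<close>, paired with the operators obtained by substituting \<open>T\<close>.
  It is a relation because one function can be written in several ways; that the operator depends on the
  function only is a consequence of the estimate below.
\<close>

inductive rational_calculus :: "complex set \<Rightarrow> (complex \<Rightarrow> complex) \<Rightarrow> ('a \<Rightarrow> 'a) \<Rightarrow> bool" for C where
  one: "rational_calculus C (\<lambda>z. 1) (\<lambda>x. x)"
| ident: "rational_calculus C (\<lambda>z. z) T"
| resolvent: "\<mu> \<notin> C \<Longrightarrow> rational_calculus C (\<lambda>z. 1 / (\<mu> - z)) (R \<mu>)"
| add: "rational_calculus C r A \<Longrightarrow> rational_calculus C s B \<Longrightarrow>
    rational_calculus C (\<lambda>z. r z + s z) (\<lambda>x. A x + B x)"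
| scale: "rational_calculus C r A \<Longrightarrow> rational_calculus C (\<lambda>z. c * r z) (\<lambda>x. sc c (A x))"
| mult: "rational_calculus C r A \<Longrightarrow> rational_calculus C s B \<Longrightarrow>
    rational_calculus C (\<lambda>z. r z * s z) (\<lambda>x. A (B x))"

lemma rational_calculus_in_Q:
  assumes "K \<subseteq> C"
  shows "rational_calculus C r A \<Longrightarrow> A \<in> Q"
proof (induction rule: rational_calculus.induct)
  case (resolvent \<mu>)
  then show ?case using assms by (intro resolvent_in_Q) blast
qed (simp_all add: id_in_Q[unfolded id_def] T_in_Q add_in_Q scale_in_Q comp_in_Q[unfolded o_def])

lemma rational_calculus_holomorphic:
  "rational_calculus C r A \<Longrightarrow> r holomorphic_on C"
  by (induction rule: rational_calculus.induct) (auto intro!: holomorphic_intros)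

lemma rational_calculus_antimono:
  assumes "B \<subseteq> C"
  shows "rational_calculus C r A \<Longrightarrow> rational_calculus B r A"
  by (induction rule: rational_calculus.induct) (use assms in \<open>auto intro: rational_calculus.intros\<close>)

lemma rational_calculus_diff:
  assumes "rational_calculus C r A" "rational_calculus C s B"
  shows "rational_calculus C (\<lambda>z. r z - s z) (A - B)"
proof -
  have "A - B = (\<lambda>x. A x + sc (- 1) (B x))" by (simp add: fun_eq_iff)
  then show ?thesis
    using rational_calculus.add[OF assms(1) rational_calculus.scale[OF assms(2), of "- 1"]] by simp
qed

lemma fraction_sum_calculus:
  assumes "A \<inter> C = {}"
  shows "fraction_sum A r \<Longrightarrow> \<exists>S. rational_calculus C r S"
proof (induction rule: fraction_sum.induct)
  case zero
  show ?case using rational_calculus.scale[OF rational_calculus.one, of C 0] by auto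
next
  case (add r \<mu> c)
  then obtain S where S: "rational_calculus C r S" by blast
  have "\<mu> \<notin> C" using add assms by blast
  from rational_calculus.add[OF rational_calculus.scale[OF rational_calculus.resolvent[OF this], of c] S]
  show ?case by auto
qed

text \<open>
  The polynomial identity that \<open>\<lambda> - t\<close> divides \<open>r \<lambda> - r t\<close>, with \<open>T\<close> in place of \<open>t\<close>, says that
  \<open>(r z - A) R z\<close> has no singularity on \<open>K\<close>. The induction verifies this after application of a
  functional; for a product it uses \<open>r s - A B = r (s - B) + (r - A) B\<close>, which is why \<open>x\<close> has to vary.
\<close>

lemma rational_calculus_extension:
  assumes KW: "K \<subseteq> W" and p: "p \<in> P" and \<phi>: "dominated_functional sc p \<phi>"
  shows "rational_calculus W r A \<Longrightarrow>
    \<exists>g. g holomorphic_on W \<and> (\<forall>z\<in>W - K. g z = r z * \<phi> (R z x) - \<phi> (R z (A x)))"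
proof (induction arbitrary: x rule: rational_calculus.induct)
  case one
  show ?case by (intro exI[of _ "\<lambda>z. 0"]) auto
next
  case ident
  have "\<phi> x = z * \<phi> (R z x) - \<phi> (R z (T x))" if "z \<in> W - K" for z
  proof -
    have z: "z \<notin> K" using that by blast
    have "R z (sc z x - T x) = sc z (R z x) - R z (T x)"
      using resolvent_in_Q[OF z] by (simp add: Q_diff Q_scale)
    then show ?thesis
      using resolvent_left[OF z, of x] by (metis functional_diff[OF p \<phi>] functional_scale[OF p \<phi>])
  qed
  then show ?case by (intro exI[of _ "\<lambda>z. \<phi> x"]) auto
next
  case (resolvent \<mu>)
  have "\<phi> (R \<mu> x) / (\<mu> - z) = 1 / (\<mu> - z) * \<phi> (R z x) - \<phi> (R z (R \<mu> x))" if "z \<in> W - K" for z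
  proof -
    have z: "z \<notin> K" "\<mu> \<notin> K" "z \<noteq> \<mu>" using that resolvent KW by auto
    have "\<phi> (R z x) - \<phi> (R \<mu> x) = (\<mu> - z) * \<phi> (R z (R \<mu> x))"
      unfolding functional_diff[OF p \<phi>, symmetric] resolvent_identity[OF z(1,2)] functional_scale[OF p \<phi>] ..
    then show ?thesis using z(3) by (simp add: field_simps)
  qed
  then show ?case
    by (intro exI[of _ "\<lambda>z. \<phi> (R \<mu> x) / (\<mu> - z)"]) (use resolvent in \<open>auto intro!: holomorphic_intros\<close>)
next
  case (add r A s B)
  obtain g where "g holomorphic_on W" "\<forall>z\<in>W - K. g z = r z * \<phi> (R z x) - \<phi> (R z (A x))"
    using add.IH(1)[of x] by blast
  moreover obtain h where "h holomorphic_on W" "\<forall>z\<in>W - K. h z = s z * \<phi> (R z x) - \<phi> (R z (B x))"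
    using add.IH(2)[of x] by blast
  ultimately show ?case
    by (intro exI[of _ "\<lambda>z. g z + h z"])
      (auto intro!: holomorphic_intros simp: Q_add[OF resolvent_in_Q] functional_add[OF p \<phi>] distrib_right)
next
  case (scale r A c)
  obtain g where "g holomorphic_on W" "\<forall>z\<in>W - K. g z = r z * \<phi> (R z x) - \<phi> (R z (A x))"
    using scale.IH[of x] by blast
  then show ?case
    by (intro exI[of _ "\<lambda>z. c * g z"])
      (auto intro!: holomorphic_intros simp: Q_scale[OF resolvent_in_Q] functional_scale[OF p \<phi>] right_diff_distrib)
next
  case (mult r A s B)
  obtain g where "g holomorphic_on W" "\<forall>z\<in>W - K. g z = r z * \<phi> (R z (B x)) - \<phi> (R z (A (B x)))"
    using mult.IH(1)[of "B x"] by blast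
  moreover obtain h where "h holomorphic_on W" "\<forall>z\<in>W - K. h z = s z * \<phi> (R z x) - \<phi> (R z (B x))"
    using mult.IH(2)[of x] by blast
  ultimately show ?case
    by (intro exI[of _ "\<lambda>z. g z + r z * h z"])
      (use rational_calculus_holomorphic[OF mult.hyps(1)] in
        \<open>auto intro!: holomorphic_intros simp: right_diff_distrib\<close>)
qed

text \<open>
  The continuity of the calculus. Integrated over a cycle around \<open>K\<close> in \<open>W\<close>, the extension of
  \<open>\<phi> ((r z - A) R z x)\<close> gives \<open>0\<close>, and \<open>\<phi> (R z (A x))\<close> gives \<open>2 \<pi> \<i> \<phi> (A x)\<close>. Hence \<open>\<phi> (A x)\<close> is the
  Cauchy integral of \<open>r z \<phi> (R z x)\<close>, which is bounded by the supremum of \<open>r\<close> times a constant that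
  depends on the cycle and on \<open>p\<close>. The Hahn-Banach theorem provides \<open>\<phi>\<close> with \<open>norm (\<phi> (A x)) = p (A x)\<close>.
\<close>

lemma rational_calculus_estimate:
  assumes W: "open W" "K \<subseteq> W" and p: "p \<in> P"
  obtains c where "c \<ge> 0"
    "\<And>r A m. rational_calculus W r A \<Longrightarrow> 0 \<le> m \<Longrightarrow> (\<And>z. z \<in> W \<Longrightarrow> norm (r z) \<le> m) \<Longrightarrow> nrm p A \<le> c * m"
proof -
  obtain I :: "edge set" and w a b where C: "cauchy_cycle K W I w a b"
    by (rule exists_cauchy_cycle[OF compact_spectrum W]) blast
  then have I: "finite I" and seg: "\<And>i. i \<in> I \<Longrightarrow> closed_segment (a i) (b i) \<subseteq> W - K"
    unfolding cauchy_cycle_def by blast+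
  have "compact (\<Union>i\<in>I. closed_segment (a i) (b i))" using I by (intro compact_UN) auto
  moreover have "(\<Union>i\<in>I. closed_segment (a i) (b i)) \<inter> K = {}" using seg by blast
  ultimately obtain M where M: "M \<ge> 0" "\<And>l. l \<in> (\<Union>i\<in>I. closed_segment (a i) (b i)) \<Longrightarrow> nrm p (R l) \<le> M"
    using resolvent_bounded_on_compact p by metis
  define c where "c = (\<Sum>i\<in>I. norm (w i) * norm (b i - a i)) * M"
  have c: "c \<ge> 0" unfolding c_def using M by (simp add: sum_nonneg)
  moreover have "nrm p A \<le> c * m"
    if A: "rational_calculus W r A" and m: "0 \<le> m" and r: "\<And>z. z \<in> W \<Longrightarrow> norm (r z) \<le> m" for r A m
  proof (rule nrm_le[OF p])
    fix x
    obtain \<phi> where \<phi>: "dominated_functional sc p \<phi>" and eq: "norm (\<phi> (A x)) = p (A x)"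
      by (rule Hahn_Banach_seminorm[OF vector_space_axioms seminorms[OF p]]) blast
    obtain g where g: "g holomorphic_on W" "\<forall>z\<in>W - K. g z = r z * \<phi> (R z x) - \<phi> (R z (A x))"
      using rational_calculus_extension[OF W(2) p \<phi> A] by blast
    have k: "continuous_on (- K) (\<lambda>z. \<phi> (R z y))" for y
      by (rule holomorphic_on_imp_continuous_on[OF resolvent_functional_holomorphic[OF p \<phi>]])
    have segment: "contour_integral (linepath (a i) (b i)) (\<lambda>z. \<phi> (R z (A x))) =
        contour_integral (linepath (a i) (b i)) (\<lambda>z. r z * \<phi> (R z x)) - contour_integral (linepath (a i) (b i)) g \<and>
        norm (contour_integral (linepath (a i) (b i)) (\<lambda>z. r z * \<phi> (R z x))) \<le> m * (M * p x) * norm (b i - a i)"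
      if i: "i \<in> I" for i
    proof -
      let ?l = "linepath (a i) (b i)" and ?s = "closed_segment (a i) (b i)"
      have s: "?s \<subseteq> W" "?s \<subseteq> - K" using seg[OF i] by auto
      have gi: "g contour_integrable_on ?l"
        by (rule contour_integrable_continuous_linepath)
          (rule continuous_on_subset[OF holomorphic_on_imp_continuous_on[OF g(1)] s(1)])
      have ri: "(\<lambda>z. r z * \<phi> (R z x)) contour_integrable_on ?l"
        by (intro contour_integrable_continuous_linepath continuous_on_mult continuous_on_subset[OF k s(2)]
            continuous_on_subset[OF holomorphic_on_imp_continuous_on[OF rational_calculus_holomorphic[OF A]] s(1)])
      have "contour_integral ?l (\<lambda>z. \<phi> (R z (A x))) = contour_integral ?l (\<lambda>z. r z * \<phi> (R z x) - g z)"
      proof (rule contour_integral_eq)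
        fix z assume "z \<in> path_image ?l"
        then have "z \<in> W - K" using s by auto
        then show "\<phi> (R z (A x)) = r z * \<phi> (R z x) - g z" using g(2) by simp
      qed
      also have "\<dots> = contour_integral ?l (\<lambda>z. r z * \<phi> (R z x)) - contour_integral ?l g"
        by (rule contour_integral_diff[OF ri gi])
      finally show ?thesis
      proof (intro conjI)
        show "norm (contour_integral ?l (\<lambda>z. r z * \<phi> (R z x))) \<le> m * (M * p x) * norm (b i - a i)"
        proof (rule has_contour_integral_bound_linepath[OF has_contour_integral_integral[OF ri]])
          show "0 \<le> m * (M * p x)" using m M(1) seminorm_nonneg[OF p] by simp
          fix z assume z: "z \<in> ?s"
          have zK: "z \<notin> K" using z s by blast
          have "norm (\<phi> (R z x)) \<le> nrm p (R z) * p x"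
            using functional_le[OF p \<phi>, of "R z x"] nrm_bound[OF resolvent_in_Q[OF zK] p, of x] by linarith
          also have "\<dots> \<le> M * p x" using M(2)[of z] z i seminorm_nonneg[OF p] by (intro mult_right_mono) auto
          finally show "norm (r z * \<phi> (R z x)) \<le> m * (M * p x)"
            unfolding norm_mult using r[of z] z s m by (intro mult_mono) auto
        qed
      qed
    qed
    have "2 * pi * \<i> * \<phi> (A x) = (\<Sum>i\<in>I. w i * contour_integral (linepath (a i) (b i)) (\<lambda>z. \<phi> (R z (A x))))"
      using cycle_integral_resolvent[OF p \<phi> C] by simp
    also have "\<dots> = (\<Sum>i\<in>I. w i * contour_integral (linepath (a i) (b i)) (\<lambda>z. r z * \<phi> (R z x)))
        - (\<Sum>i\<in>I. w i * contour_integral (linepath (a i) (b i)) g)"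
      using segment by (simp add: right_diff_distrib sum_subtractf)
    also have "(\<Sum>i\<in>I. w i * contour_integral (linepath (a i) (b i)) g) = 0"
      using C g(1) unfolding cauchy_cycle_def by blast
    finally have "norm (2 * pi * \<i> * \<phi> (A x)) =
        norm (\<Sum>i\<in>I. w i * contour_integral (linepath (a i) (b i)) (\<lambda>z. r z * \<phi> (R z x)))" by simp
    also have "\<dots> \<le> (\<Sum>i\<in>I. norm (w i) * (m * (M * p x) * norm (b i - a i)))"
      by (rule sum_norm_le) (use segment in \<open>simp add: norm_mult mult_left_mono\<close>)
    also have "\<dots> = c * m * p x"
      unfolding c_def sum_distrib_right by (intro sum.cong) (auto simp: algebra_simps)
    finally have "2 * pi * p (A x) \<le> c * m * p x" by (simp add: norm_mult eq)
    \<comment> \<open>the factor \<open>2 \<pi>\<close> only improves the constant\<close>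
    moreover have "1 * p (A x) \<le> 2 * pi * p (A x)"
      using pi_gt3 by (intro mult_right_mono seminorm_nonneg[OF p]) auto
    ultimately show "p (A x) \<le> c * m * p x" by linarith
  qed (use c m in simp)
  ultimately show thesis using that by blast
qed

section \<open>The holomorphic calculus\<close>

text \<open>
  The closure of the rational calculus under uniform convergence on \<open>W\<close>. The approximants have their
  poles off \<open>closure W\<close>, so that they represent germs on \<open>W\<close> themselves; \<open>f\<close> is required to be bounded
  because products of uniformly convergent sequences converge uniformly only for bounded limits.
\<close>

definition calculus_on :: "complex set \<Rightarrow> (complex \<Rightarrow> complex) \<Rightarrow> ('a \<Rightarrow> 'a) \<Rightarrow> bool" where
  "calculus_on W f A \<longleftrightarrow> A \<in> Q \<and> bounded (f ` W) \<and>
     (\<exists>r S. (\<forall>n. rational_calculus (closure W) (r n) (S n)) \<and>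
            uniform_limit W r f sequentially \<and> Q_limit S A)"

lemma germ_nbhds_closure: "W \<in> germ_nbhds K \<Longrightarrow> K \<subseteq> closure W"
  unfolding germ_nbhds_def using closure_subset by blast

lemma calculus_on_antimono:
  assumes "calculus_on W f A" "V \<subseteq> W"
  shows "calculus_on V f A"
proof -
  obtain r S where r: "\<And>n. rational_calculus (closure W) (r n) (S n)"
    "uniform_limit W r f sequentially" "Q_limit S A" and A: "A \<in> Q" "bounded (f ` W)"
    using assms(1) unfolding calculus_on_def by blast
  show ?thesis
    unfolding calculus_on_def
  proof (intro conjI exI[of _ r] exI[of _ S] allI)
    show "bounded (f ` V)" using A(2) assms(2) by (metis bounded_subset image_mono)
    show "rational_calculus (closure V) (r n) (S n)" for n
      using rational_calculus_antimono[OF closure_mono[OF assms(2)]] r(1) by blast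
    show "uniform_limit V r f sequentially" using r(2) assms(2) by (rule uniform_limit_on_subset)
  qed (use A r in auto)
qed

lemma calculus_on_rational:
  assumes W: "W \<in> germ_nbhds K" and r: "rational_calculus (closure W) r A"
  shows "calculus_on W r A"
  unfolding calculus_on_def
proof (intro conjI exI[of _ "\<lambda>n. r"] exI[of _ "\<lambda>n. A"] allI)
  show "A \<in> Q" by (rule rational_calculus_in_Q[OF germ_nbhds_closure[OF W] r])
  have "compact (closure W)" using W by (simp add: germ_nbhds_def compact_closure)
  then have "bounded (r ` closure W)"
    by (intro compact_imp_bounded compact_continuous_image holomorphic_on_imp_continuous_on
        rational_calculus_holomorphic[OF r])
  then show "bounded (r ` W)" by (rule bounded_subset) (use closure_subset in blast)
  show "uniform_limit W (\<lambda>n. r) r sequentially" by (rule uniform_limit_const)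
  show "Q_limit (\<lambda>n. A) A" unfolding Q_limit_def using nrm_zero by (simp add: fun_diff_def)
qed (rule r)

lemma calculus_on_add:
  assumes W: "W \<in> germ_nbhds K" and "calculus_on W f A" "calculus_on W g B"
  shows "calculus_on W (\<lambda>z. f z + g z) (\<lambda>x. A x + B x)"
proof -
  obtain r S where r: "\<And>n. rational_calculus (closure W) (r n) (S n)"
    "uniform_limit W r f sequentially" "Q_limit S A" and A: "A \<in> Q" "bounded (f ` W)"
    using assms(2) unfolding calculus_on_def by blast
  obtain s U where s: "\<And>n. rational_calculus (closure W) (s n) (U n)"
    "uniform_limit W s g sequentially" "Q_limit U B" and B: "B \<in> Q" "bounded (g ` W)"
    using assms(3) unfolding calculus_on_def by blast
  have SQ: "S n \<in> Q" "U n \<in> Q" for n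
    using rational_calculus_in_Q[OF germ_nbhds_closure[OF W]] r(1) s(1) by blast+
  have "Q_limit (\<lambda>n x. S n x + U n x) (\<lambda>x. A x + B x)"
    unfolding Q_limit_def
  proof
    fix p assume p: "p \<in> P"
    show "(\<lambda>n. nrm p ((\<lambda>x. S n x + U n x) - (\<lambda>x. A x + B x))) \<longlonglongrightarrow> 0"
    proof (rule tendsto_zero_le)
      show "0 \<le> nrm p ((\<lambda>x. S n x + U n x) - (\<lambda>x. A x + B x))" for n
        by (intro nrm_nonneg diff_in_Q add_in_Q SQ A B p)
      have "(\<lambda>x. S n x + U n x) - (\<lambda>x. A x + B x) = (\<lambda>x. (S n - A) x + (U n - B) x)" for n
        by (simp add: fun_eq_iff)
      then show "nrm p ((\<lambda>x. S n x + U n x) - (\<lambda>x. A x + B x)) \<le> nrm p (S n - A) + nrm p (U n - B)" for n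
        by (simp only:) (intro nrm_add diff_in_Q SQ A B p)
      show "(\<lambda>n. nrm p (S n - A) + nrm p (U n - B)) \<longlonglongrightarrow> 0"
        using r(3) s(3) p tendsto_add[of "\<lambda>n. nrm p (S n - A)" 0 sequentially "\<lambda>n. nrm p (U n - B)" 0]
        unfolding Q_limit_def by simp
    qed
  qed
  moreover have "bounded ((\<lambda>z. f z + g z) ` W)" using A(2) B(2) by (rule bounded_plus_comp)
  moreover have "uniform_limit W (\<lambda>n z. r n z + s n z) (\<lambda>z. f z + g z) sequentially"
    by (rule uniform_limit_add[OF r(2) s(2)])
  ultimately show ?thesis
    unfolding calculus_on_def using add_in_Q[OF A(1) B(1)] rational_calculus.add[OF r(1) s(1)]
    by (intro conjI exI[of _ "\<lambda>n z. r n z + s n z"] exI[of _ "\<lambda>n x. S n x + U n x"]) auto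
qed

lemma calculus_on_mult:
  assumes W: "W \<in> germ_nbhds K" and "calculus_on W f A" "calculus_on W g B"
  shows "calculus_on W (\<lambda>z. f z * g z) (A \<circ> B)"
proof -
  obtain r S where r: "\<And>n. rational_calculus (closure W) (r n) (S n)"
    "uniform_limit W r f sequentially" "Q_limit S A" and A: "A \<in> Q" "bounded (f ` W)"
    using assms(2) unfolding calculus_on_def by blast
  obtain s U where s: "\<And>n. rational_calculus (closure W) (s n) (U n)"
    "uniform_limit W s g sequentially" "Q_limit U B" and B: "B \<in> Q" "bounded (g ` W)"
    using assms(3) unfolding calculus_on_def by blast
  have SQ: "S n \<in> Q" "U n \<in> Q" for n
    using rational_calculus_in_Q[OF germ_nbhds_closure[OF W]] r(1) s(1) by blast+
  have "Q_limit (\<lambda>n. S n \<circ> U n) (A \<circ> B)"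
    unfolding Q_limit_def
  proof
    fix p assume p: "p \<in> P"
    let ?a = "\<lambda>n. nrm p (S n - A)" and ?b = "\<lambda>n. nrm p (U n - B)"
    show "(\<lambda>n. nrm p ((S n \<circ> U n) - (A \<circ> B))) \<longlonglongrightarrow> 0"
    proof (rule tendsto_zero_le)
      show "0 \<le> nrm p ((S n \<circ> U n) - (A \<circ> B))" for n
        by (intro nrm_nonneg diff_in_Q comp_in_Q SQ A B p)
      show "nrm p ((S n \<circ> U n) - (A \<circ> B)) \<le> ?a n * nrm p (U n) + nrm p A * ?b n" for n
      proof -
        have "(S n \<circ> U n) - (A \<circ> B) = (\<lambda>x. ((S n - A) \<circ> U n) x + (A \<circ> (U n - B)) x)"
          by (simp add: fun_eq_iff Q_diff[OF A(1)])
        then have "nrm p ((S n \<circ> U n) - (A \<circ> B)) \<le> nrm p ((S n - A) \<circ> U n) + nrm p (A \<circ> (U n - B))"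
          by (simp only:) (intro nrm_add comp_in_Q diff_in_Q SQ A B p)
        also have "\<dots> \<le> ?a n * nrm p (U n) + nrm p A * ?b n"
          by (intro add_mono nrm_comp diff_in_Q SQ A B p)
        finally show ?thesis .
      qed
      have a: "?a \<longlonglongrightarrow> 0" and b: "?b \<longlonglongrightarrow> 0" using r(3) s(3) p unfolding Q_limit_def by blast+
      have "nrm p (U n) \<le> ?b n + nrm p B" for n
        using nrm_triangle[OF zero_in_Q B(1) SQ(2) p, of n] by (simp add: fun_diff_def)
      then have "?a n * nrm p (U n) + nrm p A * ?b n \<le> ?a n * (?b n + nrm p B) + nrm p A * ?b n" for n
        using nrm_nonneg[OF diff_in_Q[OF SQ(1) A(1)] p] by (simp add: mult_left_mono)
      moreover have "(\<lambda>n. ?a n * (?b n + nrm p B) + nrm p A * ?b n) \<longlonglongrightarrow> 0 * (0 + nrm p B) + nrm p A * 0"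
        by (intro tendsto_intros a b)
      moreover have "0 \<le> ?a n * nrm p (U n) + nrm p A * ?b n" for n
        by (intro add_nonneg_nonneg mult_nonneg_nonneg nrm_nonneg diff_in_Q SQ A B p)
      ultimately show "(\<lambda>n. ?a n * nrm p (U n) + nrm p A * ?b n) \<longlonglongrightarrow> 0"
        by (intro tendsto_zero_le[of "\<lambda>n. ?a n * nrm p (U n) + nrm p A * ?b n"
              "\<lambda>n. ?a n * (?b n + nrm p B) + nrm p A * ?b n"]) auto
    qed
  qed
  moreover have "bounded ((\<lambda>z. f z * g z) ` W)"
  proof -
    obtain M N where "\<And>z. z \<in> W \<Longrightarrow> norm (f z) \<le> M" "\<And>z. z \<in> W \<Longrightarrow> norm (g z) \<le> N"
      using A(2) B(2) unfolding bounded_iff by auto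
    then have "norm (f z * g z) \<le> M * N" if "z \<in> W" for z
      unfolding norm_mult using that by (meson mult_mono norm_ge_zero order_trans)
    then show ?thesis unfolding bounded_iff by auto
  qed
  moreover have "uniform_limit W (\<lambda>n z. r n z * s n z) (\<lambda>z. f z * g z) sequentially"
    by (rule uniform_lim_mult[OF r(2) s(2) A(2) B(2)])
  ultimately show ?thesis
    unfolding calculus_on_def using comp_in_Q[OF A(1) B(1)] rational_calculus.mult[OF r(1) s(1)]
    by (intro conjI exI[of _ "\<lambda>n z. r n z * s n z"] exI[of _ "\<lambda>n. S n \<circ> U n"]) (auto simp: o_def)
qed

lemma calculus_on_scale:
  assumes W: "W \<in> germ_nbhds K" and "calculus_on W f A"
  shows "calculus_on W (\<lambda>z. c * f z) (\<lambda>x. sc c (A x))"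
proof -
  have "rational_calculus (closure W) (\<lambda>z. c * 1) (\<lambda>x. sc c x)"
    by (intro rational_calculus.intros)
  from calculus_on_mult[OF W calculus_on_rational[OF W this] assms(2)]
  show ?thesis by (simp add: o_def)
qed

lemma calculus_on_diff:
  assumes W: "W \<in> germ_nbhds K" and "calculus_on W f A" "calculus_on W g B"
  shows "calculus_on W (\<lambda>z. f z - g z) (A - B)"
proof -
  have "A - B = (\<lambda>x. A x + sc (- 1) (B x))" by (simp add: fun_eq_iff)
  then show ?thesis
    using calculus_on_add[OF W assms(2) calculus_on_scale[OF W assms(3), of "- 1"]] by simp
qed

lemma calculus_on_estimate:
  assumes W: "W \<in> germ_nbhds K" and p: "p \<in> P"
  obtains c where "c \<ge> 0"
    "\<And>f A m. calculus_on W f A \<Longrightarrow> 0 \<le> m \<Longrightarrow> (\<And>z. z \<in> W \<Longrightarrow> norm (f z) \<le> m) \<Longrightarrow> nrm p A \<le> c * m"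
proof -
  have W': "open W" "K \<subseteq> W" using W by (auto simp: germ_nbhds_def)
  obtain c where c: "c \<ge> 0" and est: "\<And>r A m. rational_calculus W r A \<Longrightarrow> 0 \<le> m \<Longrightarrow>
      (\<And>z. z \<in> W \<Longrightarrow> norm (r z) \<le> m) \<Longrightarrow> nrm p A \<le> c * m"
    by (rule rational_calculus_estimate[OF W' p]) blast
  have "nrm p A \<le> c * m"
    if f: "calculus_on W f A" and m: "0 \<le> m" "\<And>z. z \<in> W \<Longrightarrow> norm (f z) \<le> m" for f A m
  proof (rule field_le_epsilon)
    fix \<delta> :: real assume \<delta>: "\<delta> > 0"
    define \<epsilon> where "\<epsilon> = \<delta> / (c + 1)"
    have \<epsilon>: "\<epsilon> > 0" using \<delta> c by (simp add: \<epsilon>_def)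
    obtain r S where r: "\<And>n. rational_calculus (closure W) (r n) (S n)"
      "uniform_limit W r f sequentially" "Q_limit S A" and A: "A \<in> Q"
      using f unfolding calculus_on_def by blast
    have "eventually (\<lambda>n. \<forall>z\<in>W. dist (r n z) (f z) < \<epsilon>) sequentially"
      using r(2) \<epsilon> by (rule uniform_limitD)
    moreover have "eventually (\<lambda>n. nrm p (S n - A) < \<epsilon>) sequentially"
      using r(3) p \<epsilon> unfolding Q_limit_def by (intro order_tendstoD(2)) auto
    ultimately have "eventually (\<lambda>n. (\<forall>z\<in>W. dist (r n z) (f z) < \<epsilon>) \<and> nrm p (S n - A) < \<epsilon>) sequentially"
      by (rule eventually_conj)
    then obtain n where n: "\<And>z. z \<in> W \<Longrightarrow> dist (r n z) (f z) < \<epsilon>" "nrm p (S n - A) < \<epsilon>"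
      by (metis (mono_tags, lifting) eventually_happens' sequentially_bot)
    have SQ: "S n \<in> Q" by (rule rational_calculus_in_Q[OF germ_nbhds_closure[OF W] r(1)])
    have "nrm p (S n) \<le> c * (m + \<epsilon>)"
    proof (rule est)
      show "rational_calculus W (r n) (S n)"
        using rational_calculus_antimono[OF closure_subset] r(1) by blast
      show "norm (r n z) \<le> m + \<epsilon>" if "z \<in> W" for z
        using n(1)[OF that] m(2)[OF that] norm_triangle_sub[of "r n z" "f z"] by (simp add: dist_norm)
    qed (use m \<epsilon> in simp)
    moreover have "nrm p A \<le> nrm p (A - S n) + nrm p (S n)"
      using nrm_triangle[OF zero_in_Q SQ A p] by (simp add: fun_diff_def)
    ultimately have "nrm p A \<le> c * m + (c + 1) * \<epsilon>"
      using n(2) nrm_diff_commute[OF p, of A "S n"] by (simp add: algebra_simps)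
    then show "nrm p A \<le> c * m + \<delta>" using c by (simp add: \<epsilon>_def)
  qed
  then show thesis using that c by blast
qed

text \<open>
  The operator depends on the germ of the function at \<open>K\<close> only: the estimate on a common smaller
  neighbourhood applies to the difference, with supremum zero.
\<close>

lemma calculus_on_unique:
  assumes "W \<in> germ_nbhds K" "calculus_on W f A" "W' \<in> germ_nbhds K" "calculus_on W' g B"
    and V: "open V" "K \<subseteq> V" "\<And>z. z \<in> V \<Longrightarrow> f z = g z"
  shows "A = B"
proof (rule nrm_separates)
  let ?V = "W \<inter> W' \<inter> V"
  have V': "?V \<in> germ_nbhds K" using assms(1,3) V by (auto simp: germ_nbhds_def)
  have *: "calculus_on ?V (\<lambda>z. f z - g z) (A - B)"
    by (intro calculus_on_diff[OF V'] calculus_on_antimono[OF assms(2)] calculus_on_antimono[OF assms(4)]) auto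
  show "A \<in> Q" "B \<in> Q" using assms(2,4) by (simp_all add: calculus_on_def)
  fix p assume p: "p \<in> P"
  obtain c where "\<And>f A m. calculus_on ?V f A \<Longrightarrow> 0 \<le> m \<Longrightarrow> (\<And>z. z \<in> ?V \<Longrightarrow> norm (f z) \<le> m) \<Longrightarrow> nrm p A \<le> c * m"
    by (rule calculus_on_estimate[OF V' p]) blast
  from this[OF *, of 0] show "nrm p (A - B) \<le> 0" using V(3) by simp
qed

text \<open>
  One neighbourhood \<open>W\<close> serves all functions on \<open>D\<close>; the continuity of the calculus on the space of
  functions on \<open>D\<close> depends on this uniformity. Runge's theorem gives the approximants, and the estimate
  turns their uniform convergence into the Cauchy property of the operators.
\<close>

lemma calculus_exists:
  assumes D: "D \<in> germ_nbhds K"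
  obtains W where "W \<in> germ_nbhds K" "closure W \<subseteq> D" "\<And>f. f holomorphic_on D \<Longrightarrow> \<exists>A. calculus_on W f A"
proof -
  have D': "open D" "K \<subseteq> D" using D by (auto simp: germ_nbhds_def)
  have "closed (- D)" "K \<inter> - D = {}" using D' by (auto simp: closed_Compl)
  from separation_normal_compact[OF compact_spectrum this]
  obtain W V where WV: "open W" "open V" "bounded W" "K \<subseteq> W" "- D \<subseteq> V" "W \<inter> V = {}"
    using bounded_subset[OF compact_imp_bounded closure_subset] by metis
  have W: "W \<in> germ_nbhds K" using WV by (simp add: germ_nbhds_def)
  have "closure W \<subseteq> - V" by (rule closure_minimal) (use WV in \<open>auto simp: closed_Compl\<close>)
  then have WD: "closure W \<subseteq> D" using WV by blast
  have cW: "compact (closure W)" using WV by (simp add: compact_closure)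
  have KW: "K \<subseteq> closure W" by (rule germ_nbhds_closure[OF W])
  moreover have "\<exists>A. calculus_on W f A" if f: "f holomorphic_on D" for f
  proof -
    have "\<exists>r S. rational_calculus (closure W) r S \<and> (\<forall>z\<in>closure W. norm (f z - r z) \<le> 1 / real (Suc n))" for n
    proof -
      obtain r where r: "fraction_sum (D - closure W) r" "\<And>z. z \<in> closure W \<Longrightarrow> norm (f z - r z) \<le> 1 / real (Suc n)"
        by (rule Runge_approximation[OF cW D'(1) WD f, of "1 / real (Suc n)"]) (simp, blast)
      have "(D - closure W) \<inter> closure W = {}" by blast
      from fraction_sum_calculus[OF this r(1)] r(2) show ?thesis by blast
    qed
    then obtain r S where r: "\<And>n. rational_calculus (closure W) (r n) (S n)"
      "\<And>n z. z \<in> closure W \<Longrightarrow> norm (f z - r n z) \<le> 1 / real (Suc n)" by metis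
    have r': "norm (f z - r n z) \<le> 1 / real (Suc n)" if "z \<in> W" for n z
      using r(2) that closure_subset by blast
    have SQ: "S n \<in> Q" for n by (rule rational_calculus_in_Q[OF KW r(1)])
    have "\<exists>N. \<forall>m\<ge>N. \<forall>n\<ge>N. nrm p (S m - S n) \<le> e" if p: "p \<in> P" and e: "e > 0" for p e
    proof -
      obtain c where c: "c \<ge> 0" and est: "\<And>r A m. rational_calculus W r A \<Longrightarrow> 0 \<le> m \<Longrightarrow>
          (\<And>z. z \<in> W \<Longrightarrow> norm (r z) \<le> m) \<Longrightarrow> nrm p A \<le> c * m"
        by (rule rational_calculus_estimate[OF WV(1,4) p]) blast
      have "e / (2 * (c + 1)) > 0" using e c by simp
      then obtain N where N: "1 / real (Suc N) < e / (2 * (c + 1))"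
        using reals_Archimedean by (metis inverse_eq_divide)
      have "nrm p (S m - S n) \<le> e" if mn: "m \<ge> N" "n \<ge> N" for m n
      proof -
        have small: "norm (f z - r k z) \<le> 1 / real (Suc N)" if "z \<in> W" "k \<ge> N" for z k
        proof -
          have "1 / real (Suc k) \<le> 1 / real (Suc N)" using that(2) by (intro divide_left_mono) auto
          then show ?thesis using r'[OF that(1), of k] by linarith
        qed
        have "nrm p (S m - S n) \<le> c * (2 * (1 / real (Suc N)))"
        proof (rule est)
          show "rational_calculus W (\<lambda>z. r m z - r n z) (S m - S n)"
            using rational_calculus_antimono[OF closure_subset] rational_calculus_diff r(1) by blast
          fix z assume z: "z \<in> W"
          have "r m z - r n z = (f z - r n z) - (f z - r m z)" by simp
          then show "norm (r m z - r n z) \<le> 2 * (1 / real (Suc N))"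
            using small[OF z mn(1)] small[OF z mn(2)] norm_triangle_ineq4[of "f z - r n z" "f z - r m z"]
            by simp
        qed simp
        also have "\<dots> \<le> (c + 1) * (2 * (e / (2 * (c + 1))))"
          using N c by (intro mult_mono) auto
        also have "\<dots> = e" using c by (simp add: field_simps)
        finally show ?thesis .
      qed
      then show ?thesis by blast
    qed
    then obtain A where A: "A \<in> Q" "Q_limit S A" by (rule Q_complete[OF SQ]) blast
    have "compact (f ` closure W)"
      using cW f WD by (meson compact_continuous_image continuous_on_subset holomorphic_on_imp_continuous_on)
    then have bd: "bounded (f ` W)"
      using closure_subset by (metis bounded_subset compact_imp_bounded image_mono)
    have "uniform_limit W r f sequentially"
    proof (rule uniform_limitI)
      fix e :: real assume "e > 0"
      then obtain N where N: "1 / real (Suc N) < e" using reals_Archimedean by (metis inverse_eq_divide)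
      have "dist (r n z) (f z) < e" if "n \<ge> N" "z \<in> W" for n z
      proof -
        have "1 / real (Suc n) \<le> 1 / real (Suc N)" using that(1) by (intro divide_left_mono) auto
        then show ?thesis using r'[OF that(2), of n] N by (simp add: dist_norm norm_minus_commute)
      qed
      then show "\<forall>\<^sub>F n in sequentially. \<forall>z\<in>W. dist (r n z) (f z) < e"
        unfolding eventually_sequentially by blast
    qed
    then show ?thesis unfolding calculus_on_def using A bd r(1) by blast
  qed
  ultimately show thesis using that W WD by blast
qed

end

section \<open>Germs\<close>

lemma germ_nbhds_Int: "D \<in> germ_nbhds K \<Longrightarrow> E \<in> germ_nbhds K \<Longrightarrow> D \<inter> E \<in> germ_nbhds K"
  by (auto simp: germ_nbhds_def bounded_Int)

lemma germ_nbhds_nonempty: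
  assumes "compact K"
  obtains D where "D \<in> germ_nbhds K"
proof -
  obtain B where "K \<subseteq> ball 0 B" using compact_imp_bounded[OF assms] bounded_subset_ballD by blast
  then show thesis using that[of "ball 0 B"] by (simp add: germ_nbhds_def)
qed

lemma hol_space_antimono: "f \<in> hol_space E \<Longrightarrow> D \<subseteq> E \<Longrightarrow> f \<in> hol_space D"
  unfolding hol_space_def using holomorphic_on_subset continuous_on_subset closure_mono by blast

lemma hol_space_of_holomorphic: "f holomorphic_on E \<Longrightarrow> closure D \<subseteq> E \<Longrightarrow> f \<in> hol_space D"
  unfolding hol_space_def using closure_subset[of D]
  by (auto intro: holomorphic_on_subset holomorphic_on_imp_continuous_on)

lemma hol_space_add: "f \<in> hol_space D \<Longrightarrow> g \<in> hol_space D \<Longrightarrow> (\<lambda>z. f z + g z) \<in> hol_space D"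
  and hol_space_mult: "f \<in> hol_space D \<Longrightarrow> g \<in> hol_space D \<Longrightarrow> (\<lambda>z. f z * g z) \<in> hol_space D"
  and hol_space_scale: "f \<in> hol_space D \<Longrightarrow> (\<lambda>z. c * f z) \<in> hol_space D"
  and hol_space_diff: "f \<in> hol_space D \<Longrightarrow> g \<in> hol_space D \<Longrightarrow> f - g \<in> hol_space D"
  unfolding hol_space_def fun_diff_def by (auto intro!: holomorphic_intros continuous_intros)

lemma equiv_germ_rel: "equiv (germ_reps K) (germ_rel K)"
proof (rule equivI)
  show "germ_rel K \<subseteq> germ_reps K \<times> germ_reps K" unfolding germ_rel_def by blast
  show "refl_on (germ_reps K) (germ_rel K)"
    unfolding refl_on_def germ_rel_def by (auto simp: germ_reps_def germ_nbhds_def)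
  show "sym (germ_rel K)"
    unfolding sym_def germ_rel_def by (clarsimp, metis Int_commute)
  show "trans (germ_rel K)"
    unfolding trans_def germ_rel_def
  proof clarsimp
    fix D f E g G h A B
    assume "open A" "K \<subseteq> A" "A \<subseteq> D" "A \<subseteq> E" "\<forall>z\<in>A. f z = g z"
      "open B" "K \<subseteq> B" "B \<subseteq> E" "B \<subseteq> G" "\<forall>z\<in>B. g z = h z"
    then show "\<exists>V. open V \<and> K \<subseteq> V \<and> V \<subseteq> D \<and> V \<subseteq> G \<and> (\<forall>z\<in>V. f z = h z)"
      by (intro exI[of _ "A \<inter> B"]) auto
  qed
qed

lemma germ_of_in_germs: "D \<in> germ_nbhds K \<Longrightarrow> f \<in> hol_space D \<Longrightarrow> germ_of K D f \<in> germs K"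
  unfolding germs_def germ_of_def by (intro quotientI) (simp add: germ_reps_def)

lemma germ_cases:
  assumes "a \<in> germs K"
  obtains D f where "D \<in> germ_nbhds K" "f \<in> hol_space D" "a = germ_of K D f"
  using assms unfolding germs_def germ_of_def by (elim quotientE) (auto simp: germ_reps_def)

lemma germ_of_eq_iff:
  assumes "D \<in> germ_nbhds K" "f \<in> hol_space D" "E \<in> germ_nbhds K" "g \<in> hol_space E"
  shows "germ_of K D f = germ_of K E g \<longleftrightarrow>
    (\<exists>V. open V \<and> K \<subseteq> V \<and> V \<subseteq> D \<inter> E \<and> (\<forall>z\<in>V. f z = g z))"
proof -
  have "(D, f) \<in> germ_reps K" "(E, g) \<in> germ_reps K" using assms by (simp_all add: germ_reps_def)
  then have "germ_of K D f = germ_of K E g \<longleftrightarrow> ((D, f), (E, g)) \<in> germ_rel K"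
    unfolding germ_of_def by (rule eq_equiv_class_iff[OF equiv_germ_rel])
  then show ?thesis using assms by (simp add: germ_rel_def germ_reps_def)
qed

lemma germ_of_restrict:
  assumes "D \<in> germ_nbhds K" "f \<in> hol_space D" "E \<in> germ_nbhds K" "E \<subseteq> D"
  shows "germ_of K E f = germ_of K D f"
  using assms by (subst germ_of_eq_iff) (auto intro: hol_space_antimono simp: germ_nbhds_def)

lemma mem_germ_of:
  "(E, g) \<in> germ_of K D f \<longleftrightarrow> D \<in> germ_nbhds K \<and> f \<in> hol_space D \<and> E \<in> germ_nbhds K \<and> g \<in> hol_space E \<and>
     (\<exists>V. open V \<and> K \<subseteq> V \<and> V \<subseteq> D \<inter> E \<and> (\<forall>z\<in>V. f z = g z))"
  by (auto simp: germ_of_def germ_rel_def germ_reps_def)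

lemma germ_of_self: "D \<in> germ_nbhds K \<Longrightarrow> f \<in> hol_space D \<Longrightarrow> (D, f) \<in> germ_of K D f"
  unfolding mem_germ_of by (auto simp: germ_nbhds_def)

lemma UN_constant_on:
  assumes "x0 \<in> A" "\<And>x. x \<in> A \<Longrightarrow> F x = c"
  shows "(\<Union>x\<in>A. F x) = c"
  using assms by auto

text \<open>
  The common part of the computation of sums and products of germs: the union that defines them does not
  depend on the representatives.
\<close>

lemma germ_binop_of:
  assumes op: "\<And>D f g. f \<in> hol_space D \<Longrightarrow> g \<in> hol_space D \<Longrightarrow> (\<lambda>z. h (f z) (g z)) \<in> hol_space D"
    and f: "D \<in> germ_nbhds K" "f \<in> hol_space D" and g: "E \<in> germ_nbhds K" "g \<in> hol_space E"
  shows "(\<Union>(D, f)\<in>germ_of K D f. \<Union>(E, g)\<in>germ_of K E g. germ_of K (D \<inter> E) (\<lambda>z. h (f z) (g z)))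
    = germ_of K (D \<inter> E) (\<lambda>z. h (f z) (g z))"
proof (rule UN_constant_on[OF germ_of_self[OF f]])
  fix u assume u: "u \<in> germ_of K D f"
  obtain D' f' where [simp]: "u = (D', f')" by (cases u)
  obtain V where f': "D' \<in> germ_nbhds K" "f' \<in> hol_space D'"
    and V: "open V" "K \<subseteq> V" "V \<subseteq> D \<inter> D'" "\<forall>z\<in>V. f z = f' z"
    using u by (auto simp: mem_germ_of)
  have "(\<Union>(E, g)\<in>germ_of K E g. germ_of K (D' \<inter> E) (\<lambda>z. h (f' z) (g z))) = germ_of K (D \<inter> E) (\<lambda>z. h (f z) (g z))"
  proof (rule UN_constant_on[OF germ_of_self[OF g]])
    fix v assume v: "v \<in> germ_of K E g"
    obtain E' g' where [simp]: "v = (E', g')" by (cases v)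
    obtain W where g': "E' \<in> germ_nbhds K" "g' \<in> hol_space E'"
      and W: "open W" "K \<subseteq> W" "W \<subseteq> E \<inter> E'" "\<forall>z\<in>W. g z = g' z"
      using v by (auto simp: mem_germ_of)
    have 1: "(\<lambda>z. h (f' z) (g' z)) \<in> hol_space (D' \<inter> E')"
      using op[of f' "D' \<inter> E'" g'] hol_space_antimono f' g' by (metis inf_le1 inf_le2)
    have 2: "(\<lambda>z. h (f z) (g z)) \<in> hol_space (D \<inter> E)"
      using op[of f "D \<inter> E" g] hol_space_antimono f g by (metis inf_le1 inf_le2)
    have "germ_of K (D' \<inter> E') (\<lambda>z. h (f' z) (g' z)) = germ_of K (D \<inter> E) (\<lambda>z. h (f z) (g z))"
      unfolding germ_of_eq_iff[OF germ_nbhds_Int[OF f'(1) g'(1)] 1 germ_nbhds_Int[OF f(1) g(1)] 2]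
      by (rule exI[of _ "V \<inter> W"]) (use V W in auto)
    then show "(case v of (E, g) \<Rightarrow> germ_of K (D' \<inter> E) (\<lambda>z. h (f' z) (g z))) = germ_of K (D \<inter> E) (\<lambda>z. h (f z) (g z))"
      by simp
  qed
  then show "(case u of (D, f) \<Rightarrow> \<Union>(E, g)\<in>germ_of K E g. germ_of K (D \<inter> E) (\<lambda>z. h (f z) (g z))) =
      germ_of K (D \<inter> E) (\<lambda>z. h (f z) (g z))" by simp
qed

lemma germ_add_of:
  assumes "D \<in> germ_nbhds K" "f \<in> hol_space D" "E \<in> germ_nbhds K" "g \<in> hol_space E"
  shows "germ_add K (germ_of K D f) (germ_of K E g) = germ_of K (D \<inter> E) (\<lambda>z. f z + g z)"
  unfolding germ_add_def by (rule germ_binop_of[OF hol_space_add assms])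

lemma germ_mult_of:
  assumes "D \<in> germ_nbhds K" "f \<in> hol_space D" "E \<in> germ_nbhds K" "g \<in> hol_space E"
  shows "germ_mult K (germ_of K D f) (germ_of K E g) = germ_of K (D \<inter> E) (\<lambda>z. f z * g z)"
  unfolding germ_mult_def by (rule germ_binop_of[OF hol_space_mult assms])

lemma germ_scale_of:
  assumes f: "D \<in> germ_nbhds K" "f \<in> hol_space D"
  shows "germ_scale K c (germ_of K D f) = germ_of K D (\<lambda>z. c * f z)"
  unfolding germ_scale_def
proof (rule UN_constant_on[OF germ_of_self[OF f]])
  fix u assume u: "u \<in> germ_of K D f"
  obtain D' f' where [simp]: "u = (D', f')" by (cases u)
  obtain V where f': "D' \<in> germ_nbhds K" "f' \<in> hol_space D'"
    and V: "open V" "K \<subseteq> V" "V \<subseteq> D \<inter> D'" "\<forall>z\<in>V. f z = f' z"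
    using u by (auto simp: mem_germ_of)
  have "germ_of K D' (\<lambda>z. c * f' z) = germ_of K D (\<lambda>z. c * f z)"
    unfolding germ_of_eq_iff[OF f'(1) hol_space_scale[OF f'(2)] f(1) hol_space_scale[OF f(2)]]
    by (rule exI[of _ V]) (use V in auto)
  then show "(case u of (D, f) \<Rightarrow> germ_of K D (\<lambda>z. c * f z)) = germ_of K D (\<lambda>z. c * f z)" by simp
qed

lemma germ_entire_of:
  assumes D: "D \<in> germ_nbhds K" and f: "f holomorphic_on UNIV"
  shows "germ_entire K f = germ_of K D f"
  unfolding germ_entire_def
proof (rule UN_constant_on[OF D])
  fix E assume E: "E \<in> germ_nbhds K"
  have "f \<in> hol_space G" for G by (rule hol_space_of_holomorphic[OF f]) simp
  then show "germ_of K E f = germ_of K D f"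
    using D E by (subst germ_of_eq_iff) (auto simp: germ_nbhds_def intro!: exI[of _ "D \<inter> E"])
qed

lemma germ_add_closed: "a \<in> germs K \<Longrightarrow> b \<in> germs K \<Longrightarrow> germ_add K a b \<in> germs K"
  by (elim germ_cases)
    (auto simp: germ_add_of intro!: germ_of_in_germs germ_nbhds_Int hol_space_add intro: hol_space_antimono)

lemma germ_scale_closed: "a \<in> germs K \<Longrightarrow> germ_scale K c a \<in> germs K"
  by (elim germ_cases) (auto simp: germ_scale_of intro!: germ_of_in_germs hol_space_scale)

lemma sup_norm_upper:
  assumes "bounded D" "f \<in> hol_space D" "z \<in> D"
  shows "norm (f z) \<le> sup_norm D f"
proof -
  have "compact (f ` closure D)"
    using assms(1,2) by (intro compact_continuous_image) (auto simp: hol_space_def compact_closure)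
  then have "bounded (f ` D)"
    using closure_subset by (metis bounded_subset compact_imp_bounded image_mono)
  then have "bdd_above ((\<lambda>z. norm (f z)) ` D)"
    unfolding bounded_iff bdd_above_def by auto
  then show ?thesis using assms(3) by (auto simp: sup_norm_def intro: cSUP_upper)
qed

lemma sup_norm_least: "0 \<le> m \<Longrightarrow> (\<And>z. z \<in> D \<Longrightarrow> norm (f z) \<le> m) \<Longrightarrow> sup_norm D f \<le> m"
  unfolding sup_norm_def by (auto intro: cSUP_least)

lemma sup_norm_nonneg: "bounded D \<Longrightarrow> f \<in> hol_space D \<Longrightarrow> 0 \<le> sup_norm D f"
  using order_trans[OF norm_ge_zero sup_norm_upper[of D f]] by (cases "D = {}") (auto simp: sup_norm_def)

lemma distance_family_hol_space:
  assumes D: "bounded D"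
  shows "distance_family (hol_space D) {sup_norm D}"
  unfolding distance_family_def
proof (intro ballI conjI; elim singletonE; hypsubst)
  fix f g h assume f: "f \<in> hol_space D" "g \<in> hol_space D" "h \<in> hol_space D"
  note up = sup_norm_upper[OF D] and nn = sup_norm_nonneg[OF D]
  show "sup_norm D (h - f) \<le> sup_norm D (h - g) + sup_norm D (g - f)"
  proof (rule sup_norm_least)
    show "0 \<le> sup_norm D (h - g) + sup_norm D (g - f)"
      using nn hol_space_diff f by (simp add: add_nonneg_nonneg)
    fix z assume z: "z \<in> D"
    have "norm ((h - f) z) \<le> norm ((h - g) z) + norm ((g - f) z)"
      using norm_triangle_ineq[of "(h - g) z" "(g - f) z"] by simp
    also have "\<dots> \<le> sup_norm D (h - g) + sup_norm D (g - f)"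
      by (intro add_mono up hol_space_diff f z)
    finally show "norm ((h - f) z) \<le> sup_norm D (h - g) + sup_norm D (g - f)" .
  qed
next
  fix f assume f: "f \<in> hol_space D"
  have "sup_norm D (f - f) \<le> 0" by (rule sup_norm_least) auto
  then show "sup_norm D (f - f) = 0"
    using sup_norm_nonneg[OF D hol_space_diff[OF f f]] by simp
qed

lemma openin_hol_ball:
  assumes "bounded D" "f \<in> hol_space D" "e > 0"
  shows "openin (hol_topology D) {g \<in> hol_space D. sup_norm D (g - f) < e}"
  using openin_seminorm_ball[OF distance_family_hol_space[OF assms(1)], of "{sup_norm D}" f e] assms
  by (simp add: hol_topology_def seminorm_ball_def)

text \<open>
  Some admissible topology \<open>\<tau>\<close> has to be exhibited for the join of all of them to have the set of all
  germs as its underlying set.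
\<close>

lemma continuous_map_germ_of:
  assumes \<tau>: "lc_topology (germs K) (germ_add K) (germ_scale K) \<tau>"
    and \<tau>_cont: "\<And>D. D \<in> germ_nbhds K \<Longrightarrow> continuous_map (hol_topology D) \<tau> (germ_of K D)"
    and D: "D \<in> germ_nbhds K"
  shows "continuous_map (hol_topology D) (germ_topology K) (germ_of K D)"
  unfolding germ_topology_def
proof (rule continuous_on_generated_topo)
  let ?\<T> = "{{U. openin \<tau> U} | \<tau>. lc_topology (germs K) (germ_add K) (germ_scale K) \<tau> \<and>
             (\<forall>D\<in>germ_nbhds K. continuous_map (hol_topology D) \<tau> (germ_of K D))}"
  show "openin (hol_topology D) (germ_of K D -` U \<inter> topspace (hol_topology D))" if "U \<in> \<Union>?\<T>" for U
    using that D unfolding continuous_map_alt by blast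
  have "topspace \<tau> = germs K" using \<tau> by (simp add: lc_topology_def)
  then have "openin \<tau> (germs K)" using openin_topspace[of \<tau>] by simp
  then have "germs K \<in> \<Union>?\<T>" using \<tau> \<tau>_cont by (intro UnionI[of "{U. openin \<tau> U}"]) auto
  moreover have "germ_of K D ` topspace (hol_topology D) \<subseteq> germs K"
    using germ_of_in_germs[OF D] by (auto simp: hol_topology_def)
  ultimately show "germ_of K D ` topspace (hol_topology D) \<subseteq> \<Union> (\<Union>?\<T>)" by blast
qed

section \<open>The functional calculus on germs\<close>

context bounded_operator
begin

text \<open>
  The neighbourhood \<open>W\<close> on which the approximation takes place may be smaller than the domain \<open>D\<close> of the
  representative: near the boundary of \<open>D\<close>, where \<open>f\<close> is merely continuous, no approximation is claimed.
\<close>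

definition germ_calculus :: "germ \<Rightarrow> 'a \<Rightarrow> 'a" where
  "germ_calculus = restrict (\<lambda>a. THE A. \<exists>D f W. a = germ_of K D f \<and> D \<in> germ_nbhds K \<and> f \<in> hol_space D \<and>
     W \<in> germ_nbhds K \<and> W \<subseteq> D \<and> calculus_on W f A) (germs K)"

lemma germ_calculus_eq:
  assumes D: "D \<in> germ_nbhds K" "f \<in> hol_space D" and W: "W \<in> germ_nbhds K" "W \<subseteq> D" "calculus_on W f A"
  shows "germ_calculus (germ_of K D f) = A"
proof -
  have "(THE A. \<exists>E g W. germ_of K D f = germ_of K E g \<and> E \<in> germ_nbhds K \<and> g \<in> hol_space E \<and>
     W \<in> germ_nbhds K \<and> W \<subseteq> E \<and> calculus_on W g A) = A"
  proof (rule the_equality)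
    show "\<exists>E g W. germ_of K D f = germ_of K E g \<and> E \<in> germ_nbhds K \<and> g \<in> hol_space E \<and>
        W \<in> germ_nbhds K \<and> W \<subseteq> E \<and> calculus_on W g A" using assms by blast
    fix B assume "\<exists>E g W. germ_of K D f = germ_of K E g \<and> E \<in> germ_nbhds K \<and> g \<in> hol_space E \<and>
        W \<in> germ_nbhds K \<and> W \<subseteq> E \<and> calculus_on W g B"
    then obtain E g W' where E: "germ_of K D f = germ_of K E g" "E \<in> germ_nbhds K" "g \<in> hol_space E"
      and W': "W' \<in> germ_nbhds K" "calculus_on W' g B" by blast
    obtain V where "open V" "K \<subseteq> V" "\<forall>z\<in>V. f z = g z"
      using E(1) unfolding germ_of_eq_iff[OF D E(2,3)] by blast
    then show "B = A" using calculus_on_unique[OF W(1,3) W'] by metis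
  qed
  then show ?thesis using germ_of_in_germs[OF D] by (simp add: germ_calculus_def)
qed

lemma germ_calculus_on:
  assumes D: "D \<in> germ_nbhds K"
  obtains W where "W \<in> germ_nbhds K" "closure W \<subseteq> D"
    "\<And>f. f \<in> hol_space D \<Longrightarrow> calculus_on W f (germ_calculus (germ_of K D f))"
proof -
  obtain W where W: "W \<in> germ_nbhds K" "closure W \<subseteq> D" "\<And>f. f holomorphic_on D \<Longrightarrow> \<exists>A. calculus_on W f A"
    by (rule calculus_exists[OF D]) blast
  have "calculus_on W f (germ_calculus (germ_of K D f))" if f: "f \<in> hol_space D" for f
  proof -
    obtain A where A: "calculus_on W f A" using W(3) f unfolding hol_space_def by blast
    moreover have "W \<subseteq> D" using W(2) closure_subset by blast
    ultimately show ?thesis using germ_calculus_eq[OF D f W(1)] by simp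
  qed
  then show thesis using that W by blast
qed

lemma germ_calculus_in_Q: "a \<in> germs K \<Longrightarrow> germ_calculus a \<in> Q"
  by (elim germ_cases) (metis germ_calculus_on calculus_on_def)

text \<open>
  Two germs are brought to a common domain and a common neighbourhood of approximation.
\<close>

lemma germ_calculus_pair:
  assumes "a \<in> germs K" "b \<in> germs K"
  obtains D f g W where "D \<in> germ_nbhds K" "f \<in> hol_space D" "g \<in> hol_space D"
    "a = germ_of K D f" "b = germ_of K D g" "W \<in> germ_nbhds K" "W \<subseteq> D"
    "calculus_on W f (germ_calculus a)" "calculus_on W g (germ_calculus b)"
proof -
  obtain D f where D: "D \<in> germ_nbhds K" "f \<in> hol_space D" "a = germ_of K D f" using germ_cases[OF assms(1)] .
  obtain E g where E: "E \<in> germ_nbhds K" "g \<in> hol_space E" "b = germ_of K E g" using germ_cases[OF assms(2)] .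
  have DE: "D \<inter> E \<in> germ_nbhds K" using D E germ_nbhds_Int by blast
  have fg: "f \<in> hol_space (D \<inter> E)" "g \<in> hol_space (D \<inter> E)" using D E hol_space_antimono by blast+
  have ab: "a = germ_of K (D \<inter> E) f" "b = germ_of K (D \<inter> E) g"
    using germ_of_restrict[OF D(1,2) DE] germ_of_restrict[OF E(1,2) DE] D(3) E(3) by auto
  obtain W where W: "W \<in> germ_nbhds K" "closure W \<subseteq> D \<inter> E"
    "\<And>f. f \<in> hol_space (D \<inter> E) \<Longrightarrow> calculus_on W f (germ_calculus (germ_of K (D \<inter> E) f))"
    by (rule germ_calculus_on[OF DE]) blast
  have "W \<subseteq> D \<inter> E" using W(2) closure_subset by blast
  then show thesis using that[OF DE fg ab W(1)] W(3) fg ab by blast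
qed

lemma germ_calculus_add:
  assumes "a \<in> germs K" "b \<in> germs K"
  shows "germ_calculus (germ_add K a b) = (\<lambda>x. germ_calculus a x + germ_calculus b x)"
proof -
  obtain D f g W where D: "D \<in> germ_nbhds K" "f \<in> hol_space D" "g \<in> hol_space D"
    and ab: "a = germ_of K D f" "b = germ_of K D g" and W: "W \<in> germ_nbhds K" "W \<subseteq> D"
    and c: "calculus_on W f (germ_calculus a)" "calculus_on W g (germ_calculus b)"
    by (rule germ_calculus_pair[OF assms])
  have "germ_add K a b = germ_of K D (\<lambda>z. f z + g z)"
    using germ_add_of[OF D(1,2) D(1,3)] by (simp add: ab)
  then show ?thesis
    using germ_calculus_eq[OF D(1) hol_space_add[OF D(2,3)] W calculus_on_add[OF W(1) c]] by simp
qed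

lemma germ_calculus_mult:
  assumes "a \<in> germs K" "b \<in> germs K"
  shows "germ_calculus (germ_mult K a b) = germ_calculus a \<circ> germ_calculus b"
proof -
  obtain D f g W where D: "D \<in> germ_nbhds K" "f \<in> hol_space D" "g \<in> hol_space D"
    and ab: "a = germ_of K D f" "b = germ_of K D g" and W: "W \<in> germ_nbhds K" "W \<subseteq> D"
    and c: "calculus_on W f (germ_calculus a)" "calculus_on W g (germ_calculus b)"
    by (rule germ_calculus_pair[OF assms])
  have "germ_mult K a b = germ_of K D (\<lambda>z. f z * g z)"
    using germ_mult_of[OF D(1,2) D(1,3)] by (simp add: ab)
  then show ?thesis
    using germ_calculus_eq[OF D(1) hol_space_mult[OF D(2,3)] W calculus_on_mult[OF W(1) c]] by simp
qed

lemma germ_calculus_scale: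
  assumes "a \<in> germs K"
  shows "germ_calculus (germ_scale K c a) = (\<lambda>x. sc c (germ_calculus a x))"
proof -
  obtain D f W where D: "D \<in> germ_nbhds K" "f \<in> hol_space D"
    and a: "a = germ_of K D f" and W: "W \<in> germ_nbhds K" "W \<subseteq> D"
    and c: "calculus_on W f (germ_calculus a)"
    by (rule germ_calculus_pair[OF assms assms])
  show ?thesis
    using germ_calculus_eq[OF D(1) hol_space_scale[OF D(2)] W calculus_on_scale[OF W(1) c]]
      germ_scale_of[OF D] by (simp add: a)
qed

lemma germ_calculus_rational:
  assumes W: "W \<in> germ_nbhds K" and r: "rational_calculus (closure W) r A"
  shows "germ_calculus (germ_of K W r) = A"
  by (rule germ_calculus_eq[OF W _ W order_refl calculus_on_rational[OF W r]])
    (rule hol_space_of_holomorphic[OF rational_calculus_holomorphic[OF r] order_refl])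

lemma germ_calculus_entire:
  assumes "f holomorphic_on UNIV" "\<And>C. rational_calculus C f A"
  shows "germ_calculus (germ_entire K f) = A"
proof -
  obtain D where D: "D \<in> germ_nbhds K" using germ_nbhds_nonempty[OF compact_spectrum] .
  show ?thesis using germ_calculus_rational[OF D assms(2)] germ_entire_of[OF D assms(1)] by simp
qed

lemma germ_calculus_morphism: "unital_algebra_morphism sc P K germ_calculus"
  unfolding unital_algebra_morphism_def
proof (intro conjI ballI allI)
  show "germ_calculus \<in> germs K \<rightarrow>\<^sub>E Q"
    using germ_calculus_in_Q by (auto simp: germ_calculus_def PiE_iff extensional_def)
  show "germ_calculus (germ_entire K (\<lambda>z. 1)) = id"
    unfolding id_def by (rule germ_calculus_entire) (auto intro: rational_calculus.one)
qed (simp_all add: germ_calculus_add germ_calculus_scale germ_calculus_mult)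

lemma germ_calculus_ident: "germ_calculus (germ_entire K (\<lambda>z. z)) = T"
  by (rule germ_calculus_entire) (auto intro: rational_calculus.ident)

lemma germ_calculus_continuous_hol:
  assumes D: "D \<in> germ_nbhds K"
  shows "continuous_map (hol_topology D) (Q_topology sc P) (germ_calculus \<circ> germ_of K D)"
proof (rule continuous_map_into_Q)
  have top: "topspace (hol_topology D) = hol_space D" by (simp add: hol_topology_def)
  show "(germ_calculus \<circ> germ_of K D) f \<in> Q" if "f \<in> topspace (hol_topology D)" for f
    using that germ_calculus_in_Q germ_of_in_germs[OF D] top by simp
  fix p f and e :: real assume p: "p \<in> P" and "f \<in> topspace (hol_topology D)" and e: "e > 0"
  then have f: "f \<in> hol_space D" using top by simp
  have bD: "bounded D" using D by (simp add: germ_nbhds_def)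
  obtain W where W: "W \<in> germ_nbhds K" "closure W \<subseteq> D"
    "\<And>f. f \<in> hol_space D \<Longrightarrow> calculus_on W f (germ_calculus (germ_of K D f))"
    by (rule germ_calculus_on[OF D]) blast
  have WD: "W \<subseteq> D" using W(2) closure_subset by blast
  obtain c where c: "c \<ge> 0" and est: "\<And>f A m. calculus_on W f A \<Longrightarrow> 0 \<le> m \<Longrightarrow>
      (\<And>z. z \<in> W \<Longrightarrow> norm (f z) \<le> m) \<Longrightarrow> nrm p A \<le> c * m"
    by (rule calculus_on_estimate[OF W(1) p]) blast
  let ?U = "{g \<in> hol_space D. sup_norm D (g - f) < e / (c + 1)}"
  have e': "e / (c + 1) > 0" using e c by simp
  have "nrm p ((germ_calculus \<circ> germ_of K D) g - (germ_calculus \<circ> germ_of K D) f) < e" if "g \<in> ?U" for g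
  proof -
    have g: "g \<in> hol_space D" "sup_norm D (g - f) < e / (c + 1)" using that by auto
    have "nrm p (germ_calculus (germ_of K D g) - germ_calculus (germ_of K D f)) \<le> c * sup_norm D (g - f)"
    proof (rule est)
      show "calculus_on W (\<lambda>z. g z - f z) (germ_calculus (germ_of K D g) - germ_calculus (germ_of K D f))"
        by (rule calculus_on_diff[OF W(1) W(3)[OF g(1)] W(3)[OF f]])
      show "0 \<le> sup_norm D (g - f)" by (rule sup_norm_nonneg[OF bD hol_space_diff[OF g(1) f]])
      show "norm (g z - f z) \<le> sup_norm D (g - f)" if "z \<in> W" for z
        using sup_norm_upper[OF bD hol_space_diff[OF g(1) f], of z] that WD by auto
    qed
    also have "\<dots> \<le> c * (e / (c + 1))" using g(2) c by (intro mult_left_mono) auto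
    also have "\<dots> < e" using c e by (simp add: field_simps)
    finally show ?thesis by simp
  qed
  moreover have "f \<in> ?U"
    using f e' distance_self[OF distance_family_hol_space[OF bD] _ f, of "sup_norm D"] by simp
  ultimately show "\<exists>U. openin (hol_topology D) U \<and> f \<in> U \<and>
      (\<forall>g\<in>U. nrm p ((germ_calculus \<circ> germ_of K D) g - (germ_calculus \<circ> germ_of K D) f) < e)"
    using openin_hol_ball[OF bD f e'] by blast
qed

abbreviation calculus_topology :: "germ topology" where
  "calculus_topology \<equiv> pullback_topology (germs K) germ_calculus (Q_topology sc P)"

lemma topspace_Q: "topspace (Q_topology sc P) = Q"
  by (simp add: Q_topology_def)

lemma topspace_calculus_topology: "topspace calculus_topology = germs K"
  using germ_calculus_in_Q by (auto simp: topspace_pullback_topology topspace_Q)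

lemma continuous_map_calculus: "continuous_map calculus_topology (Q_topology sc P) germ_calculus"
  using continuous_map_pullback[of "Q_topology sc P" "Q_topology sc P" id "germs K" germ_calculus] by simp

text \<open>
  The calculus is linear, so the topology that it pulls back to the germs is locally convex, and it makes
  the canonical maps continuous. It is therefore one of the topologies whose join is the inductive limit
  topology, for which the calculus is then continuous as well.
\<close>

lemma lc_calculus_topology: "lc_topology (germs K) (germ_add K) (germ_scale K) calculus_topology"
  unfolding lc_topology_def
proof (intro conjI allI impI)
  let ?Q = "Q_topology sc P"
  note lcQ = lc_topology_Q[unfolded lc_topology_def]
  show "topspace calculus_topology = germs K" by (rule topspace_calculus_topology)
  show "continuous_map (prod_topology calculus_topology calculus_topology) calculus_topology (\<lambda>(a, b). germ_add K a b)"
  proof (rule continuous_map_pullback')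
    have "continuous_map (prod_topology calculus_topology calculus_topology) (prod_topology ?Q ?Q)
        (\<lambda>u. (germ_calculus (fst u), germ_calculus (snd u)))"
      by (intro continuous_map_pairedI continuous_map_compose[OF continuous_map_fst continuous_map_calculus, unfolded o_def]
          continuous_map_compose[OF continuous_map_snd continuous_map_calculus, unfolded o_def])
    from continuous_map_compose[OF this conjunct1[OF conjunct2[OF lcQ]]]
    show "continuous_map (prod_topology calculus_topology calculus_topology) ?Q (germ_calculus \<circ> (\<lambda>(a, b). germ_add K a b))"
      by (rule continuous_map_eq) (auto simp: topspace_calculus_topology germ_calculus_add)
    show "topspace (prod_topology calculus_topology calculus_topology) \<subseteq> (\<lambda>(a, b). germ_add K a b) -` germs K"
      by (auto simp: topspace_calculus_topology germ_add_closed)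
  qed
  show "continuous_map (prod_topology euclidean calculus_topology) calculus_topology (\<lambda>(c, a). germ_scale K c a)"
  proof (rule continuous_map_pullback')
    have "continuous_map (prod_topology euclidean calculus_topology) (prod_topology euclidean ?Q)
        (\<lambda>u. (fst u, germ_calculus (snd u)))"
      by (intro continuous_map_pairedI continuous_map_fst
          continuous_map_compose[OF continuous_map_snd continuous_map_calculus, unfolded o_def])
    from continuous_map_compose[OF this conjunct1[OF conjunct2[OF conjunct2[OF lcQ]]]]
    show "continuous_map (prod_topology euclidean calculus_topology) ?Q (germ_calculus \<circ> (\<lambda>(c, a). germ_scale K c a))"
      by (rule continuous_map_eq) (auto simp: topspace_calculus_topology germ_calculus_scale)
    show "topspace (prod_topology euclidean calculus_topology) \<subseteq> (\<lambda>(c, a). germ_scale K c a) -` germs K"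
      by (auto simp: topspace_calculus_topology germ_scale_closed)
  qed
  fix U a assume "openin calculus_topology U \<and> a \<in> U"
  then obtain O' where O': "openin ?Q O'" "U = germ_calculus -` O' \<inter> germs K" "a \<in> U"
    unfolding openin_pullback_topology by blast
  then have "openin ?Q O' \<and> germ_calculus a \<in> O'" by auto
  then obtain V where V: "openin ?Q V" "germ_calculus a \<in> V" "V \<subseteq> O'"
    "convex_in (\<lambda>A B x. A x + B x) (\<lambda>c A x. sc c (A x)) V"
    using lcQ by blast
  show "\<exists>V. openin calculus_topology V \<and> a \<in> V \<and> V \<subseteq> U \<and> convex_in (germ_add K) (germ_scale K) V"
  proof (intro exI conjI)
    show "openin calculus_topology (germ_calculus -` V \<inter> germs K)"
      unfolding openin_pullback_topology using V by blast
    show "convex_in (germ_add K) (germ_scale K) (germ_calculus -` V \<inter> germs K)"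
      unfolding convex_in_def
    proof (intro ballI IntI vimageI2)
      fix b c and t :: real
      assume bc: "b \<in> germ_calculus -` V \<inter> germs K" "c \<in> germ_calculus -` V \<inter> germs K" and t: "t \<in> {0..1}"
      show "germ_calculus (germ_add K (germ_scale K (complex_of_real t) b) (germ_scale K (complex_of_real (1 - t)) c)) \<in> V"
        using V(4) bc t unfolding convex_in_def
        by (simp add: germ_calculus_add germ_calculus_scale germ_scale_closed)
      show "germ_add K (germ_scale K (complex_of_real t) b) (germ_scale K (complex_of_real (1 - t)) c) \<in> germs K"
        using bc by (simp add: germ_add_closed germ_scale_closed)
    qed
  qed (use O' V in auto)
qed

lemma continuous_map_germ_of_calculus:
  assumes D: "D \<in> germ_nbhds K"
  shows "continuous_map (hol_topology D) calculus_topology (germ_of K D)"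
  using germ_calculus_continuous_hol[OF D] germ_of_in_germs[OF D]
  by (intro continuous_map_pullback') (auto simp: hol_topology_def)

lemma germ_calculus_continuous: "continuous_map (germ_topology K) (Q_topology sc P) germ_calculus"
  unfolding continuous_map_alt
proof (intro conjI allI impI)
  let ?\<T> = "\<Union>{{U. openin \<tau> U} | \<tau>. lc_topology (germs K) (germ_add K) (germ_scale K) \<tau> \<and>
             (\<forall>D\<in>germ_nbhds K. continuous_map (hol_topology D) \<tau> (germ_of K D))}"
  have gen: "V \<in> ?\<T>" if "openin calculus_topology V" for V
    by (rule UnionI[of "{U. openin calculus_topology U}"])
      (use that lc_calculus_topology continuous_map_germ_of_calculus in auto)
  have "U \<subseteq> germs K" if U: "U \<in> ?\<T>" for U
  proof -
    obtain \<tau> where "openin \<tau> U" "topspace \<tau> = germs K"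
      using U unfolding lc_topology_def by auto
    then show ?thesis using openin_subset by metis
  qed
  then have top: "topspace (germ_topology K) \<subseteq> germs K" unfolding germ_topology_def by auto
  show "germ_calculus \<in> topspace (germ_topology K) \<rightarrow> topspace (Q_topology sc P)"
    using top germ_calculus_in_Q topspace_Q by auto
  fix V assume "openin (Q_topology sc P) V"
  then have "openin calculus_topology (germ_calculus -` V \<inter> germs K)"
    unfolding openin_pullback_topology by blast
  then have o: "openin (germ_topology K) (germ_calculus -` V \<inter> germs K)"
    unfolding germ_topology_def by (intro topology_generated_by_Basis gen)
  then have "germ_calculus -` V \<inter> germs K = germ_calculus -` V \<inter> topspace (germ_topology K)"
    using top openin_subset by blast
  then show "openin (germ_topology K) (germ_calculus -` V \<inter> topspace (germ_topology K))" using o by simp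
qed

text \<open>
  A unital morphism is determined on rational functions by its value at the identity germ, since it sends
  \<open>1 / (\<mu> - z)\<close> to an inverse of \<open>\<mu> - T\<close>.
\<close>

lemma morphism_on_rational:
  assumes F: "unital_algebra_morphism sc P K F" "F (germ_entire K (\<lambda>z. z)) = T"
    and W: "W \<in> germ_nbhds K"
  shows "rational_calculus (closure W) r A \<Longrightarrow> F (germ_of K W r) = A"
proof (induction rule: rational_calculus.induct)
  case one
  then show ?case
    using F(1) germ_entire_of[OF W, of "\<lambda>z. 1"] unfolding unital_algebra_morphism_def by (simp add: id_def)
next
  case ident
  then show ?case using F(2) germ_entire_of[OF W, of "\<lambda>z. z"] by simp
next
  case (resolvent \<mu>)
  have \<mu>K: "\<mu> \<notin> K" using resolvent germ_nbhds_closure[OF W] by blast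
  have inv: "(\<lambda>z. 1 / (\<mu> - z)) \<in> hol_space W"
    by (rule hol_space_of_holomorphic[OF rational_calculus_holomorphic[OF rational_calculus.resolvent[OF resolvent]] order_refl])
  have ent: "f \<in> hol_space W" if "f holomorphic_on UNIV" for f
    by (rule hol_space_of_holomorphic[OF that]) simp
  have lin: "(\<lambda>z. \<mu> * 1 + (- 1) * z) \<in> hol_space W" "(\<lambda>z. \<mu> * 1) \<in> hol_space W" "(\<lambda>z. (- 1) * z) \<in> hol_space W"
    "(\<lambda>z. 1) \<in> hol_space W" "(\<lambda>z. z) \<in> hol_space W"
    by (intro ent holomorphic_intros)+
  have add: "F (germ_add K a b) = (\<lambda>x. F a x + F b x)" and scale: "F (germ_scale K c a) = (\<lambda>x. sc c (F a x))"
    and mult: "F (germ_mult K a b) = F a \<circ> F b" if "a \<in> germs K" "b \<in> germs K" for a b c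
    using F(1) that unfolding unital_algebra_morphism_def by blast+
  have one: "F (germ_of K W (\<lambda>z. 1)) = id" and ident: "F (germ_of K W (\<lambda>z. z)) = T"
    using F germ_entire_of[OF W, of "\<lambda>z. 1"] germ_entire_of[OF W, of "\<lambda>z. z"]
    unfolding unital_algebra_morphism_def by simp_all
  note g = germ_of_in_germs[OF W]
  have "F (germ_of K W (\<lambda>z. \<mu> * 1 + (- 1) * z)) = (\<lambda>x. sc \<mu> x + sc (- 1) (T x))"
    using add[OF g[OF lin(2)] g[OF lin(3)]] scale[OF g[OF lin(4)] g[OF lin(4)], of \<mu>]
      scale[OF g[OF lin(5)] g[OF lin(5)], of "- 1"] one ident
    by (simp only: germ_add_of[OF W lin(2) W lin(3)] germ_scale_of[OF W lin(4)] germ_scale_of[OF W lin(5)] Int_absorb id_apply)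
  then have "F (germ_of K W (\<lambda>z. \<mu> * 1 + (- 1) * z)) = (\<lambda>x. sc \<mu> x - T x)" by simp
  moreover have "germ_of K W (\<lambda>z. 1 / (\<mu> - z) * (\<mu> * 1 + (- 1) * z)) = germ_of K W (\<lambda>z. 1)"
    unfolding germ_of_eq_iff[OF W hol_space_mult[OF inv lin(1)] W lin(4)]
    using W resolvent closure_subset[of W] by (intro exI[of _ W]) (auto simp: germ_nbhds_def)
  ultimately have "F (germ_of K W (\<lambda>z. 1 / (\<mu> - z))) \<circ> (\<lambda>x. sc \<mu> x - T x) = id"
    using mult[OF g[OF inv] g[OF lin(1)]] one by (simp only: germ_mult_of[OF W inv W lin(1)] Int_absorb)
  then have "F (germ_of K W (\<lambda>z. 1 / (\<mu> - z))) (sc \<mu> (R \<mu> x) - T (R \<mu> x)) = R \<mu> x" for x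
    by (simp add: fun_eq_iff)
  then show ?case using resolvent_right[OF \<mu>K] by (simp add: fun_eq_iff)
next
  case (add r A s B)
  note h = hol_space_of_holomorphic[OF rational_calculus_holomorphic order_refl]
  have "germ_of K W (\<lambda>z. r z + s z) = germ_add K (germ_of K W r) (germ_of K W s)"
    using germ_add_of[OF W h[OF add.hyps(1)] W h[OF add.hyps(2)]] by simp
  then show ?case
    using F(1) add.IH germ_of_in_germs[OF W h[OF add.hyps(1)]] germ_of_in_germs[OF W h[OF add.hyps(2)]]
    unfolding unital_algebra_morphism_def by simp
next
  case (scale r A c)
  note h = hol_space_of_holomorphic[OF rational_calculus_holomorphic order_refl]
  have "germ_of K W (\<lambda>z. c * r z) = germ_scale K c (germ_of K W r)"
    using germ_scale_of[OF W h[OF scale.hyps(1)]] by simp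
  then show ?case
    using F(1) scale.IH germ_of_in_germs[OF W h[OF scale.hyps(1)]]
    unfolding unital_algebra_morphism_def by simp
next
  case (mult r A s B)
  note h = hol_space_of_holomorphic[OF rational_calculus_holomorphic order_refl]
  have "germ_of K W (\<lambda>z. r z * s z) = germ_mult K (germ_of K W r) (germ_of K W s)"
    using germ_mult_of[OF W h[OF mult.hyps(1)] W h[OF mult.hyps(2)]] by simp
  then show ?case
    using F(1) mult.IH germ_of_in_germs[OF W h[OF mult.hyps(1)]] germ_of_in_germs[OF W h[OF mult.hyps(2)]]
    unfolding unital_algebra_morphism_def by (simp add: o_def)
qed

text \<open>
  A continuous morphism is continuous on functions on \<open>W\<close> for the supremum norm, hence it is determined by
  its values on the rational approximants of a germ.
\<close>

lemma germ_calculus_unique: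
  assumes F: "unital_algebra_morphism sc P K F" "F (germ_entire K (\<lambda>z. z)) = T"
    and cont: "continuous_map (germ_topology K) (Q_topology sc P) F"
  shows "F = germ_calculus"
proof (rule PiE_ext)
  show FQ: "F \<in> germs K \<rightarrow>\<^sub>E Q" using F(1) by (simp add: unital_algebra_morphism_def)
  show "germ_calculus \<in> germs K \<rightarrow>\<^sub>E Q"
    using germ_calculus_morphism by (simp add: unital_algebra_morphism_def)
  fix a assume a: "a \<in> germs K"
  obtain D f where D: "D \<in> germ_nbhds K" "f \<in> hol_space D" "a = germ_of K D f" using germ_cases[OF a] .
  obtain W where W: "W \<in> germ_nbhds K" "closure W \<subseteq> D"
    "\<And>f. f \<in> hol_space D \<Longrightarrow> calculus_on W f (germ_calculus (germ_of K D f))"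
    by (rule germ_calculus_on[OF D(1)]) blast
  have WD: "W \<subseteq> D" and bW: "bounded W"
    using W(1,2) closure_subset[of W] by (auto simp: germ_nbhds_def)
  have f: "f \<in> hol_space W" using hol_space_antimono[OF D(2) WD] .
  have aW: "a = germ_of K W f" using germ_of_restrict[OF D(1,2) W(1) WD] D(3) by simp
  obtain r S where r: "\<And>n. rational_calculus (closure W) (r n) (S n)"
    "uniform_limit W r f sequentially" "Q_limit S (germ_calculus a)" and AQ: "germ_calculus a \<in> Q"
    using W(3)[OF D(2)] unfolding D(3)[symmetric] calculus_on_def by blast
  have SQ: "S n \<in> Q" for n by (rule rational_calculus_in_Q[OF germ_nbhds_closure[OF W(1)] r(1)])
  have rW: "r n \<in> hol_space W" for n
    by (rule hol_space_of_holomorphic[OF rational_calculus_holomorphic[OF r(1)] order_refl])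
  have FaQ: "F a \<in> Q" using FQ a by auto
  have cW: "continuous_map (hol_topology W) (Q_topology sc P) (F \<circ> germ_of K W)"
    by (rule continuous_map_compose[OF continuous_map_germ_of[OF lc_calculus_topology continuous_map_germ_of_calculus W(1)] cont])
  show "F a = germ_calculus a"
  proof (rule nrm_separates[OF FaQ AQ])
    fix p assume p: "p \<in> P"
    show "nrm p (F a - germ_calculus a) \<le> 0"
    proof (rule field_le_epsilon)
      fix e :: real assume e: "e > 0"
      let ?B = "{B \<in> Q. nrm p (B - F a) < e / 2}"
      have "openin (hol_topology W) {g \<in> topspace (hol_topology W). (F \<circ> germ_of K W) g \<in> ?B}"
        by (rule openin_continuous_map_preimage[OF cW openin_Q_ball[OF p FaQ]]) (use e in simp)
      moreover have "f \<in> {g \<in> topspace (hol_topology W). (F \<circ> germ_of K W) g \<in> ?B}"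
        using f e FaQ nrm_zero[OF p] by (simp add: hol_topology_def aW[symmetric] fun_diff_def)
      ultimately obtain G d where "G \<subseteq> {sup_norm W}" "d > 0"
        and G: "seminorm_ball (hol_space W) G f d \<subseteq> {g \<in> topspace (hol_topology W). (F \<circ> germ_of K W) g \<in> ?B}"
        unfolding hol_topology_def
        by (rule openin_seminorm_topology_imp[OF distance_family_hol_space[OF bW]]) blast
      then have near: "nrm p (F (germ_of K W g) - F a) < e / 2"
        if "g \<in> hol_space W" "sup_norm W (g - f) < d" for g
        using that unfolding seminorm_ball_def by fastforce
      have "eventually (\<lambda>n. \<forall>z\<in>W. dist (r n z) (f z) < d / 2) sequentially"
        by (rule uniform_limitD[OF r(2)]) (use \<open>d > 0\<close> in simp)
      moreover have "eventually (\<lambda>n. nrm p (S n - germ_calculus a) < e / 2) sequentially"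
        using r(3) p e unfolding Q_limit_def by (intro order_tendstoD(2)) auto
      ultimately have "eventually (\<lambda>n. (\<forall>z\<in>W. dist (r n z) (f z) < d / 2) \<and> nrm p (S n - germ_calculus a) < e / 2) sequentially"
        by (rule eventually_conj)
      then obtain n where n: "\<And>z. z \<in> W \<Longrightarrow> dist (r n z) (f z) < d / 2" "nrm p (S n - germ_calculus a) < e / 2"
        by (metis (mono_tags, lifting) eventually_happens' sequentially_bot)
      have "sup_norm W (r n - f) \<le> d / 2"
        using n(1) \<open>d > 0\<close> by (intro sup_norm_least) (auto simp: dist_norm intro: less_imp_le)
      then have "nrm p (F (germ_of K W (r n)) - F a) < e / 2" using \<open>d > 0\<close> by (intro near rW) auto
      then have "nrm p (S n - F a) < e / 2" using morphism_on_rational[OF F W(1) r(1)] by simp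
      moreover have "nrm p (F a - germ_calculus a) \<le> nrm p (F a - S n) + nrm p (S n - germ_calculus a)"
        by (rule nrm_triangle[OF AQ SQ FaQ p])
      ultimately show "nrm p (F a - germ_calculus a) \<le> 0 + e"
        using n(2) nrm_diff_commute[OF p, of "F a" "S n"] by simp
    qed
  qed
qed

end

theorem corollary3p8:
  fixes sc :: "complex \<Rightarrow> 'a::{ab_group_add,t2_space} \<Rightarrow> 'a"
    and P :: "('a \<Rightarrow> real) set"
    and T :: "'a \<Rightarrow> 'a"
    and K :: "complex set"
  assumes "vector_space sc"
    and "lc_topology (UNIV :: 'a set) (+) sc euclidean"
    and "sequentially_complete (UNIV :: 'a set)"
    and "principal_calibration sc P"
    and "T \<in> Q_bounded_elements sc P"
    and K_def: "K = {z. Some z \<in> waelbroeck_spectrum sc P T}"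
  shows "\<exists>!F. unital_algebra_morphism sc P K F \<and>
              continuous_map (germ_topology K) (Q_topology sc P) F \<and>
              F (germ_entire K (\<lambda>z. z)) = T"
proof -
  interpret vector_space sc by (rule assms(1))
  interpret bounded_operator sc P T K
    by unfold_locales
      (use assms in \<open>auto simp: principal_calibration_def calibration_def\<close>)
  show ?thesis
    using germ_calculus_morphism germ_calculus_continuous germ_calculus_ident germ_calculus_unique
    by (intro ex1I[of _ germ_calculus]) blast+
qed

end
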